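(* Let $A$ be a finite non-empty subset of the extended lamplighter group $\mathbf{Z} \ltimes \mathbf{F}_2^{\mathbf{Z}}$ with $|A\cdot A| \le K|A|$ for some $K \ge 1$. Then $A$ is $O_K(1)$-controlled by a set $B$ which is of one of the following forms: (Case 1) $B = \{0\} \times V$ for some finite-dimensional subspace $V$ of $\mathbf{F}_2^{\mathbf{Z}}$. (Case 2) $B = \{ (n,\phi(n)+v) : n \in P, v \in V\}$, where $V$ is a $T^d$-invariant finite-dimensional subspace of $\mathbf{F}_2^{\mathbf{Z}}$ for some integer $d \ge 1$, $P \subset d\mathbf{Z}$ is a generalised arithmetic progression of rank $O_K(1)$, and $\phi: P \to \mathbf{F}_2^{\mathbf{Z}}$ is a function whose graph $n \mapsto (n,\phi(n))$ is a Freiman isomorphism modulo $V$, in the sense that $$(n_1,\phi(n_1)) \cdot (n_2,\phi(n_2)) = (n_3,\phi(n_3)) \cdot (n_4,\phi(n_4)) \text{ mod } V$$ whenever $n_1,n_2,n_3,n_4 \in P$ are such that $n_1+n_2=n_3+n_4$. If moreover $A \subset \mathbf{Z} \ltimes (\mathbf{F}_2^{\mathbf{Z}})_0$, then one can take $V$ to be a finite-dimensional subspace of $(\mathbf{F}_2^{\mathbf{Z}})_0$ in Case 1, and can take $V$ to be trivial in Case 2.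
   Context: $\mathbf{F}_2$ is the field of two elements; $\mathbf{F}_2^{\mathbf{Z}}$ is the additive group (and $\mathbf{F}_2$-vector space) of all sequences $(x_i)_{i\in\mathbf{Z}}$ with $x_i \in \mathbf{F}_2$; $(\mathbf{F}_2^{\mathbf{Z}})_0$ is the subgroup of sequences with at most finitely many non-zero entries. $T$ is the shift $T(x_i)_{i} := (x_{i-1})_{i}$, an automorphism of $\mathbf{F}_2^{\mathbf{Z}}$ preserving $(\mathbf{F}_2^{\mathbf{Z}})_0$. The extended lamplighter group $\mathbf{Z} \ltimes \mathbf{F}_2^{\mathbf{Z}}$ is the set of pairs $(n,x)$, $n \in \mathbf{Z}$, $x \in \mathbf{F}_2^{\mathbf{Z}}$, with group law $(n,x)\cdot(n',x') := (n+n', T^{n'}(x)+x')$. The lamplighter group $\mathbf{Z}\ltimes(\mathbf{F}_2^{\mathbf{Z}})_0$ is the subgroup of pairs with $x \in (\mathbf{F}_2^{\mathbf{Z}})_0$. Two elements $(n,x),(n',x')$ are equal mod $V$ if $n=n'$ and $x-x'\in V$. Product sets: $A \cdot B := \{ab : a\in A, b\in B\}$. $K$-control: for $K \ge 1$, a finite non-empty subset $A$ of a group $G$ is $K$-controlled by a finite non-empty subset $B$ of a subgroup of $G$ if $|B| \le K|A|$ and there is a finite non-empty $X \subset G$ with $|X| \le K$ and $A \subset (X\cdot B) \cap (B\cdot X)$. A generalised arithmetic progression of rank $r$ in an abelian group is a set of the form $\{n_1v_1+\dots+n_rv_r : n_i \in \mathbf{Z}, |n_i| \le N_i \text{ for all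 } i\}$ for some group elements $v_1,\dots,v_r$ and some real numbers $N_1,\dots,N_r \ge 1$. $O_K(1)$ denotes a quantity bounded by a constant depending only on $K$. *)

theory Defs
  imports Complex_Main "HOL-Algebra.Coset" "HOL-Library.Z2" "HOL-Library.Function_Algebras"
begin

text \<open>Sequences \<open>int \<Rightarrow> bit\<close> carry the pointwise group structure of
  \<open>Function_Algebras\<close>; \<open>bit\<close> is the field with two elements.\<close>

type_synonym seq = "int \<Rightarrow> bit"

definition seq_scale :: "bit \<Rightarrow> seq \<Rightarrow> seq" where
  "seq_scale c x = (\<lambda>i. c * x i)"

global_interpretation seq: vector_space seq_scale
  by unfold_locales (auto simp: seq_scale_def fun_eq_iff algebra_simps)

text \<open>The library's notion of a finite-dimensional space concerns a whole type, so for
  subspaces finite dimension is expressed by a finite spanning set.\<close>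

definition fin_dim_subspace :: "seq set \<Rightarrow> bool" where
  "fin_dim_subspace V \<longleftrightarrow> seq.subspace V \<and> (\<exists>S. finite S \<and> seq.span S = V)"

definition fin_supp_seqs :: "seq set" where
  "fin_supp_seqs = {x. finite {i. x i \<noteq> 0}}"

definition shift :: "seq \<Rightarrow> seq" where
  "shift x = (\<lambda>i. x (i - 1))"

definition shift_pow :: "int \<Rightarrow> seq \<Rightarrow> seq" where
  "shift_pow n = (if 0 \<le> n then shift ^^ nat n else (inv_into UNIV shift) ^^ nat (- n))"

lemma inv_shift: "inv_into UNIV shift = (\<lambda>x i. x (i + 1))"
  by (rule inv_unique_comp) (auto simp: shift_def fun_eq_iff)

lemma shift_pow_apply: "shift_pow n x = (\<lambda>i. x (i - n))"
proof -
  have 1: "(shift ^^ k) x = (\<lambda>i. x (i - int k))" for k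
    by (induction k) (auto simp: shift_def fun_eq_iff algebra_simps)
  have 2: "((inv_into UNIV shift) ^^ k) x = (\<lambda>i. x (i + int k))" for k
    by (induction k) (auto simp: inv_shift fun_eq_iff algebra_simps)
  show ?thesis
    by (auto simp: shift_pow_def 1 2)
qed

definition ext_lamplighter :: "(int \<times> seq) monoid" where
  "ext_lamplighter =
    \<lparr>carrier = UNIV,
     mult = (\<lambda>(n, x) (n', x'). (n + n', shift_pow n' x + x')),
     one = (0, 0)\<rparr>"

definition lamplighter :: "(int \<times> seq) set" where
  "lamplighter = UNIV \<times> fin_supp_seqs"

lemma group_ext_lamplighter: "group ext_lamplighter"
proof (rule groupI)
  fix a assume "a \<in> carrier ext_lamplighter"
  obtain n x where a: "a = (n, x)" by fastforce
  show "\<exists>b\<in>carrier ext_lamplighter. b \<otimes>\<^bsub>ext_lamplighter\<^esub> a = \<one>\<^bsub>ext_lamplighter\<^esub>"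
    by (rule bexI[of _ "(- n, - shift_pow (- n) x)"])
      (auto simp: a ext_lamplighter_def shift_pow_apply fun_eq_iff)
qed (auto simp: ext_lamplighter_def shift_pow_apply fun_eq_iff algebra_simps)

lemma subgroup_lamplighter: "subgroup lamplighter ext_lamplighter"
proof -
  interpret group ext_lamplighter by (rule group_ext_lamplighter)
  have shift: "shift_pow n x \<in> fin_supp_seqs" if "x \<in> fin_supp_seqs" for n x
  proof -
    have "{i. x (i - n) \<noteq> 0} = (\<lambda>i. i + n) ` {i. x i \<noteq> 0}"
      by (force simp: image_def)
    then show ?thesis
      using that by (simp add: fin_supp_seqs_def shift_pow_apply)
  qed
  have add: "x + y \<in> fin_supp_seqs" if "x \<in> fin_supp_seqs" "y \<in> fin_supp_seqs" for x y
  proof -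
    have "{i. (x + y) i \<noteq> 0} \<subseteq> {i. x i \<noteq> 0} \<union> {i. y i \<noteq> 0}"
      by auto
    then show ?thesis
      using that unfolding fin_supp_seqs_def mem_Collect_eq
      by (meson finite_UnI finite_subset)
  qed
  have inv_eq: "inv\<^bsub>ext_lamplighter\<^esub> (n, x) = (- n, - shift_pow (- n) x)" for n x
    by (rule inv_equality)
      (auto simp: ext_lamplighter_def shift_pow_apply fun_eq_iff)
  have neg: "- x \<in> fin_supp_seqs" if "x \<in> fin_supp_seqs" for x
    using that by (simp add: fin_supp_seqs_def)
  show ?thesis
  proof (rule subgroupI)
    show "lamplighter \<noteq> {}"
      by (auto simp: lamplighter_def fin_supp_seqs_def intro!: exI[of _ 0])
    show "inv\<^bsub>ext_lamplighter\<^esub> a \<in> lamplighter" if "a \<in> lamplighter" for a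
      using that by (cases a) (simp add: inv_eq lamplighter_def shift neg)
  qed (auto simp: lamplighter_def shift neg add ext_lamplighter_def)
qed

definition eq_mod :: "seq set \<Rightarrow> int \<times> seq \<Rightarrow> int \<times> seq \<Rightarrow> bool" where
  "eq_mod V g g' \<longleftrightarrow> fst g = fst g' \<and> snd g - snd g' \<in> V"

definition controlled :: "('a, 'b) monoid_scheme \<Rightarrow> real \<Rightarrow> 'a set \<Rightarrow> 'a set \<Rightarrow> bool" where
  "controlled G K A B \<longleftrightarrow>
    K \<ge> 1 \<and>
    finite A \<and> A \<noteq> {} \<and> A \<subseteq> carrier G \<and>
    finite B \<and> B \<noteq> {} \<and> B \<subseteq> carrier G \<and>
    real (card B) \<le> K * real (card A) \<and>
    (\<exists>X. finite X \<and> X \<noteq> {} \<and> X \<subseteq> carrier G \<and> real (card X) \<le> K \<and>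
         A \<subseteq> (X <#>\<^bsub>G\<^esub> B) \<inter> (B <#>\<^bsub>G\<^esub> X))"

text \<open>Generalised arithmetic progressions of rank \<open>r\<close> in the additive group of integers.\<close>

definition int_gap :: "nat \<Rightarrow> int set \<Rightarrow> bool" where
  "int_gap r P \<longleftrightarrow>
    (\<exists>(v :: nat \<Rightarrow> int) (N :: nat \<Rightarrow> real).
       (\<forall>i<r. N i \<ge> 1) \<and>
       P = {\<Sum>i<r. n i * v i | n :: nat \<Rightarrow> int. \<forall>i<r. real_of_int \<bar>n i\<bar> \<le> N i})"

definition case1_form :: "seq set \<Rightarrow> (int \<times> seq) set \<Rightarrow> bool" where
  "case1_form V B \<longleftrightarrow> fin_dim_subspace V \<and> B = {0} \<times> V"

text \<open>The argument \<open>R\<close> bounds the rank of the progression. Only the values of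
  \<open>\<phi>\<close> on \<open>P\<close> matter.\<close>

definition case2_form :: "real \<Rightarrow> seq set \<Rightarrow> (int \<times> seq) set \<Rightarrow> bool" where
  "case2_form R V B \<longleftrightarrow>
    fin_dim_subspace V \<and>
    (\<exists>(d :: int) (r :: nat) (P :: int set) (\<phi> :: int \<Rightarrow> seq).
       d \<ge> 1 \<and> shift_pow d ` V = V \<and>
       real r \<le> R \<and> int_gap r P \<and> P \<subseteq> {n. d dvd n} \<and>
       (\<forall>n1\<in>P. \<forall>n2\<in>P. \<forall>n3\<in>P. \<forall>n4\<in>P. n1 + n2 = n3 + n4 \<longrightarrow>
          eq_mod V ((n1, \<phi> n1) \<otimes>\<^bsub>ext_lamplighter\<^esub> (n2, \<phi> n2))
                   ((n3, \<phi> n3) \<otimes>\<^bsub>ext_lamplighter\<^esub> (n4, \<phi> n4))) \<and>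
       B = {(n, \<phi> n + v) | n v. n \<in> P \<and> v \<in> V})"

end

theory Submission
  imports Defs "HOL-Algebra.Elementary_Groups" "HOL-Computational_Algebra.Primes" "HOL-Library.FuncSet"
begin

text \<open>By Petridis' argument and the Ruzsa covering lemma, \<open>A\<close> may be replaced by a symmetric set \<open>S\<close>
  all of whose powers have size comparable to \<open>S\<close>. Freiman's theorem in the integers (Ruzsa's model
  lemma, Bogolyubov's lemma, geometry of numbers) covers the projection of \<open>S\<close> by few translates
  of a progression \<open>P\<close> contained in the projection of the eighth power of \<open>S\<close>. The part \<open>fiber S m\<close>
  of the \<open>m\<close>-th power lying over \<open>0\<close> spans a space of size comparable to \<open>fiber S 2\<close>, by Ruzsa covering
  in bounded torsion. Conjugation by elements over \<open>P\<close> shifts \<open>fiber S 32\<close> into \<open>fiber S 48\<close>, so adding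
  up its shifts along the long directions of \<open>P\<close> becomes stationary after boundedly many steps, at
  a space \<open>V\<close> invariant under these directions. As \<open>V\<close> contains \<open>fiber S 32\<close>, any choice of lifts of \<open>P\<close>
  to the eighth power of \<open>S\<close> is a Freiman homomorphism modulo \<open>V\<close>. If \<open>P\<close> has no long direction, one is in
  Case 1.\<close>

section \<open>Sets of small doubling in groups\<close>

text \<open>The numbers 32, 48 and \<open>kappa\<close> have to fit together. Two products of two
  lifts from the eighth power differ by an element of \<open>fiber S 32\<close> (16 + 16), so
  \<open>V\<close> must contain that fiber; conjugation by one more such lift leads to
  \<open>fiber S 48\<close>, as 48 = 32 + 2 * 8. The ratio \<open>kappa\<close> between the size of
  the span of \<open>fiber S 48\<close> and that of \<open>fiber S 2\<close> bounds the number of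
  steps in which the sum of shifts can grow. Each step uses one more generator of \<open>P\<close>,
  so a direction is usable only if it admits coefficients up to \<open>kappa\<close>. Shorter
  directions are discarded into the covering set, at a cost that depends on \<open>kappa\<close> and
  the rank alone. The integer \<open>d\<close> is the generator of the group of all shifts that
  preserve \<open>V\<close>, so it need not be bounded. For finitely supported \<open>A\<close> the
  same \<open>V\<close> and \<open>B\<close> work: a finite set of finitely supported sequences that
  is invariant under a positive shift has no nonzero member. In the integers, transporting a
  progression back from the cyclic model compares three values of the form a + b - c - e, which is
  why growth is controlled up to the 12-fold sumset.\<close>

context group
begin

lemma card_left_mult: "a \<in> carrier G \<Longrightarrow> B \<subseteq> carrier G \<Longrightarrow> card ((\<otimes>) a ` B) = card B"
  by (intro card_image inj_onI) (metis Units_eq Units_l_cancel subsetD)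

lemma set_multI: "x \<in> A \<Longrightarrow> y \<in> B \<Longrightarrow> x \<otimes> y \<in> A <#> B"
  by (auto simp: set_mult_def)

lemma set_multE:
  assumes "z \<in> A <#> B"
  obtains x y where "x \<in> A" "y \<in> B" "z = x \<otimes> y"
  using assms by (auto simp: set_mult_def)

lemma finite_set_mult: "finite A \<Longrightarrow> finite B \<Longrightarrow> finite (A <#> B)"
  by (auto simp: set_mult_def)

lemma set_mult_subset: "A \<subseteq> A' \<Longrightarrow> B \<subseteq> B' \<Longrightarrow> A <#> B \<subseteq> A' <#> B'"
  by (auto simp: set_mult_def)

lemma card_le_set_mult_left:
  assumes "finite A" "finite B" "A \<noteq> {}" "A \<subseteq> carrier G" "B \<subseteq> carrier G"
  shows "card B \<le> card (A <#> B)"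
proof -
  obtain a where a: "a \<in> A" using assms by auto
  have "(\<otimes>) a ` B \<subseteq> A <#> B" using a by (auto simp: set_mult_def)
  then show ?thesis
    using card_left_mult[of a B] card_mono[OF finite_set_mult[OF assms(1,2)]] a assms by (metis subsetD)
qed

lemma card_set_mult_le: "finite A \<Longrightarrow> finite B \<Longrightarrow> card (A <#> B) \<le> card A * card B"
proof -
  assume f: "finite A" "finite B"
  have "A <#> B = (\<lambda>(a,b). a \<otimes> b) ` (A \<times> B)" by (auto simp: set_mult_def)
  then show ?thesis using card_image_le[of "A \<times> B"] f by (simp add: card_cartesian_product)
qed

text \<open>Induction on \<open>C\<close>. When \<open>c\<close> joins, the \<open>x\<close> with
  \<open>c \<otimes> x\<close> already in \<open>C <#> X\<close> form \<open>Y\<close>, and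
  \<open>c\<close> times \<open>Y <#> A\<close> is old as well. So at most |XA| - |YA| elements are
  new, while |CX| grows by exactly |X| - |Y|; the lower bound \<open>min\<close> for |YA| and the
  equality for \<open>X\<close> close the step.\<close>

lemma petridis_step:
  assumes A: "finite A" "A \<subseteq> carrier G" and X: "finite X" "X \<subseteq> carrier G"
    and min: "\<And>Y. Y \<subseteq> X \<Longrightarrow> k * real (card Y) \<le> real (card (Y <#> A))"
    and eq: "real (card (X <#> A)) = k * real (card X)"
    and C: "finite C" "C \<subseteq> carrier G"
  shows "real (card (C <#> X <#> A)) \<le> k * real (card (C <#> X))"
  using C
proof (induction C rule: finite_induct)
  case empty
  then show ?case by (simp add: set_mult_def)
next
  case (insert c C)
  then have c: "c \<in> carrier G" and Cc: "C \<subseteq> carrier G" by auto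
  define Y where "Y = {x \<in> X. c \<otimes> x \<in> C <#> X}"
  have YX: "Y \<subseteq> X" by (auto simp: Y_def)
  have fin: "finite (C <#> X)" "finite (C <#> X <#> A)" "finite (X <#> A)" "finite Y"
    using insert X A YX by (auto intro!: finite_set_mult intro: finite_subset)
  have XAc: "X <#> A \<subseteq> carrier G" "Y <#> A \<subseteq> carrier G" "C <#> X \<subseteq> carrier G"
    using set_mult_closed X A YX Cc by (meson order_trans)+
  have YA: "Y <#> A \<subseteq> X <#> A" using YX by (intro set_mult_subset) auto
  have 1: "insert c C <#> X = (C <#> X) \<union> (\<otimes>) c ` (X - Y)"
    by (auto simp: set_mult_def Y_def image_iff)
  have disj: "(C <#> X) \<inter> (\<otimes>) c ` (X - Y) = {}"
    by (auto simp: Y_def)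
  have card1: "card (insert c C <#> X) = card (C <#> X) + (card X - card Y)"
  proof -
    have "card ((\<otimes>) c ` (X - Y)) = card X - card Y"
      using X YX c fin by (subst card_left_mult) (auto simp: card_Diff_subset)
    then show ?thesis
      unfolding 1 using fin X disj by (subst card_Un_disjoint) auto
  qed
  have 2: "insert c C <#> X <#> A \<subseteq> (C <#> X <#> A) \<union> (\<otimes>) c ` ((X <#> A) - (Y <#> A))"
  proof
    fix z assume "z \<in> insert c C <#> X <#> A"
    then obtain d x a where z: "d \<in> insert c C" "x \<in> X" "a \<in> A" "z = d \<otimes> x \<otimes> a"
      by (auto simp: set_mult_def)
    then have m: "d \<in> carrier G" "x \<in> carrier G" "a \<in> carrier G"
      using insert X A by auto
    show "z \<in> (C <#> X <#> A) \<union> (\<otimes>) c ` ((X <#> A) - (Y <#> A))"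
    proof (cases "d \<in> C")
      case True
      then have "z \<in> C <#> X <#> A" unfolding z(4) using z by (intro set_multI)
      then show ?thesis ..
    next
      case False
      then have [simp]: "d = c" using z by auto
      have zz: "z = c \<otimes> (x \<otimes> a)" using z m by (simp add: m_assoc)
      show ?thesis
      proof (cases "x \<otimes> a \<in> Y <#> A")
        case True
        then obtain y a' where y: "y \<in> Y" "a' \<in> A" "x \<otimes> a = y \<otimes> a'" by (auto elim: set_multE)
        then have "y \<in> carrier G" "a' \<in> carrier G" using YX X A by auto
        then have "z = (c \<otimes> y) \<otimes> a'" unfolding zz y(3) using c by (simp add: m_assoc)
        moreover have "c \<otimes> y \<in> C <#> X" using y by (simp add: Y_def)
        ultimately have "z \<in> C <#> X <#> A" using y by (auto intro: set_multI)
        then show ?thesis ..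
      next
        case False
        then show ?thesis unfolding zz using set_multI[OF z(2,3)] by blast
      qed
    qed
  qed
  have "card (insert c C <#> X <#> A) \<le> card (C <#> X <#> A) + card ((\<otimes>) c ` ((X <#> A) - (Y <#> A)))"
    using card_mono[OF _ 2] card_Un_le fin by (meson finite_Diff finite_UnI finite_imageI le_trans)
  also have "card ((\<otimes>) c ` ((X <#> A) - (Y <#> A))) = card (X <#> A) - card (Y <#> A)"
    using XAc fin YA c by (subst card_left_mult) (auto intro!: card_Diff_subset intro: finite_subset)
  finally have "real (card (insert c C <#> X <#> A))
      \<le> real (card (C <#> X <#> A)) + (real (card (X <#> A)) - real (card (Y <#> A)))"
    using card_mono[OF fin(3) YA] by (simp add: of_nat_diff)
  also have "\<dots> \<le> k * real (card (C <#> X)) + (k * real (card X) - k * real (card Y))"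
    using insert.IH Cc eq min[OF YX] by simp
  also have "\<dots> = k * real (card (insert c C <#> X))"
    using card1 card_mono[OF X(1) YX] by (simp add: of_nat_diff algebra_simps)
  finally show ?case .
qed

text \<open>\<open>X\<close> minimises |YA| / |Y| among the non-empty
  \<open>Y \<subseteq> A\<close>; as \<open>A\<close> itself competes, the minimum is at most
  \<open>K\<close>. That \<open>C\<close> is arbitrary is what makes up for the lack of
  commutativity.\<close>

lemma petridis:
  assumes A: "finite A" "A \<noteq> {}" "A \<subseteq> carrier G" and K: "real (card (A <#> A)) \<le> K * real (card A)"
  obtains X where "X \<subseteq> A" "X \<noteq> {}"
    "\<And>C. finite C \<Longrightarrow> C \<subseteq> carrier G \<Longrightarrow> real (card (C <#> X <#> A)) \<le> K * real (card (C <#> X))"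
proof -
  define rat where "rat = (\<lambda>Y. real (card (Y <#> A)) / real (card Y))"
  define F where "F = Pow A - {{}}"
  have F: "finite F" "F \<noteq> {}" using A by (auto simp: F_def)
  obtain X where X: "X \<in> F" "\<And>Y. Y \<in> F \<Longrightarrow> rat X \<le> rat Y"
    using arg_min_if_finite[OF F, of rat] by (metis linorder_not_less)
  have XA: "X \<subseteq> A" "X \<noteq> {}" "finite X" using X A by (auto simp: F_def intro: finite_subset)
  have cX: "card X > 0" using XA by (simp add: card_gt_0_iff)
  have "rat X \<le> rat A" using X(2)[of A] A by (auto simp: F_def)
  also have "\<dots> \<le> K" using K A by (simp add: rat_def divide_le_eq card_gt_0_iff)
  finally have rK: "rat X \<le> K" .
  have min: "rat X * real (card Y) \<le> real (card (Y <#> A))" if "Y \<subseteq> X" for Y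
  proof (cases "Y = {}")
    case False
    then have "Y \<in> F" "card Y > 0" using that XA finite_subset[OF that]
      by (auto simp: F_def card_gt_0_iff)
    then show ?thesis using X(2)[of Y] by (simp add: rat_def field_simps)
  qed auto
  have eq: "real (card (X <#> A)) = rat X * real (card X)"
    using cX by (simp add: rat_def)
  show ?thesis
  proof (rule that[OF XA(1,2)])
    fix C assume C: "finite C" "C \<subseteq> carrier G"
    have "real (card (C <#> X <#> A)) \<le> rat X * real (card (C <#> X))"
      using petridis_step[OF A(1,3) XA(3) _ min eq C] XA A by auto
    also have "\<dots> \<le> K * real (card (C <#> X))" using rK by (intro mult_right_mono) auto
    finally show "real (card (C <#> X <#> A)) \<le> K * real (card (C <#> X))" .
  qed
qed

text \<open>Fix one factorisation z = u w for each \<open>z\<close> (this is \<open>r\<close>). The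
  map sending (z, v) to (u v^-1, v w) is injective: the product of the two entries returns
  \<open>z\<close>, hence \<open>w\<close>, and then the second entry returns
  \<open>v\<close>.\<close>

lemma ruzsa_triangle:
  assumes "finite U" "finite V" "finite W" "U \<subseteq> carrier G" "V \<subseteq> carrier G" "W \<subseteq> carrier G"
  shows "card (U <#> W) * card V \<le> card (U <#> m_inv G ` V) * card (V <#> W)"
proof -
  define r where "r = (\<lambda>z. SOME p. fst p \<in> U \<and> snd p \<in> W \<and> z = fst p \<otimes> snd p)"
  have r: "fst (r z) \<in> U \<and> snd (r z) \<in> W \<and> z = fst (r z) \<otimes> snd (r z)" if "z \<in> U <#> W" for z
  proof -
    have "\<exists>p. fst p \<in> U \<and> snd p \<in> W \<and> z = fst p \<otimes> snd p"
      using that by (auto simp: set_mult_def)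
    from someI_ex[OF this] show ?thesis by (simp add: r_def)
  qed
  define f where "f = (\<lambda>(z,v). (fst (r z) \<otimes> inv v, v \<otimes> snd (r z)))"
  have prod: "fst (f (z,v)) \<otimes> snd (f (z,v)) = z" if "z \<in> U <#> W" "v \<in> V" for z v
  proof -
    have m: "fst (r z) \<in> carrier G" "snd (r z) \<in> carrier G" "v \<in> carrier G"
      using r[OF that(1)] that assms by auto
    then have "fst (r z) \<otimes> inv v \<otimes> (v \<otimes> snd (r z)) = fst (r z) \<otimes> (inv v \<otimes> v) \<otimes> snd (r z)"
      by (metis (no_types, lifting) inv_closed m_assoc m_closed)
    also have "\<dots> = fst (r z) \<otimes> snd (r z)" using m by simp
    finally show ?thesis using r[OF that(1)] by (simp add: f_def)
  qed
  have "inj_on f ((U <#> W) \<times> V)"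
  proof (rule inj_onI, clarify)
    fix z v z' v' assume h: "z \<in> U <#> W" "z' \<in> U <#> W" "v \<in> V" "v' \<in> V" "f (z,v) = f (z',v')"
    have zz: "z = z'" using prod[OF h(1,3)] prod[OF h(2,4)] h(5) by simp
    have "v \<otimes> snd (r z) = v' \<otimes> snd (r z)" using h(5) zz by (simp add: f_def)
    moreover have "snd (r z) \<in> carrier G" using r[OF h(1)] assms by auto
    ultimately show "z = z' \<and> v = v'" using zz h assms by (metis right_cancel subsetD)
  qed
  moreover have "f ` ((U <#> W) \<times> V) \<subseteq> (U <#> m_inv G ` V) \<times> (V <#> W)"
    using r by (auto simp: f_def intro!: set_multI)
  ultimately have "card ((U <#> W) \<times> V) \<le> card ((U <#> m_inv G ` V) \<times> (V <#> W))"
    using assms by (intro card_inj_on_le[of f]) (auto intro!: finite_set_mult)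
  then show ?thesis by (simp add: card_cartesian_product)
qed

text \<open>\<open>Y\<close> is a largest subset of \<open>A\<close> with pairwise disjoint
  translates yX. Disjointness inside AX bounds its size; maximality makes every aX meet some yX, so
  that a lies in y X X^-1.\<close>

lemma ruzsa_covering:
  assumes A: "finite A" "A \<subseteq> carrier G" and X: "finite X" "X \<noteq> {}" "X \<subseteq> carrier G"
    and K: "real (card (A <#> X)) \<le> K * real (card X)"
  obtains Y where "Y \<subseteq> A" "real (card Y) \<le> K" "A \<subseteq> Y <#> (X <#> m_inv G ` X)"
proof -
  define D where "D = {Y. Y \<subseteq> A \<and> (\<forall>y\<in>Y. \<forall>y'\<in>Y. y \<noteq> y' \<longrightarrow> (\<otimes>) y ` X \<inter> (\<otimes>) y' ` X = {})}"
  have D: "finite D" "{} \<in> D" using A by (auto simp: D_def)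
  obtain Y where Y: "Y \<in> D" "\<And>Z. Z \<in> D \<Longrightarrow> card Z \<le> card Y"
    using obtains_MAX[OF D(1), of card] D by (metis (no_types, lifting) Max_ge empty_iff finite_imageI imageI)
  have YA: "Y \<subseteq> A" "finite Y" using Y A by (auto simp: D_def intro: finite_subset)
  have "card Y * card X = (\<Sum>y\<in>Y. card ((\<otimes>) y ` X))"
    using YA A X by (subst sum.cong[OF refl card_left_mult]) auto
  also have "\<dots> = card (\<Union>y\<in>Y. (\<otimes>) y ` X)"
    using Y YA X by (subst card_UN_disjoint) (auto simp: D_def)
  also have "\<dots> \<le> card (A <#> X)"
    using YA A X by (intro card_mono finite_set_mult) (auto simp: set_mult_def)
  finally have "real (card Y) * real (card X) \<le> K * real (card X)"
    using K by (metis of_nat_le_iff of_nat_mult order_trans)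
  then have cY: "real (card Y) \<le> K" using X by (simp add: card_gt_0_iff)
  have "A \<subseteq> Y <#> (X <#> m_inv G ` X)"
  proof
    fix a assume a: "a \<in> A"
    have "\<exists>y\<in>Y. \<exists>x\<in>X. \<exists>x'\<in>X. a \<otimes> x = y \<otimes> x'"
    proof (cases "a \<in> Y")
      case True then show ?thesis using X by blast
    next
      case False
      then have "card (insert a Y) > card Y" using YA by simp
      then have "insert a Y \<notin> D" using Y(2) by fastforce
      then obtain y where "y \<in> Y" "(\<otimes>) a ` X \<inter> (\<otimes>) y ` X \<noteq> {}"
        using a Y(1) unfolding D_def by simp blast
      then obtain x x' where "x \<in> X" "x' \<in> X" "a \<otimes> x = y \<otimes> x'" by auto
      then show ?thesis using \<open>y \<in> Y\<close> by blast
    qed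
    then obtain y x x' where yx: "y \<in> Y" "x \<in> X" "x' \<in> X" "a \<otimes> x = y \<otimes> x'" by auto
    then have m: "y \<in> carrier G" "x \<in> carrier G" "x' \<in> carrier G" "a \<in> carrier G"
      using YA A X a by auto
    have "a = y \<otimes> (x' \<otimes> inv x)"
      using m yx(4) by (metis inv_closed inv_solve_right m_assoc m_closed)
    then show "a \<in> Y <#> (X <#> m_inv G ` X)" using yx by (auto intro!: set_multI)
  qed
  then show ?thesis using that YA cY by blast
qed


lemma set_inv_set_mult:
  assumes "A \<subseteq> carrier G" "B \<subseteq> carrier G"
  shows "m_inv G ` (A <#> B) = m_inv G ` B <#> m_inv G ` A"
proof -
  have "inv (a \<otimes> b) = inv b \<otimes> inv a" if "a \<in> A" "b \<in> B" for a b
    using that assms by (simp add: inv_mult_group subsetD)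
  then show ?thesis
    unfolding set_mult_def by (auto intro!: imageI) (metis (no_types, lifting) UN_I imageI singletonI)
qed

lemma set_inv_inv: "A \<subseteq> carrier G \<Longrightarrow> m_inv G ` m_inv G ` A = A"
proof -
  assume "A \<subseteq> carrier G"
  then have "inv (inv x) = x" if "x \<in> A" for x
    using that by (simp add: subsetD)
  then show ?thesis by (simp add: image_image)
qed

lemma set_inv_closed: "A \<subseteq> carrier G \<Longrightarrow> m_inv G ` A \<subseteq> carrier G"
  by auto

lemma card_set_inv: "A \<subseteq> carrier G \<Longrightarrow> card (m_inv G ` A) = card A"
  by (intro card_image inj_on_subset[OF inv_inj])

end

section \<open>Powers of a set, and the passage to a symmetric set with controlled powers\<close>

primrec set_pow :: "('a, 'b) monoid_scheme \<Rightarrow> 'a set \<Rightarrow> nat \<Rightarrow> 'a set" where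
  "set_pow G S 0 = {\<one>\<^bsub>G\<^esub>}"
| "set_pow G S (Suc k) = S <#>\<^bsub>G\<^esub> set_pow G S k"

context group
begin

lemma set_pow_closed: "S \<subseteq> carrier G \<Longrightarrow> set_pow G S k \<subseteq> carrier G"
  by (induction k) (auto simp: set_mult_def)

lemma finite_set_pow: "finite S \<Longrightarrow> finite (set_pow G S k)"
  by (induction k) (auto intro: finite_set_mult)

lemma set_one_mult: "S \<subseteq> carrier G \<Longrightarrow> {\<one>} <#> S = S"
proof -
  assume "S \<subseteq> carrier G"
  then have "\<one> \<otimes> s = s" if "s \<in> S" for s using that by auto
  then show ?thesis by (simp add: set_mult_def)
qed

lemma set_mult_one: "S \<subseteq> carrier G \<Longrightarrow> S <#> {\<one>} = S"
proof -
  assume "S \<subseteq> carrier G"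
  then have "s \<otimes> \<one> = s" if "s \<in> S" for s using that by auto
  then show ?thesis by (simp add: set_mult_def)
qed

lemma set_pow_1: "S \<subseteq> carrier G \<Longrightarrow> set_pow G S (Suc 0) = S"
  by (simp add: set_mult_one)

lemma set_pow_add: "S \<subseteq> carrier G \<Longrightarrow> set_pow G S (a + b) = set_pow G S a <#> set_pow G S b"
proof (induction a)
  case 0
  then show ?case by (simp add: set_one_mult set_pow_closed)
next
  case (Suc a)
  then show ?case by (simp add: set_pow_closed set_mult_assoc)
qed

lemma set_pow_multI:
  "S \<subseteq> carrier G \<Longrightarrow> x \<in> set_pow G S a \<Longrightarrow> y \<in> set_pow G S b \<Longrightarrow> x \<otimes> y \<in> set_pow G S (a + b)"
  by (simp add: set_pow_add set_multI)

lemma set_pow_mono: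
  assumes "S \<subseteq> carrier G" "\<one> \<in> S" "a \<le> b"
  shows "set_pow G S a \<subseteq> set_pow G S b"
proof -
  have "set_pow G S k \<subseteq> set_pow G S (Suc k)" for k
  proof
    fix x assume x: "x \<in> set_pow G S k"
    then have "\<one> \<otimes> x \<in> set_pow G S (Suc k)" using assms by (auto intro: set_multI)
    then show "x \<in> set_pow G S (Suc k)" using x set_pow_closed[of S k] assms by auto
  qed
  then show ?thesis using assms(3) by (rule lift_Suc_mono_le)
qed

lemma one_in_set_pow: "\<one> \<in> S \<Longrightarrow> \<one> \<in> set_pow G S k"
proof (induction k)
  case (Suc k)
  then have "\<one> \<otimes> \<one> \<in> S <#> set_pow G S k" by (intro set_multI)
  then show ?case by simp
qed simp

lemma set_pow_inv:
  assumes "S \<subseteq> carrier G" "\<And>s. s \<in> S \<Longrightarrow> inv s \<in> S" "x \<in> set_pow G S k"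
  shows "inv x \<in> set_pow G S k"
  using assms(3)
proof (induction k arbitrary: x)
  case (Suc k)
  then obtain s y where x: "s \<in> S" "y \<in> set_pow G S k" "x = s \<otimes> y" by (auto elim: set_multE)
  then have "inv x = inv y \<otimes> inv s"
    using assms(1) set_pow_closed[OF assms(1)] by (metis inv_mult_group subsetD)
  also have "\<dots> \<in> set_pow G S (k + Suc 0)"
    using x Suc.IH assms by (intro set_pow_multI) (simp_all add: set_mult_one)
  finally show ?case by simp
qed auto

text \<open>The triangle inequality with the symmetric set \<open>S\<close> in the middle gives
  |S^(m+3)| |S| \<le> |S^3| |S^(m+2)|, so from the third power on every further factor costs
  \<open>c\<close>.\<close>

lemma card_set_pow_le:
  assumes S: "finite S" "\<one> \<in> S" "S \<subseteq> carrier G" and inv: "\<And>s. s \<in> S \<Longrightarrow> inv s \<in> S"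
    and c: "real (card (set_pow G S 3)) \<le> c * real (card S)" "c \<ge> 1"
  shows "real (card (set_pow G S m)) \<le> c ^ m * real (card S)"
proof -
  have cS: "card S > 0" using S by (auto simp: card_gt_0_iff)
  have invS: "m_inv G ` S = S"
  proof
    show "m_inv G ` S \<subseteq> S" by (rule image_subsetI) (rule inv)
    show "S \<subseteq> m_inv G ` S"
    proof
      fix s assume s: "s \<in> S"
      show "s \<in> m_inv G ` S"
        using inv_inv[OF subsetD[OF S(3) s]] inv[OF s] by (rule image_eqI[OF sym])
    qed
  qed
  have step: "real (card (set_pow G S (Suc (Suc (Suc m))))) \<le> c * real (card (set_pow G S (Suc (Suc m))))" for m
  proof -
    have "card (set_pow G S 2 <#> set_pow G S (Suc m)) * card S
        \<le> card (set_pow G S 2 <#> m_inv G ` S) * card (S <#> set_pow G S (Suc m))"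
      using S by (intro ruzsa_triangle) (simp_all only: finite_set_pow set_pow_closed)
    moreover have "set_pow G S 2 <#> set_pow G S (Suc m) = set_pow G S (Suc (Suc (Suc m)))"
      using set_pow_add[of S 2 "Suc m"] S by simp
    moreover have "set_pow G S 2 <#> m_inv G ` S = set_pow G S 3"
      using set_pow_add[of S 2 1] S by (simp add: invS set_pow_1 eval_nat_numeral set_mult_one)
    ultimately have "real (card (set_pow G S (Suc (Suc (Suc m))))) * card S \<le> card (set_pow G S 3) * real (card (set_pow G S (Suc (Suc m))))"
      unfolding of_nat_mult[symmetric] of_nat_le_iff by simp
    also have "\<dots> \<le> c * real (card S) * real (card (set_pow G S (Suc (Suc m))))"
      using c by (intro mult_right_mono) auto
    finally have "real (card (set_pow G S (Suc (Suc (Suc m))))) * card S \<le> (c * real (card (set_pow G S (Suc (Suc m))))) * card S"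
      by (simp add: algebra_simps)
    then show ?thesis using cS by simp
  qed
  have base: "real (card (set_pow G S (Suc (Suc 0)))) \<le> c * real (card S)"
  proof -
    have "card (set_pow G S (Suc (Suc 0))) \<le> card (set_pow G S 3)"
      using card_mono[OF finite_set_pow[OF S(1)] set_pow_mono[OF S(3,2), of "Suc (Suc 0)" 3]] by simp
    then show ?thesis using c(1) by linarith
  qed
  consider "m = 0" | "m = Suc 0" | n where "m = Suc (Suc n)" by (metis not0_implies_Suc)
  then show ?thesis
  proof cases
    case 1 then show ?thesis using cS by simp
  next
    case 2 then show ?thesis using c S cS by (simp add: set_mult_one)
  next
    case 3
    have "real (card (set_pow G S (Suc (Suc n)))) \<le> c ^ Suc (Suc n) * real (card S)"
    proof (induction n)
      case 0
      have "c * real (card S) \<le> c * (c * real (card S))"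
        using c cS by (intro mult_left_mono) auto
      then show ?case using base by simp
    next
      case (Suc n)
      have "c * real (card (set_pow G S (Suc (Suc n)))) \<le> c * (c ^ Suc (Suc n) * real (card S))"
        using Suc c by (intro mult_left_mono) auto
      then show ?case using step[of n] by (simp add: mult.assoc)
    qed
    then show ?thesis using 3 by simp
  qed
qed

text \<open>Measured relative to the middle set \<open>V\<close>, the constants of the triangle
  inequality multiply, which makes it convenient to chain applications.\<close>

lemma ruzsa_triangle_bound:
  assumes f: "finite U" "finite V" "finite W" "V \<noteq> {}"
    and c: "U \<subseteq> carrier G" "V \<subseteq> carrier G" "W \<subseteq> carrier G"
    and 1: "real (card (U <#> m_inv G ` V)) \<le> a * real (card V)"
    and 2: "real (card (V <#> W)) \<le> b * real (card V)"
  shows "real (card (U <#> W)) \<le> a * b * real (card V)"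
proof -
  have cV: "real (card V) > 0" using f by (simp add: card_gt_0_iff)
  have "real (card (U <#> W)) * real (card V) \<le> real (card (U <#> m_inv G ` V)) * real (card (V <#> W))"
    using ruzsa_triangle[OF f(1-3) c] by (metis of_nat_le_iff of_nat_mult)
  also have "\<dots> \<le> (a * real (card V)) * (b * real (card V))"
    using order_trans[OF of_nat_0_le_iff 1] by (intro mult_mono[OF 1 2]) simp_all
  finally show ?thesis using cV by (simp add: algebra_simps)
qed

text \<open>Petridis' set \<open>X\<close> bounds products without inverses. Each use of the
  triangle inequality, with \<open>X\<close> or its inverse \<open>X'\<close> in the middle, trades
  two known bounds for one with more inverted factors, until the third power of S = X^-1 X is
  reached. The exponent 36 is 3 * 12, from |S^3| \<le> k^12 |X| with k = K^3.\<close>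

lemma approximate_group_of_small_doubling:
  assumes A: "finite A" "A \<noteq> {}" "A \<subseteq> carrier G" and K: "real (card (A <#> A)) \<le> K * real (card A)" "K \<ge> 1"
  obtains S Y where "finite S" "\<one> \<in> S" "\<And>s. s \<in> S \<Longrightarrow> inv s \<in> S" "S \<subseteq> m_inv G ` A <#> A"
    "\<And>m. real (card (set_pow G S m)) \<le> (K ^ 36) ^ m * real (card S)"
    "real (card S) \<le> K ^ 9 * real (card A)"
    "finite Y" "Y \<subseteq> carrier G" "real (card Y) \<le> 2 * K ^ 8"
    "A \<subseteq> Y <#> set_pow G S 2" "A \<subseteq> set_pow G S 2 <#> Y"
proof -
  obtain X where X: "X \<subseteq> A" "X \<noteq> {}" and pet:
    "\<And>C. finite C \<Longrightarrow> C \<subseteq> carrier G \<Longrightarrow> real (card (C <#> X <#> A)) \<le> K * real (card (C <#> X))"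
    using petridis[OF A K(1)] by metis
  have Xf: "finite X" "X \<subseteq> carrier G" using X A by (auto intro: finite_subset)
  define X' where "X' = m_inv G ` X"
  have X': "finite X'" "X' \<noteq> {}" "X' \<subseteq> carrier G" "m_inv G ` X' = X" "card X' = card X"
    using X Xf by (auto simp: X'_def set_inv_inv card_set_inv)
  note cl = Xf(2) X'(3) A(3) set_mult_closed set_inv_closed
  note fin = Xf(1) X'(1) A(1) finite_set_mult finite_imageI
  \<comment> \<open>The bound for |XXA| relative to |X|: one factor \<open>K\<close> from Petridis
    and \<open>K ^ 2\<close> from |XX| \<le> |AA|.\<close>
  define k where "k = K ^ 3"
  have k: "k \<ge> 1" using K by (simp add: k_def)
  have AX: "real (card A) \<le> K * real (card X)"
  proof -
    have "card A \<le> card (X <#> A)" using card_le_set_mult_left[OF Xf(1) A(1) X(2) Xf(2) A(3)] .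
    moreover have "real (card (X <#> A)) \<le> K * real (card X)"
      using pet[of "{\<one>}"] Xf by (simp add: set_one_mult)
    ultimately show ?thesis by simp
  qed
  have AA: "real (card (A <#> A)) \<le> K ^ 2 * real (card X)"
    using order_trans[OF K(1) mult_left_mono[OF AX]] K(2) by (simp add: power2_eq_square mult.assoc)
  have sub: "real (card (C <#> D)) \<le> K ^ 2 * real (card X)" if "C \<subseteq> A" "D \<subseteq> A" for C D
    using card_mono[OF finite_set_mult[OF A(1) A(1)] set_mult_subset[OF that]] AA by linarith
  have XXA: "real (card (X <#> X <#> A)) \<le> k * real (card X)"
    using order_trans[OF pet[OF Xf] mult_left_mono[OF sub[OF X(1) X(1)]]] K(2)
    by (simp add: k_def eval_nat_numeral mult.assoc)
  have XXX: "real (card (X <#> X <#> X)) \<le> k * real (card X)"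
    using card_mono[OF _ set_mult_subset[OF subset_refl X(1), of "X <#> X"]] XXA
    by (meson fin of_nat_mono order_trans)
  have "K ^ 2 \<le> k" using K by (simp add: k_def power_increasing)
  then have XX: "real (card (X <#> X)) \<le> k * real (card X)"
    using sub[OF X(1) X(1)] by (meson mult_right_mono of_nat_0_le_iff order_trans)
  have X'X': "card (X' <#> X') = card (X <#> X)"
    unfolding X'_def by (metis card_set_inv cl(4) set_inv_set_mult Xf(2))
  have X'X'X': "card (X' <#> X' <#> X') = card (X <#> X <#> X)"
  proof -
    have "X' <#> X' <#> X' = m_inv G ` (X <#> X <#> X)"
      by (simp add: X'_def cl set_inv_set_mult set_mult_assoc)
    then show ?thesis using cl by (simp add: card_set_inv)
  qed
  have 1: "real (card (X' <#> X' <#> X)) \<le> k ^ 2 * real (card X)"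
    using ruzsa_triangle_bound[of "X' <#> X'" X X k k] XXX XX X'X'X' X fin cl X'_def
    by (simp add: power2_eq_square)
  have 2: "real (card (X <#> X' <#> X)) \<le> k ^ 3 * real (card X)"
    using ruzsa_triangle_bound[of X X' "X' <#> X" k "k ^ 2"] 1 XX X' fin cl
    by (simp add: set_mult_assoc eval_nat_numeral)
  define S where "S = X' <#> X"
  have S: "finite S" "S \<subseteq> carrier G" unfolding S_def using fin cl by auto
  have 3: "real (card (X' <#> X <#> X')) \<le> k ^ 3 * real (card X)"
  proof -
    have "X' <#> X <#> X' = m_inv G ` (X <#> X' <#> X)"
      using cl by (simp add: X'_def set_inv_set_mult set_mult_assoc set_inv_inv)
    then show ?thesis using 2 cl by (simp add: card_set_inv)
  qed
  have 4: "real (card (S <#> S)) \<le> k ^ 6 * real (card X)"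
    using ruzsa_triangle_bound[of S X S "k ^ 3" "k ^ 3"] 2 3 X fin cl X'_def unfolding S_def
    by (simp add: set_mult_assoc flip: power_add)
  have 5: "real (card (S <#> X' <#> (X <#> S))) \<le> k ^ 12 * real (card X)"
    using ruzsa_triangle_bound[of "S <#> X'" X' "X <#> S" "k ^ 6" "k ^ 6"] 4 X' fin cl S
    by (simp add: set_mult_assoc S_def flip: power_add)
  have XS: "card X \<le> card S"
    unfolding S_def using card_le_set_mult_left[OF X'(1) Xf(1) X'(2,3) Xf(2)] .
  have SX: "real (card S) \<le> k ^ 3 * real (card X)"
    using card_le_set_mult_left[OF Xf(1) S(1) X(2) Xf(2) S(2)] 2 cl
    by (simp add: S_def set_mult_assoc)
  have one: "\<one> \<in> S"
  proof -
    obtain x where x: "x \<in> X" using X by auto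
    then have "inv x \<otimes> x \<in> S" unfolding S_def X'_def by (intro set_multI) auto
    then show ?thesis using x Xf by (simp add: subsetD)
  qed
  have invS: "m_inv G ` S = S"
    unfolding S_def using cl X' by (simp add: set_inv_set_mult X'_def[symmetric])
  have S3: "set_pow G S 3 = S <#> X' <#> (X <#> S)"
    using cl S by (simp add: eval_nat_numeral set_mult_one set_mult_assoc S_def)
  have "real (card (set_pow G S 3)) \<le> k ^ 12 * real (card S)"
    unfolding S3 using 5 XS k by (smt (verit, best) mult_left_mono of_nat_mono zero_le_power)
  then have pow: "real (card (set_pow G S m)) \<le> (k ^ 12) ^ m * real (card S)" for m
    using card_set_pow_le[OF S(1) one S(2) _ _ one_le_power[OF k]] invS by blast
  have S2: "S <#> m_inv G ` S = set_pow G S 2"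
    by (simp add: invS eval_nat_numeral set_mult_one S(2))
  have mono: "K ^ n * real (card X) \<le> K ^ n * real (card S)" for n
    using XS K by (intro mult_left_mono) auto
  have "real (card (A <#> S)) \<le> K ^ 2 * k ^ 2 * real (card X)"
    using ruzsa_triangle_bound[of A X' S "K ^ 2" "k ^ 2"] 1 sub[of A X] X X' fin cl S
    by (simp add: S_def set_mult_assoc)
  then have "real (card (A <#> S)) \<le> K ^ 8 * real (card S)"
    using mono[of 8] by (simp add: k_def flip: power_mult power_add)
  from ruzsa_covering[OF A(1,3) S(1) _ S(2) this] one obtain Y1 where
    Y1: "Y1 \<subseteq> A" "real (card Y1) \<le> K ^ 8" "A \<subseteq> Y1 <#> set_pow G S 2"
    unfolding S2 by (metis empty_iff)
  \<comment> \<open>The covering lemma puts the translates on the left only. Applying it to A^-1 and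
    inverting gives the cover of \<open>A\<close> with translates on the right; this is the size
    bound it needs.\<close>
  have "real (card (X' <#> (X <#> A))) \<le> k * k * real (card X)"
    using ruzsa_triangle_bound[of X' X "X <#> A" k k] XXA XX X fin cl X'X'
    by (simp add: set_mult_assoc X'_def[symmetric])
  moreover have "card (m_inv G ` A <#> S) = card (X' <#> (X <#> A))"
  proof -
    have "m_inv G ` A <#> S = m_inv G ` (S <#> A)"
      using S A by (simp add: set_inv_set_mult invS)
    then show ?thesis using cl S by (simp add: card_set_inv S_def set_mult_assoc)
  qed
  ultimately have "real (card (m_inv G ` A <#> S)) \<le> K ^ 6 * real (card S)"
    using mono[of 6] by (simp add: k_def flip: power_mult power_add)
  also have "\<dots> \<le> K ^ 8 * real (card S)"
    using K by (intro mult_right_mono power_increasing) auto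
  finally have "real (card (m_inv G ` A <#> S)) \<le> K ^ 8 * real (card S)" .
  from ruzsa_covering[OF finite_imageI[OF A(1)] set_inv_closed[OF A(3)] S(1) _ S(2) this] one obtain Y2 where
    Y2: "Y2 \<subseteq> m_inv G ` A" "real (card Y2) \<le> K ^ 8" "m_inv G ` A \<subseteq> Y2 <#> set_pow G S 2"
    unfolding S2 by (metis empty_iff)
  have Y2c: "Y2 \<subseteq> carrier G" "finite Y2" using Y2 A by (auto intro: finite_subset)
  have "A = m_inv G ` m_inv G ` A" using A by (simp add: set_inv_inv)
  also have "\<dots> \<subseteq> m_inv G ` (Y2 <#> set_pow G S 2)" using Y2(3) by blast
  also have "\<dots> = set_pow G S 2 <#> m_inv G ` Y2"
    using Y2c S by (simp add: set_inv_set_mult S2[symmetric] invS set_mult_closed)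
  finally have A2: "A \<subseteq> set_pow G S 2 <#> m_inv G ` Y2" .
  define Y where "Y = Y1 \<union> m_inv G ` Y2"
  show ?thesis
  proof (rule that[of S Y])
    show "finite Y" "Y \<subseteq> carrier G" using Y1 Y2c A by (auto simp: Y_def intro: finite_subset)
    have "card Y \<le> card Y1 + card Y2"
      using card_Un_le[of Y1 "m_inv G ` Y2"] Y2c by (simp add: Y_def card_set_inv)
    then show "real (card Y) \<le> 2 * K ^ 8" using Y1 Y2 by linarith
    show "A \<subseteq> Y <#> set_pow G S 2"
      using Y1(3) set_mult_subset[of Y1 Y "set_pow G S 2" "set_pow G S 2"] by (auto simp: Y_def)
    show "A \<subseteq> set_pow G S 2 <#> Y"
      using A2 set_mult_subset[of "set_pow G S 2" "set_pow G S 2" "m_inv G ` Y2" Y] by (auto simp: Y_def)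
    have "card X \<le> card A" using X A by (simp add: card_mono)
    then show "real (card S) \<le> K ^ 9 * real (card A)"
      using order_trans[OF SX mult_left_mono[of "real (card X)" "real (card A)" "k ^ 3"]] k K(2)
      by (simp add: k_def flip: power_mult)
    show "S \<subseteq> m_inv G ` A <#> A"
      unfolding S_def X'_def using X by (intro set_mult_subset) auto
    show "real (card (set_pow G S m)) \<le> (K ^ 36) ^ m * real (card S)" for m
      using pow[of m] by (simp add: k_def flip: power_mult)
    show "inv s \<in> S" if "s \<in> S" for s using that invS by blast
  qed (use S one in auto)
qed

lemma set_pow_set_pow:
  assumes "S \<subseteq> carrier G"
  shows "set_pow G (set_pow G S a) b = set_pow G S (b * a)"
  by (induction b) (simp_all add: set_pow_add[OF assms])

lemma set_pow_subset_subgroup: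
  assumes "subgroup H G" "S \<subseteq> H"
  shows "set_pow G S k \<subseteq> H"
  using assms by (induction k) (auto simp: set_mult_def subgroup.one_closed intro: subgroup.m_closed)

text \<open>Replacing \<open>S\<close> by its square \<open>T\<close> lets the covering be stated
  with the set itself; hence 72 = 2 * 36 and 81 = 2 * 36 + 9. The clause on subgroups
  \<open>H\<close> later keeps everything finitely supported when \<open>A\<close> is.\<close>

lemma approximate_group_covering:
  assumes A: "finite A" "A \<noteq> {}" "A \<subseteq> carrier G" and K: "real (card (A <#> A)) \<le> K * real (card A)" "K \<ge> 1"
  obtains S Y where "finite S" "\<one> \<in> S" "S \<subseteq> carrier G" "\<And>s. s \<in> S \<Longrightarrow> inv s \<in> S"
    "\<And>H. subgroup H G \<Longrightarrow> A \<subseteq> H \<Longrightarrow> S \<subseteq> H"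
    "\<And>m. real (card (set_pow G S m)) \<le> (K ^ 72) ^ m * real (card S)"
    "real (card S) \<le> K ^ 81 * real (card A)"
    "finite Y" "Y \<subseteq> carrier G" "real (card Y) \<le> 2 * K ^ 8" "A \<subseteq> Y <#> S" "A \<subseteq> S <#> Y"
proof -
  obtain S Y where S: "finite S" "\<one> \<in> S" "\<And>s. s \<in> S \<Longrightarrow> inv s \<in> S" "S \<subseteq> m_inv G ` A <#> A"
    "\<And>m. real (card (set_pow G S m)) \<le> (K ^ 36) ^ m * real (card S)"
    "real (card S) \<le> K ^ 9 * real (card A)"
    and Y: "finite Y" "Y \<subseteq> carrier G" "real (card Y) \<le> 2 * K ^ 8"
    "A \<subseteq> Y <#> set_pow G S 2" "A \<subseteq> set_pow G S 2 <#> Y"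
    using approximate_group_of_small_doubling[OF A K] by metis
  have Sc: "S \<subseteq> carrier G"
    using S(4) set_mult_closed[OF set_inv_closed[OF A(3)] A(3)] by blast
  define T where "T = set_pow G S 2"
  have T: "finite T" "T \<subseteq> carrier G" "\<one> \<in> T"
    unfolding T_def using S Sc by (simp_all add: finite_set_pow set_pow_closed one_in_set_pow)
  have "S \<subseteq> T"
    using set_pow_mono[OF Sc S(2), of "Suc 0" 2] unfolding T_def set_pow_1[OF Sc] by simp
  then have cST: "card S \<le> card T" by (rule card_mono[OF T(1)])
  show ?thesis
  proof (rule that[OF T(1,3,2) _ _ _ _ Y(1-3)])
    show "inv s \<in> T" if "s \<in> T" for s
      using set_pow_inv[OF Sc S(3), of s 2] that by (simp add: T_def)
    show "T \<subseteq> H" if H: "subgroup H G" "A \<subseteq> H" for H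
    proof -
      have "m_inv G ` A <#> A \<subseteq> H"
        using H by (auto simp: set_mult_def intro!: subgroup.m_closed subgroup.m_inv_closed)
      then show ?thesis unfolding T_def using S(4) by (intro set_pow_subset_subgroup[OF H(1)]) blast
    qed
    show "real (card (set_pow G T m)) \<le> (K ^ 72) ^ m * real (card T)" for m
    proof -
      have "real (card (set_pow G T m)) \<le> (K ^ 36) ^ (m * 2) * real (card S)"
        unfolding T_def set_pow_set_pow[OF Sc] by (rule S(5))
      also have "\<dots> \<le> (K ^ 36) ^ (m * 2) * real (card T)"
        using K cST by (intro mult_left_mono) auto
      also have "(K ^ 36) ^ (m * 2) = (K ^ 72) ^ m"
        by (simp add: mult.commute[of m] flip: power_mult)
      finally show ?thesis .
    qed
    have "real (card T) \<le> (K ^ 36) ^ 2 * real (card S)" unfolding T_def by (rule S(5))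
    also have "\<dots> \<le> (K ^ 36) ^ 2 * (K ^ 9 * real (card A))"
      using K by (intro mult_left_mono S(6)) auto
    also have "\<dots> = K ^ 81 * real (card A)" by (simp flip: power_mult power_add mult.assoc)
    finally show "real (card T) \<le> K ^ 81 * real (card A)" .
  qed (use Y in \<open>simp_all add: T_def\<close>)
qed

end

section \<open>Seminorms on lattices and reduced boxes\<close>

locale int_module = module scale for scale :: "int \<Rightarrow> 'b \<Rightarrow> 'b::ab_group_add" (infixr \<open>*s\<close> 75)
begin

definition seminorm :: "('b \<Rightarrow> real) \<Rightarrow> bool" where
  "seminorm p \<longleftrightarrow> (\<forall>x y. p (x + y) \<le> p x + p y) \<and> (\<forall>c x. p (c *s x) = of_int \<bar>c\<bar> * p x)"

text \<open>Expresses that the quotient by the kernel of \<open>p\<close> has rank at most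
  \<open>d\<close>, without forming that quotient.\<close>

definition rank_le :: "('b \<Rightarrow> real) \<Rightarrow> nat \<Rightarrow> bool" where
  "rank_le p d \<longleftrightarrow> (\<forall>x :: nat \<Rightarrow> 'b. \<exists>c :: nat \<Rightarrow> int. (\<exists>i\<le>d. c i \<noteq> 0) \<and> p (\<Sum>i\<le>d. c i *s x i) = 0)"

definition discrete_norm :: "('b \<Rightarrow> real) \<Rightarrow> bool" where
  "discrete_norm p \<longleftrightarrow> (\<exists>e>0. \<forall>x. p x = 0 \<or> e \<le> p x)"

lemma seminormD:
  assumes "seminorm p"
  shows "p (x + y) \<le> p x + p y" "p (c *s x) = of_int \<bar>c\<bar> * p x" "p 0 = 0" "p (- x) = p x" "0 \<le> p x"
    "p (x - y) \<le> p x + p y"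
proof -
  have add: "p (x + y) \<le> p x + p y" for x y using assms by (simp add: seminorm_def)
  have sc: "p (c *s x) = of_int \<bar>c\<bar> * p x" for c x using assms by (simp add: seminorm_def)
  have m: "p (- x) = p x" for x using sc[of "-1" x] by simp
  show "p (x + y) \<le> p x + p y" by (rule add)
  show "p (c *s x) = of_int \<bar>c\<bar> * p x" by (rule sc)
  show "p (- x) = p x" by (rule m)
  show 0: "p 0 = 0" using sc[of 0 0] by simp
  show "0 \<le> p x" using add[of x "- x"] m[of x] 0 by simp
  show "p (x - y) \<le> p x + p y" using add[of x "- y"] m[of y] by simp
qed

lemma seminorm_sum:
  assumes "seminorm p"
  shows "p (\<Sum>i\<in>I. n i *s v i) \<le> (\<Sum>i\<in>I. of_int \<bar>n i\<bar> * p (v i))"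
proof (induction I rule: infinite_finite_induct)
  case (insert i I)
  then show ?case
    using seminormD(1)[OF assms, of "n i *s v i" "\<Sum>i\<in>I. n i *s v i"] seminormD(2)[OF assms] by simp
qed (auto simp: seminormD[OF assms])

text \<open>Dividing by \<open>n\<close> imitates the infimum over real multiples of \<open>u\<close> and makes the quotient
  homogeneous.\<close>

definition quot_norm :: "('b \<Rightarrow> real) \<Rightarrow> 'b \<Rightarrow> 'b \<Rightarrow> real" where
  "quot_norm p u x = (INF (n, m) \<in> {1..} \<times> UNIV. p (n *s x + m *s u) / of_int n)"

context
  fixes p :: "'b \<Rightarrow> real" and u :: 'b assumes p: "seminorm p"
begin

lemma quot_norm_le:
  assumes "n \<ge> 1"
  shows "quot_norm p u x \<le> p (n *s x + m *s u) / of_int n"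
proof -
  have "bdd_below ((\<lambda>(n, m). p (n *s x + m *s u) / of_int n) ` ({1..} \<times> UNIV))"
    by (rule bdd_belowI[of _ 0]) (auto simp: seminormD[OF p])
  from cINF_lower[OF this, of "(n, m)"] show ?thesis using assms by (simp add: quot_norm_def)
qed

lemma quot_norm_le': "quot_norm p u x \<le> p (x + m *s u)"
  using quot_norm_le[of 1 x m] by simp

lemma quot_norm_greatest:
  assumes "\<And>n m. n \<ge> 1 \<Longrightarrow> a \<le> p (n *s x + m *s u) / of_int n"
  shows "a \<le> quot_norm p u x"
  unfolding quot_norm_def by (rule cINF_greatest) (use assms in auto)

lemma quot_norm_approx:
  assumes "e > 0"
  obtains n m where "n \<ge> 1" "p (n *s x + m *s u) \<le> of_int n * (quot_norm p u x + e)"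
proof -
  have "\<exists>n m. n \<ge> 1 \<and> p (n *s x + m *s u) / of_int n < quot_norm p u x + e"
  proof (rule ccontr)
    assume "\<not> ?thesis"
    then have "quot_norm p u x + e \<le> quot_norm p u x"
      by (intro quot_norm_greatest) (auto simp: not_less)
    then show False using assms by simp
  qed
  then obtain n m where "n \<ge> 1" "p (n *s x + m *s u) / of_int n < quot_norm p u x + e" by auto
  then show ?thesis using that[of n m] by (simp add: divide_less_eq mult.commute split: if_splits)
qed

text \<open>For subadditivity, near minimisers with denominators \<open>n\<close> and
  \<open>n'\<close> are combined over the common denominator \<open>n * n'\<close>.\<close>

lemma seminorm_quot_norm: "seminorm (quot_norm p u)"
  unfolding seminorm_def
proof (intro conjI allI)
  let ?q = "quot_norm p u"
  show "?q (x + y) \<le> ?q x + ?q y" for x y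
  proof (rule field_le_epsilon)
    fix e :: real assume e: "e > 0"
    obtain n m where 1: "n \<ge> 1" "p (n *s x + m *s u) \<le> of_int n * (?q x + e / 2)"
      using quot_norm_approx[of "e / 2"] e by auto
    obtain n' m' where 2: "n' \<ge> 1" "p (n' *s y + m' *s u) \<le> of_int n' * (?q y + e / 2)"
      using quot_norm_approx[of "e / 2"] e by auto
    have nn: "n * n' \<ge> 1" using 1 2 by (metis mult_mono' mult_1 order_trans zero_le_one)
    have eq: "(n * n') *s (x + y) + (n' * m + n * m') *s u
        = n' *s (n *s x + m *s u) + n *s (n' *s y + m' *s u)"
      by (simp add: scale_right_distrib scale_left_distrib algebra_simps)
    have "?q (x + y) \<le> p ((n * n') *s (x + y) + (n' * m + n * m') *s u) / of_int (n * n')"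
      using nn by (rule quot_norm_le)
    also have "\<dots> \<le> (of_int n' * (of_int n * (?q x + e / 2)) + of_int n * (of_int n' * (?q y + e / 2))) / of_int (n * n')"
    proof (rule divide_right_mono)
      show "p ((n * n') *s (x + y) + (n' * m + n * m') *s u)
        \<le> of_int n' * (of_int n * (?q x + e / 2)) + of_int n * (of_int n' * (?q y + e / 2))"
      proof -
        have "of_int n' * p (n *s x + m *s u) \<le> of_int n' * (of_int n * (?q x + e / 2))"
          using 1 2 by (intro mult_left_mono) auto
        moreover have "of_int n * p (n' *s y + m' *s u) \<le> of_int n * (of_int n' * (?q y + e / 2))"
          using 1 2 by (intro mult_left_mono) auto
        moreover have "p (n' *s (n *s x + m *s u)) = of_int n' * p (n *s x + m *s u)"
          "p (n *s (n' *s y + m' *s u)) = of_int n * p (n' *s y + m' *s u)"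
          unfolding seminormD(2)[OF p] using 1 2 by simp_all
        ultimately show ?thesis
          unfolding eq using seminormD(1)[OF p, of "n' *s (n *s x + m *s u)" "n *s (n' *s y + m' *s u)"]
          by linarith
      qed
    qed (use 1 2 in simp)
    also have "\<dots> = ?q x + ?q y + e"
      using 1 2 by (simp add: field_simps)
    finally show "?q (x + y) \<le> ?q x + ?q y + e" .
  qed
  have q0: "0 \<le> ?q x" for x
    by (rule quot_norm_greatest) (simp add: seminormD[OF p])
  show "?q (c *s x) = of_int \<bar>c\<bar> * ?q x" for c x
  proof (cases "c = 0")
    case True
    then show ?thesis using quot_norm_le'[of "0 *s x" 0] q0[of "0 *s x"] by (simp add: seminormD[OF p])
  next
    case False
    show ?thesis
    proof (rule antisym)
      show "real_of_int \<bar>c\<bar> * ?q x \<le> ?q (c *s x)"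
      proof (rule quot_norm_greatest)
        fix n m :: int assume n: "n \<ge> 1"
        have nc: "n * \<bar>c\<bar> \<ge> 1" using n False by (simp add: int_one_le_iff_zero_less)
        have eq: "n *s c *s x + m *s u = sgn c *s ((n * \<bar>c\<bar>) *s x + (sgn c * m) *s u)"
        proof -
          have "sgn c * (n * \<bar>c\<bar>) = n * c"
            by (metis mult.left_commute mult_sgn_abs)
          moreover have "sgn c * (sgn c * m) = m"
            using False by (simp add: sgn_if)
          ultimately show ?thesis by (simp only: scale_right_distrib scale_scale)
        qed
        have "p (n *s c *s x + m *s u) = p ((n * \<bar>c\<bar>) *s x + (sgn c * m) *s u)"
          unfolding eq seminormD(2)[OF p] using False by (simp add: abs_sgn_eq)
        moreover have "?q x \<le> p ((n * \<bar>c\<bar>) *s x + (sgn c * m) *s u) / of_int (n * \<bar>c\<bar>)"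
          using nc by (rule quot_norm_le)
        ultimately show "real_of_int \<bar>c\<bar> * ?q x \<le> p (n *s c *s x + m *s u) / of_int n"
          using n False by (simp add: field_simps)
      qed
      have "?q (c *s x) / of_int \<bar>c\<bar> \<le> ?q x"
      proof (rule quot_norm_greatest)
        fix n m :: int assume n: "n \<ge> 1"
        have "?q (c *s x) \<le> p (n *s c *s x + (c * m) *s u) / of_int n"
          using n by (rule quot_norm_le)
        also have "n *s c *s x + (c * m) *s u = c *s (n *s x + m *s u)"
          by (simp add: scale_right_distrib mult.commute)
        finally have "?q (c *s x) \<le> of_int \<bar>c\<bar> * p (n *s x + m *s u) / of_int n"
          unfolding seminormD(2)[OF p] .
        then show "?q (c *s x) / of_int \<bar>c\<bar> \<le> p (n *s x + m *s u) / of_int n"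
          using n False by (simp add: field_simps)
      qed
      then show "?q (c *s x) \<le> real_of_int \<bar>c\<bar> * ?q x"
        using False by (simp add: field_simps)
    qed
  qed
qed

text \<open>A near minimiser for \<open>quot_norm\<close> amounts to a rational multiple m / n of
  \<open>u\<close>. Rounding it to an integer \<open>k\<close> moves it by at most 1/2, hence the
  loss \<open>p u / 2\<close>.\<close>

lemma quot_norm_lift:
  assumes "e > 0"
  obtains k where "p (x + k *s u) \<le> quot_norm p u x + e + p u / 2"
proof -
  obtain n m where nm: "n \<ge> 1" "p (n *s x + m *s u) \<le> of_int n * (quot_norm p u x + e)"
    using quot_norm_approx[OF assms] .
  define k where "k = round (of_int m / of_int n :: real)"
  have "\<bar>of_int k - of_int m / of_int n\<bar> \<le> (1 / 2 :: real)"
    unfolding k_def by (rule of_int_round_abs_le)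
  then have "\<bar>(of_int k - of_int m / of_int n) * of_int n\<bar> \<le> (1 / 2 :: real) * of_int n"
    using nm(1) by (simp add: abs_mult)
  then have k: "\<bar>of_int (n * k - m)\<bar> \<le> (of_int n / 2 :: real)"
    using nm(1) by (simp add: algebra_simps)
  have eq: "n *s (x + k *s u) = (n *s x + m *s u) + (n * k - m) *s u"
    by (simp add: scale_right_distrib scale_left_diff_distrib)
  have "of_int n * p (x + k *s u) = p (n *s (x + k *s u))"
    using nm(1) by (simp add: seminormD(2)[OF p])
  also have "\<dots> \<le> p (n *s x + m *s u) + \<bar>of_int (n * k - m)\<bar> * p u"
    unfolding eq using seminormD(1)[OF p, of "n *s x + m *s u" "(n * k - m) *s u"]
    by (simp add: seminormD(2)[OF p])
  also have "\<dots> \<le> of_int n * (quot_norm p u x + e) + (of_int n / 2) * p u"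
    using nm(2) k by (intro add_mono mult_right_mono) (auto simp: seminormD[OF p])
  also have "\<dots> = of_int n * (quot_norm p u x + e + p u / 2)" by (simp add: algebra_simps)
  finally show ?thesis using nm(1) by (intro that[of k]) simp
qed

end

end

text \<open>The recursion comes from \<open>unit_ball_box\<close>: lifting the \<open>d\<close> old
  generators multiplies their weighted length by 6, and the new direction \<open>u\<close> adds as
  much again plus 1.\<close>

primrec box_const :: "nat \<Rightarrow> real" where
  "box_const 0 = 0"
| "box_const (Suc d) = 12 * box_const d + 1"

lemma box_const_nonneg: "0 \<le> box_const d"
  by (induction d) auto

context int_module
begin

text \<open>A reduced basis is built by splitting off a nearly shortest vector \<open>u\<close>: modulo \<open>u\<close> every
  vector lifts with bounded loss, because \<open>u\<close> is short compared with everything that survives.\<close>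

lemma unit_ball_box:
  assumes "seminorm p" "rank_le p d" "discrete_norm p"
  shows "\<exists>(v :: nat \<Rightarrow> 'b) (N :: nat \<Rightarrow> nat). (\<Sum>i<d. real (N i) * p (v i)) \<le> box_const d \<and>
    (\<forall>x. p x \<le> 1 \<longrightarrow> (\<exists>n :: nat \<Rightarrow> int. (\<forall>i<d. \<bar>n i\<bar> \<le> int (N i)) \<and> p (x - (\<Sum>i<d. n i *s v i)) = 0))"
  using assms
proof (induction d arbitrary: p)
  case 0
  have "p x = 0" for x
  proof -
    obtain c :: "nat \<Rightarrow> int" where "c 0 \<noteq> 0" "p (c 0 *s x) = 0"
      using 0(2) unfolding rank_le_def by (auto dest!: spec[of _ "\<lambda>_. x"])
    then show ?thesis by (simp add: seminormD[OF 0(1)])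
  qed
  then show ?case by simp
next
  case (Suc d)
  note p = Suc.prems(1)
  show ?case
  proof (cases "\<forall>x. p x = 0")
    case True
    then show ?thesis
      using box_const_nonneg[of "Suc d"] by (intro exI[of _ "\<lambda>_. 0"]) (auto intro!: exI[of _ "\<lambda>_. 0"])
  next
    case False
    obtain e where e: "e > 0" "\<And>x. p x = 0 \<or> e \<le> p x"
      using Suc.prems(3) by (auto simp: discrete_norm_def)
    define R where "R = {p x | x. p x \<noteq> 0}"
    have R: "R \<noteq> {}" "\<And>r. r \<in> R \<Longrightarrow> e \<le> r" using False e by (auto simp: R_def)
    have eR: "e \<le> Inf R" using R by (intro cInf_greatest)
    \<comment> \<open>With the factor 4/3 every nonzero value of \<open>p\<close> is at least 3/4 of
      \<open>p u\<close>, which exceeds the lifting loss 1/2 + 1/8 = 5/8 by 1/8.\<close>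
    have "Inf R < 4 / 3 * Inf R" using eR e by simp
    then obtain r where r: "r \<in> R" "r < 4 / 3 * Inf R"
      using cInf_lessD[OF R(1)] by blast
    then obtain u where u: "p u \<noteq> 0" "p u < 4 / 3 * Inf R" by (auto simp: R_def)
    have low: "p x = 0 \<or> 3 / 4 * p u \<le> p x" for x
    proof -
      have "p x = 0 \<or> Inf R \<le> p x"
        using R by (auto simp: R_def intro!: cInf_lower bdd_belowI[of _ e])
      then show ?thesis using u by auto
    qed
    have pu: "p u > 0" using u seminormD(5)[OF p, of u] by simp
    define q where "q = quot_norm p u"
    note q = seminorm_quot_norm[OF p, of u, folded q_def]
    have lift: "\<exists>k. p (x + k *s u) \<le> q x + 5 / 8 * p u" for x
    proof -
      have "p u / 8 > 0" using pu by simp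
      then obtain k where "p (x + k *s u) \<le> quot_norm p u x + p u / 8 + p u / 2"
        by (rule quot_norm_lift[OF p])
      then show ?thesis by (intro exI[of _ k]) (simp add: q_def)
    qed
    \<comment> \<open>If the lift is not null, then 3/4 - 5/8 = 1/8 gives
      \<open>p u \<le> 8 * q x\<close>, and 1 + 8 * 5/8 = 6.\<close>
    have lift6: "\<exists>k. p (x + k *s u) \<le> 6 * q x" for x
    proof -
      obtain k where k: "p (x + k *s u) \<le> q x + 5 / 8 * p u" using lift by auto
      show ?thesis
      proof (cases "p (x + k *s u) = 0")
        case True
        then show ?thesis using seminormD(5)[OF q, of x] by (intro exI[of _ k]) simp
      next
        case False
        then have "3 / 4 * p u \<le> p (x + k *s u)" using low by blast
        then show ?thesis using k by (intro exI[of _ k]) simp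
      qed
    qed
    have q_disc: "q x = 0 \<or> p u / 8 \<le> q x" for x
    proof -
      obtain k where k: "p (x + k *s u) \<le> q x + 5 / 8 * p u" using lift by auto
      show ?thesis
      proof (cases "p (x + k *s u) = 0")
        case True
        then have "q x \<le> 0" using quot_norm_le'[OF p, of u x k] by (simp add: q_def)
        then show ?thesis using seminormD(5)[OF q, of x] by simp
      next
        case False
        then have "3 / 4 * p u \<le> p (x + k *s u)" using low by blast
        then show ?thesis using k by simp
      qed
    qed
    have "discrete_norm q"
      unfolding discrete_norm_def using pu q_disc by (intro exI[of _ "p u / 8"]) auto
    moreover have "rank_le q d"
      unfolding rank_le_def
    proof
      fix x :: "nat \<Rightarrow> 'b"
      \<comment> \<open>With \<open>u\<close> adjoined as the last vector, its coefficient is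
        invisible to \<open>q\<close>; it cannot be the only nonzero coefficient because
        \<open>p u > 0\<close>.\<close>
      obtain c :: "nat \<Rightarrow> int" where c: "\<exists>i\<le>Suc d. c i \<noteq> 0" "p (\<Sum>i\<le>Suc d. c i *s (x(Suc d := u)) i) = 0"
        using Suc.prems(2) unfolding rank_le_def by blast
      have eq: "(\<Sum>i\<le>Suc d. c i *s (x(Suc d := u)) i) = (\<Sum>i\<le>d. c i *s x i) + c (Suc d) *s u"
        by simp
      have "q (\<Sum>i\<le>d. c i *s x i) \<le> 0"
        using quot_norm_le'[OF p, of u "\<Sum>i\<le>d. c i *s x i" "c (Suc d)"] c(2) unfolding eq by (simp add: q_def)
      then have q0: "q (\<Sum>i\<le>d. c i *s x i) = 0" using seminormD(5)[OF q] by (simp add: antisym)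
      have "\<exists>i\<le>d. c i \<noteq> 0"
      proof (rule ccontr)
        assume "\<not> ?thesis"
        then have *: "\<And>i. i \<le> d \<Longrightarrow> c i = 0" by auto
        then have "p (c (Suc d) *s u) = 0" using c(2) unfolding eq by simp
        then have "c (Suc d) = 0" using pu by (simp add: seminormD[OF p])
        then show False using c(1) * by (metis le_Suc_eq)
      qed
      then show "\<exists>c :: nat \<Rightarrow> int. (\<exists>i\<le>d. c i \<noteq> 0) \<and> q (\<Sum>i\<le>d. c i *s x i) = 0" using q0 by blast
    qed
    ultimately obtain v N where vN: "(\<Sum>i<d. real (N i) * q (v i)) \<le> box_const d"
      "\<And>x. q x \<le> 1 \<Longrightarrow> \<exists>n :: nat \<Rightarrow> int. (\<forall>i<d. \<bar>n i\<bar> \<le> int (N i)) \<and> q (x - (\<Sum>i<d. n i *s v i)) = 0"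
      using Suc.IH[OF q] by blast
    have "\<forall>i. \<exists>k. p (v i + k *s u) \<le> 6 * q (v i)" using lift6 by blast
    then obtain k where k: "\<And>i. p (v i + k i *s u) \<le> 6 * q (v i)" by metis
    define w where "w = (\<lambda>i. v i + k i *s u)"
    define L where "L = 1 + 6 * box_const d"
    have L: "L \<ge> 0" using box_const_nonneg[of d] by (simp add: L_def)
    define M where "M = nat \<lfloor>L / p u\<rfloor>"
    have M: "real M \<le> L / p u" unfolding M_def using L pu by (simp add: of_nat_floor)
    have sw: "(\<Sum>i<d. real (N i) * p (w i)) \<le> 6 * box_const d"
    proof -
      have "(\<Sum>i<d. real (N i) * p (w i)) \<le> (\<Sum>i<d. real (N i) * (6 * q (v i)))"
        unfolding w_def by (intro sum_mono mult_left_mono k) auto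
      also have "\<dots> = 6 * (\<Sum>i<d. real (N i) * q (v i))" by (simp add: sum_distrib_left algebra_simps)
      finally show ?thesis using vN(1) by simp
    qed
    show ?thesis
    proof (intro exI[of _ "w(d := u)"] exI[of _ "N(d := M)"] conjI allI impI)
      show "(\<Sum>i<Suc d. real ((N(d := M)) i) * p ((w(d := u)) i)) \<le> box_const (Suc d)"
        using sw M pu by (simp add: L_def field_simps)
      fix x assume x: "p x \<le> 1"
      have "q x \<le> 1" using quot_norm_le'[OF p, of u x 0] x by (simp add: q_def)
      then obtain n :: "nat \<Rightarrow> int" where n: "\<And>i. i < d \<Longrightarrow> \<bar>n i\<bar> \<le> int (N i)" "q (x - (\<Sum>i<d. n i *s v i)) = 0"
        using vN(2) by blast
      obtain l where "p (x - (\<Sum>i<d. n i *s v i) + l *s u) \<le> 0"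
        using lift6[of "x - (\<Sum>i<d. n i *s v i)"] n(2) by auto
      then have l: "p (x - (\<Sum>i<d. n i *s v i) + l *s u) = 0" using seminormD(5)[OF p] by (simp add: antisym)
      define t where "t = - (l + (\<Sum>i<d. n i * k i))"
      have eq: "x - (\<Sum>i<d. n i *s v i) + l *s u = x - (\<Sum>i<d. n i *s w i) - t *s u"
      proof -
        have "(\<Sum>i<d. n i *s w i) = (\<Sum>i<d. n i *s v i) + (\<Sum>i<d. n i * k i) *s u"
          by (simp add: w_def scale_right_distrib sum.distrib scale_sum_left)
        moreover have "t *s u = - (l *s u) - (\<Sum>i<d. n i * k i) *s u"
          by (simp add: t_def scale_left_distrib scale_minus_left scale_left_diff_distrib)
        ultimately show ?thesis by simp
      qed
      have t0: "p (x - (\<Sum>i<d. n i *s w i) - t *s u) = 0" using l unfolding eq .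
      \<comment> \<open>Up to a null vector, \<open>t *s u\<close> is \<open>x\<close> minus the
        lifted combination, so its length is at most \<open>L\<close>, that is 1 plus the bound
        \<open>sw\<close>.\<close>
      have "of_int \<bar>t\<bar> * p u = p (t *s u)" by (simp add: seminormD(2)[OF p])
      also have "t *s u = (x - (\<Sum>i<d. n i *s w i)) - (x - (\<Sum>i<d. n i *s w i) - t *s u)" by simp
      also have "p \<dots> \<le> p x + p (\<Sum>i<d. n i *s w i)"
        using seminormD(6)[OF p, of "x - (\<Sum>i<d. n i *s w i)" "x - (\<Sum>i<d. n i *s w i) - t *s u"] t0
          seminormD(6)[OF p, of x "\<Sum>i<d. n i *s w i"] by linarith
      also have "p (\<Sum>i<d. n i *s w i) \<le> (\<Sum>i<d. of_int \<bar>n i\<bar> * p (w i))" by (rule seminorm_sum[OF p])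
      also have "\<dots> \<le> (\<Sum>i<d. real (N i) * p (w i))"
      proof (intro sum_mono mult_right_mono)
        fix i assume "i \<in> {..<d}"
        then have "\<bar>n i\<bar> \<le> int (N i)" using n(1) by simp
        then show "real_of_int \<bar>n i\<bar> \<le> real (N i)" by linarith
      qed (simp add: seminormD[OF p])
      finally have "of_int \<bar>t\<bar> * p u \<le> L" using x sw by (simp add: L_def)
      then have "real_of_int \<bar>t\<bar> \<le> L / p u" using pu by (simp add: field_simps)
      then have tM: "\<bar>t\<bar> \<le> int M" unfolding M_def using L pu by (simp add: le_floor_iff)
      show "\<exists>n :: nat \<Rightarrow> int. (\<forall>i<Suc d. \<bar>n i\<bar> \<le> int ((N(d := M)) i)) \<and>
          p (x - (\<Sum>i<Suc d. n i *s (w(d := u)) i)) = 0"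
        using n(1) tM t0 by (intro exI[of _ "n(d := t)"]) (auto simp: less_Suc_eq algebra_simps)
    qed
  qed
qed

end

text \<open>Gaussian elimination without division: the pivot \<open>k\<close> clears coordinate
  \<open>d\<close>, and the coefficient given to \<open>k\<close> at the end turns a relation among
  the \<open>z i\<close> into one among the \<open>x i\<close>.\<close>

lemma integer_dependence:
  fixes x :: "'i \<Rightarrow> nat \<Rightarrow> int"
  assumes "finite I" "card I = Suc d"
  shows "\<exists>c :: 'i \<Rightarrow> int. (\<exists>i\<in>I. c i \<noteq> 0) \<and> (\<forall>j<d. (\<Sum>i\<in>I. c i * x i j) = 0)"
  using assms
proof (induction d arbitrary: I x)
  case 0
  then obtain i where "I = {i}" by (auto simp: card_1_singleton_iff)
  then show ?case by (intro exI[of _ "\<lambda>_. 1"]) auto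
next
  case (Suc d)
  obtain k where k: "k \<in> I" "x k d \<noteq> 0 \<or> (\<forall>i\<in>I. x i d = 0)"
  proof (cases "\<exists>k\<in>I. x k d \<noteq> 0")
    case False
    moreover have "I \<noteq> {}" using Suc.prems by auto
    ultimately show ?thesis using that by blast
  qed (use that in blast)
  \<comment> \<open>If column \<open>d\<close> vanishes on \<open>I\<close>, the value 1 makes
    \<open>z\<close> agree with \<open>x\<close> there and nothing is eliminated.\<close>
  define a where "a = (if x k d = 0 then 1 else x k d)"
  have a: "a \<noteq> 0" by (simp add: a_def)
  define z where "z = (\<lambda>i j. a * x i j - x i d * x k j)"
  have I: "finite (I - {k})" "card (I - {k}) = Suc d" using Suc.prems k by auto
  obtain c where c: "\<exists>i\<in>I - {k}. c i \<noteq> 0" "\<And>j. j < d \<Longrightarrow> (\<Sum>i\<in>I - {k}. c i * z i j) = 0"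
    using Suc.IH[OF I, of z] by auto
  have zd: "z i d = 0" if "i \<in> I" for i using k(2) that by (auto simp: z_def a_def)
  define c' where "c' = (\<lambda>i. if i = k then - (\<Sum>i\<in>I - {k}. c i * x i d) else a * c i)"
  have "(\<Sum>i\<in>I. c' i * x i j) = (\<Sum>i\<in>I - {k}. c i * z i j)" for j
  proof -
    have "(\<Sum>i\<in>I. c' i * x i j) = c' k * x k j + (\<Sum>i\<in>I - {k}. c' i * x i j)"
      using Suc.prems k by (simp add: sum.remove)
    also have "(\<Sum>i\<in>I - {k}. c' i * x i j) = (\<Sum>i\<in>I - {k}. a * c i * x i j)"
      by (intro sum.cong) (auto simp: c'_def)
    also have "c' k * x k j + \<dots> = (\<Sum>i\<in>I - {k}. c i * z i j)"
      by (simp add: c'_def z_def sum_distrib_left sum_distrib_right right_diff_distrib sum_subtractf ac_simps)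
    finally show ?thesis .
  qed
  moreover have "(\<Sum>i\<in>I - {k}. c i * z i j) = 0" if "j < Suc d" for j
  proof (cases "j = d")
    case True
    then show ?thesis using zd by (intro sum.neutral) auto
  qed (use that c(2) in auto)
  moreover have "\<exists>i\<in>I. c' i \<noteq> 0" using c(1) a by (auto simp: c'_def)
  ultimately show ?case by (intro exI[of _ c']) auto
qed

section \<open>Fourier analysis on cyclic groups\<close>

definition unit_char :: "nat \<Rightarrow> int \<Rightarrow> complex" where
  "unit_char N t = cis (2 * pi * of_int t / of_nat N)"

lemma unit_char_add: "unit_char N (s + t) = unit_char N s * unit_char N t"
  by (simp add: unit_char_def cis_mult add_divide_distrib ring_distribs)

lemma unit_char_minus: "unit_char N (- t) = cnj (unit_char N t)"
  by (simp add: unit_char_def cis_cnj)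

lemma unit_char_mult_nat: "unit_char N (int k * t) = unit_char N t ^ k"
proof -
  have "2 * pi * of_int (int k * t) / of_nat N = real k * (2 * pi * of_int t / of_nat N)" by simp
  then show ?thesis unfolding unit_char_def by (simp only: DeMoivre)
qed

lemma unit_char_multiple:
  assumes "N > 0" "int N dvd t"
  shows "unit_char N t = 1"
proof -
  obtain q where "t = int N * q" using assms by auto
  then have "2 * pi * of_int t / of_nat N = 2 * pi * of_int q" using assms by simp
  then show ?thesis unfolding unit_char_def by (simp add: cis_multiple_2pi)
qed

lemma unit_char_eq_1:
  assumes "N > 0" "unit_char N t = 1"
  shows "int N dvd t"
proof -
  define s where "s = nat (t mod int N)"
  have s: "int s = t mod int N" "s < N" using assms by (simp_all add: s_def nat_less_iff)
  have "t = int N * (t div int N) + int s" by (simp add: s)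
  then have "unit_char N t = unit_char N (int s)"
    using unit_char_add[of N "int N * (t div int N)" "int s"] unit_char_multiple[OF assms(1)] by simp
  then have "cis (2 * pi * real s / real N) = cis (2 * pi * real 0 / real N)"
    using assms(2) by (simp add: unit_char_def)
  then have "s = 0"
    using inj_onD[OF bij_betw_imp_inj_on[OF bij_betw_roots_unity[OF assms(1)]], of s 0] s(2) assms(1)
    by simp
  then show ?thesis using s(1) by (simp add: dvd_eq_mod_eq_0)
qed

lemma sum_unit_char:
  assumes "N > 0"
  shows "(\<Sum>k<N. unit_char N (int k * t)) = (if int N dvd t then of_nat N else 0)"
proof (cases "int N dvd t")
  case True
  then show ?thesis using unit_char_multiple[OF assms] by simp
next
  case False
  have 1: "unit_char N t \<noteq> 1" using unit_char_eq_1[OF assms] False by blast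
  have "unit_char N t ^ N = 1"
    using unit_char_multiple[OF assms, of "int N * t"] by (simp flip: unit_char_mult_nat)
  then show ?thesis using False 1 geometric_sum[OF 1, of N] by (simp add: unit_char_mult_nat)
qed

definition fourier :: "nat \<Rightarrow> int set \<Rightarrow> nat \<Rightarrow> complex" where
  "fourier N F k = (\<Sum>a\<in>F. unit_char N (int k * a))"

lemma fourier_norm_sq:
  "complex_of_real ((cmod (fourier N F k))\<^sup>2) = (\<Sum>(a, b)\<in>F \<times> F. unit_char N (int k * (a - b)))"
proof -
  have "complex_of_real ((cmod (fourier N F k))\<^sup>2) = fourier N F k * cnj (fourier N F k)"
    by (rule complex_norm_square)
  also have "\<dots> = (\<Sum>a\<in>F. \<Sum>b\<in>F. unit_char N (int k * a) * cnj (unit_char N (int k * b)))"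
    by (simp add: fourier_def cnj_sum sum_product)
  also have "\<dots> = (\<Sum>a\<in>F. \<Sum>b\<in>F. unit_char N (int k * (a - b)))"
    by (intro sum.cong refl)
      (simp add: right_diff_distrib flip: unit_char_minus unit_char_add)
  finally show ?thesis by (simp add: sum.cartesian_product)
qed

text \<open>Orthogonality leaves the pairs whose difference is divisible by \<open>N\<close>; as
  \<open>F\<close> consists of reduced residues, these are the diagonal ones.\<close>

lemma parseval:
  assumes "N > 0" "finite F" "F \<subseteq> {0..<int N}"
  shows "(\<Sum>k<N. (cmod (fourier N F k))\<^sup>2) = real N * real (card F)"
proof -
  have "complex_of_real (\<Sum>k<N. (cmod (fourier N F k))\<^sup>2)
      = (\<Sum>k<N. \<Sum>(a, b)\<in>F \<times> F. unit_char N (int k * (a - b)))"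
    by (simp only: of_real_sum fourier_norm_sq)
  also have "\<dots> = (\<Sum>(a, b)\<in>F \<times> F. \<Sum>k<N. unit_char N (int k * (a - b)))"
    by (subst sum.swap) (simp add: case_prod_unfold)
  also have "\<dots> = (\<Sum>(a, b)\<in>F \<times> F. if a = b then of_nat N else 0)"
  proof (intro sum.cong refl, clarify)
    fix a b assume ab: "a \<in> F" "b \<in> F"
    have "int N dvd a - b \<longleftrightarrow> a = b"
    proof
      assume "int N dvd a - b"
      then have "a mod int N = b mod int N" by (simp add: mod_eq_dvd_iff)
      then show "a = b" using ab assms(3) by (auto simp: subset_iff)
    qed simp
    then show "(\<Sum>k<N. unit_char N (int k * (a - b))) = (if a = b then of_nat N else 0)"
      by (simp add: sum_unit_char[OF assms(1)])
  qed
  also have "\<dots> = (\<Sum>a\<in>F. \<Sum>b\<in>F. if a = b then of_nat N else 0)"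
    by (simp add: sum.cartesian_product)
  also have "\<dots> = complex_of_real (real N * real (card F))"
    using assms(2) by (simp add: sum.delta)
  finally show ?thesis by (simp only: of_real_eq_iff)
qed

text \<open>Up to the factor \<open>N\<close>, the sum with the character in place of the cosine
  counts the representations of \<open>x\<close> modulo \<open>N\<close> as a + b - c - e, and there
  are none. Taking real parts yields the cosine.\<close>

lemma fourier_fourth_moment:
  assumes N: "N > 0" and no: "\<And>a b c e. a \<in> F \<Longrightarrow> b \<in> F \<Longrightarrow> c \<in> F \<Longrightarrow> e \<in> F \<Longrightarrow> \<not> int N dvd a + b - c - e - x"
  shows "(\<Sum>k<N. cmod (fourier N F k) ^ 4 * cos (2 * pi * of_int (int k * x) / of_nat N)) = 0"
proof -
  have term_k: "complex_of_real (cmod (fourier N F k) ^ 4) * unit_char N (int k * (- x))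
      = (\<Sum>(p, q)\<in>(F \<times> F) \<times> (F \<times> F). unit_char N (int k * (fst p + fst q - snd p - snd q - x)))" for k
  proof -
    have "complex_of_real (cmod (fourier N F k) ^ 4)
        = complex_of_real ((cmod (fourier N F k))\<^sup>2) * complex_of_real ((cmod (fourier N F k))\<^sup>2)"
      by (simp add: power2_eq_square power4_eq_xxxx)
    also have "\<dots> = (\<Sum>p\<in>F \<times> F. \<Sum>q\<in>F \<times> F.
        unit_char N (int k * (fst p - snd p)) * unit_char N (int k * (fst q - snd q)))"
      unfolding fourier_norm_sq by (simp add: sum_product case_prod_unfold)
    finally have "complex_of_real (cmod (fourier N F k) ^ 4) * unit_char N (int k * (- x))
        = (\<Sum>p\<in>F \<times> F. \<Sum>q\<in>F \<times> F.
        unit_char N (int k * (fst p - snd p)) * unit_char N (int k * (fst q - snd q)) * unit_char N (int k * (- x)))"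
      by (simp add: sum_distrib_right)
    also have "\<dots> = (\<Sum>p\<in>F \<times> F. \<Sum>q\<in>F \<times> F. unit_char N (int k * (fst p + fst q - snd p - snd q - x)))"
      unfolding unit_char_add[symmetric] by (simp add: algebra_simps)
    finally show ?thesis by (simp add: sum.cartesian_product)
  qed
  have "(\<Sum>k<N. complex_of_real (cmod (fourier N F k) ^ 4) * unit_char N (int k * (- x)))
      = (\<Sum>(p, q)\<in>(F \<times> F) \<times> (F \<times> F). \<Sum>k<N. unit_char N (int k * (fst p + fst q - snd p - snd q - x)))"
    unfolding term_k by (subst sum.swap) (simp add: case_prod_unfold)
  also have "\<dots> = 0"
    by (intro sum.neutral ballI) (auto simp: sum_unit_char[OF N] no)
  finally have "Re (\<Sum>k<N. complex_of_real (cmod (fourier N F k) ^ 4) * unit_char N (int k * (- x))) = 0" by simp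
  then show ?thesis by (simp add: unit_char_def)
qed

text \<open>\<open>S\<close> is the large spectrum. If \<open>x\<close> were not represented, the
  cosine-weighted fourth moment would vanish. But frequency 0 contributes M^4, the frequencies in
  \<open>S\<close> contribute nonnegatively because their phase is within a quarter turn of 0, and
  by Parseval the remaining ones lose at most M^4 / 2.\<close>

lemma bogolyubov:
  fixes \<delta> :: real
  assumes N: "N > 0" and F: "F \<noteq> {}" "F \<subseteq> {0..<int N}" and \<delta>: "\<delta> > 0" "\<delta> * real N \<le> real (card F)"
  obtains S where "S \<subseteq> {..<N}" "real (card S) \<le> 2 / \<delta>\<^sup>2"
    "\<And>x :: int. (\<And>k. k \<in> S \<Longrightarrow> \<exists>m :: int. 4 * \<bar>int k * x - int N * m\<bar> \<le> int N) \<Longrightarrow>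
      \<exists>a\<in>F. \<exists>b\<in>F. \<exists>c\<in>F. \<exists>e\<in>F. int N dvd a + b - c - e - x"
proof -
  have fin: "finite F" using F(2) by (rule finite_subset) simp
  define M where "M = real (card F)"
  have M: "M > 0" using F fin by (simp add: M_def card_gt_0_iff)
  define g where "g = (\<lambda>k. (cmod (fourier N F k))\<^sup>2)"
  have g0: "g k \<ge> 0" for k by (simp add: g_def)
  have pars: "(\<Sum>k<N. g k) = real N * M" unfolding g_def M_def by (rule parseval[OF N fin F(2)])
  \<comment> \<open>The factor 1/2 in the threshold is what limits the loss from small frequencies
    to half of the main term; it also produces the 2 in the bound on \<open>card S\<close>.\<close>
  define S where "S = {k. k < N \<and> \<delta> * M\<^sup>2 / 2 \<le> g k}"
  have S: "S \<subseteq> {..<N}" by (auto simp: S_def)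
  have "real (card S) * (\<delta> * M\<^sup>2 / 2) \<le> (\<Sum>k\<in>S. g k)"
    using sum_bounded_below[of S "\<delta> * M\<^sup>2 / 2" g] by (simp add: S_def)
  also have "\<dots> \<le> (\<Sum>k<N. g k)" using S g0 by (intro sum_mono2) auto
  finally have "real (card S) * (\<delta> * M\<^sup>2 / 2) * \<delta> \<le> real N * M * \<delta>"
    unfolding pars using \<delta> by (intro mult_right_mono) auto
  also have "\<dots> \<le> M * M" using \<delta>(2) M unfolding M_def[symmetric] by (simp add: mult.commute)
  finally have "real (card S) * \<delta>\<^sup>2 * M\<^sup>2 \<le> 2 * M\<^sup>2" by (simp add: power2_eq_square algebra_simps)
  then have "real (card S) * \<delta>\<^sup>2 \<le> 2" using M by simp
  then have cS: "real (card S) \<le> 2 / \<delta>\<^sup>2" using \<delta> by (simp add: field_simps)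
  show ?thesis
  proof (rule that[OF S cS], rule ccontr)
    fix x :: int
    assume x: "\<And>k. k \<in> S \<Longrightarrow> \<exists>m :: int. 4 * \<bar>int k * x - int N * m\<bar> \<le> int N"
      and no: "\<not> (\<exists>a\<in>F. \<exists>b\<in>F. \<exists>c\<in>F. \<exists>e\<in>F. int N dvd a + b - c - e - x)"
    define h where "h = (\<lambda>k. cos (2 * pi * of_int (int k * x) / of_nat N))"
    have g4: "cmod (fourier N F k) ^ 4 = (g k)\<^sup>2" for k by (simp add: g_def flip: power_mult)
    have sum0: "(\<Sum>k<N. (g k)\<^sup>2 * h k) = 0"
      using fourier_fourth_moment[OF N, of F x] no unfolding h_def g4 by blast
    have hS: "h k \<ge> 0" if "k \<in> S" for k
    proof -
      obtain m :: int where m: "4 * \<bar>int k * x - int N * m\<bar> \<le> int N" using x \<open>k \<in> S\<close> by blast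
      define y where "y = of_int (int k * x - int N * m) / real N"
      have "4 * real_of_int \<bar>int k * x - int N * m\<bar> \<le> real N" using m by linarith
      then have y: "\<bar>y\<bar> \<le> 1 / 4" using N by (simp add: y_def abs_divide field_simps)
      have eq: "2 * pi * of_int (int k * x) / of_nat N = 2 * pi * y + 2 * pi * of_int m"
        using N by (simp add: y_def field_simps)
      have "h k = cos (2 * pi * y)" unfolding h_def eq by (simp add: cos_add)
      moreover have "\<bar>2 * pi * y\<bar> \<le> pi / 2"
        using mult_left_mono[OF y, of "2 * pi"] by (simp add: abs_mult)
      ultimately show ?thesis using cos_ge_zero[of "2 * pi * y"] by linarith
    qed
    have S0: "0 \<in> S"
    proof -
      have "g 0 = M\<^sup>2" by (simp add: g_def fourier_def unit_char_def M_def)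
      moreover have "\<delta> \<le> 1"
      proof -
        have "card F \<le> card {0..<int N}" using F(2) by (intro card_mono) auto
        then have "\<delta> * real N \<le> 1 * real N" using \<delta>(2) by simp
        then show ?thesis using N by (subst (asm) mult_le_cancel_right) auto
      qed
      ultimately show ?thesis using N M by (simp add: S_def)
    qed
    have low: "(if k = 0 then M ^ 4 else 0) - \<delta> * M\<^sup>2 / 2 * g k \<le> (g k)\<^sup>2 * h k" if "k < N" for k
    proof (cases "k \<in> S")
      case True
      have "g 0 = M\<^sup>2" "h 0 = 1" by (simp_all add: g_def fourier_def unit_char_def M_def h_def)
      then have "(if k = 0 then M ^ 4 else 0) \<le> (g k)\<^sup>2 * h k"
        using hS[OF True] by (simp flip: power_mult)
      moreover have "0 \<le> \<delta> * M\<^sup>2 / 2 * g k" using \<delta> g0 by simp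
      ultimately show ?thesis by linarith
    next
      case False
      then have k: "k \<noteq> 0" using S0 by metis
      have gk: "g k \<le> \<delta> * M\<^sup>2 / 2" using False that by (auto simp: S_def)
      have "(g k)\<^sup>2 * (- 1) \<le> (g k)\<^sup>2 * h k" by (intro mult_left_mono) (simp_all add: h_def)
      moreover have "g k * g k \<le> \<delta> * M\<^sup>2 / 2 * g k" using gk g0 by (intro mult_right_mono) auto
      ultimately show ?thesis using k by (simp add: power2_eq_square)
    qed
    have "M ^ 4 - \<delta> * M\<^sup>2 / 2 * (real N * M) = (\<Sum>k<N. (if k = 0 then M ^ 4 else 0) - \<delta> * M\<^sup>2 / 2 * g k)"
      unfolding sum_subtractf sum_distrib_left[symmetric] pars using N by simp
    also have "\<dots> \<le> (\<Sum>k<N. (g k)\<^sup>2 * h k)" using low by (intro sum_mono) auto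
    finally have "M ^ 4 \<le> M ^ 3 / 2 * (\<delta> * real N)"
      unfolding sum0 by (simp add: power2_eq_square power3_eq_cube algebra_simps)
    also have "\<dots> \<le> M ^ 3 / 2 * M" using \<delta>(2) M by (intro mult_left_mono) (auto simp: M_def)
    finally show False using M by (simp add: eval_nat_numeral)
  qed
qed

section \<open>Bohr sets and progressions\<close>

text \<open>The usual condition that \<open>\<xi> j * x / N\<close> lies within \<open>r\<close> of
  an integer, with denominators cleared.\<close>

definition bohr :: "nat \<Rightarrow> int \<Rightarrow> (nat \<Rightarrow> int) \<Rightarrow> real \<Rightarrow> int set" where
  "bohr d N \<xi> r = {x. \<forall>j<d. \<exists>m :: int. real_of_int \<bar>\<xi> j * x - N * m\<bar> \<le> r * real_of_int N}"

text \<open>The bounds may be 0, unlike in \<open>int_gap\<close>; the final progression is adjusted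
  for that.\<close>

definition gap :: "nat \<Rightarrow> (nat \<Rightarrow> int) \<Rightarrow> (nat \<Rightarrow> nat) \<Rightarrow> int set" where
  "gap d v M = {\<Sum>i<d. n i * v i | n :: nat \<Rightarrow> int. \<forall>i<d. \<bar>n i\<bar> \<le> int (M i)}"

lemma gapI: "(\<And>i. i < d \<Longrightarrow> \<bar>n i\<bar> \<le> int (M i)) \<Longrightarrow> (\<Sum>i<d. n i * v i) \<in> gap d v M"
  by (auto simp: gap_def)

lemma gapE:
  assumes "x \<in> gap d v M"
  obtains n where "x = (\<Sum>i<d. n i * v i)" "\<And>i. i < d \<Longrightarrow> \<bar>n i\<bar> \<le> int (M i)"
  using assms by (auto simp: gap_def)

lemma finite_gap: "finite (gap d v M)"
proof (rule finite_subset)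
  show "gap d v M \<subseteq> {- (\<Sum>i<d. int (M i) * \<bar>v i\<bar>)..(\<Sum>i<d. int (M i) * \<bar>v i\<bar>)}"
  proof
    fix x assume "x \<in> gap d v M"
    then obtain n where n: "x = (\<Sum>i<d. n i * v i)" "\<And>i. i < d \<Longrightarrow> \<bar>n i\<bar> \<le> int (M i)" by (rule gapE) blast
    have "\<bar>x\<bar> \<le> (\<Sum>i<d. \<bar>n i * v i\<bar>)" unfolding n(1) by (rule sum_abs)
    also have "\<dots> \<le> (\<Sum>i<d. int (M i) * \<bar>v i\<bar>)"
      unfolding abs_mult by (intro sum_mono mult_right_mono n(2)) auto
    finally show "x \<in> {- (\<Sum>i<d. int (M i) * \<bar>v i\<bar>)..(\<Sum>i<d. int (M i) * \<bar>v i\<bar>)}" by auto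
  qed
qed simp

lemma sum_fun_apply: "(\<Sum>i\<in>I. f i) x = (\<Sum>i\<in>I. (f i x :: 'c::comm_monoid_add))"
  by (induction I rule: infinite_finite_induct) auto

text \<open>An integer sequence \<open>y\<close> carries \<open>x\<close> in coordinate
  \<open>d\<close> and the integers near \<open>\<xi> j * x / N\<close> in the coordinates below, so
  the seminorm \<open>p\<close> measures the Bohr condition. Only \<open>d\<close> linear forms
  enter, hence rank \<open>d\<close>. Coordinate \<open>d\<close> maps a reduced box for
  \<open>p\<close> to the progression, and null vectors give the divisibility by
  \<open>N\<close>.\<close>

lemma bohr_box:
  assumes N: "N > 0" and r: "r > 0"
  shows "\<exists>v M. gap d v M \<subseteq> bohr d N \<xi> (real d * box_const d * r) \<and>
    (\<forall>x\<in>bohr d N \<xi> r. \<exists>y\<in>gap d v M. \<forall>j<d. N dvd \<xi> j * (x - y))"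
proof (cases "d = 0")
  case True
  then show ?thesis by (intro exI[of _ "\<lambda>_. 0"]) (auto simp: bohr_def gap_def)
next
  case False
  interpret int_module "\<lambda>c (y :: nat \<Rightarrow> int). (\<lambda>i. c * y i)"
    by unfold_locales (auto simp: fun_eq_iff algebra_simps)
  let ?sc = "\<lambda>c (y :: nat \<Rightarrow> int). (\<lambda>i. c * y i)"
  \<comment> \<open>Normalised so that \<open>d\<close> forms of size at most r N give
    \<open>p y \<le> 1\<close>.\<close>
  define D where "D = real d * r * real_of_int N"
  have D: "D > 0" using False N r by (simp add: D_def)
  define l where "l = (\<lambda>j (y :: nat \<Rightarrow> int). \<xi> j * y d - N * y j)"
  define p where "p = (\<lambda>y. (\<Sum>j<d. real_of_int \<bar>l j y\<bar>) / D)"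
  have l_add: "l j (x + y) = l j x + l j y" for j x y by (simp add: l_def algebra_simps)
  have l_sc: "l j (?sc c x) = c * l j x" for j c x by (simp add: l_def algebra_simps)
  have l_sum: "l j (\<Sum>i\<in>I. ?sc (c i) (x i)) = (\<Sum>i\<in>I. c i * l j (x i))" for j and I :: "nat set" and c x
    by (simp add: l_def sum_fun_apply sum_distrib_left right_diff_distrib sum_subtractf algebra_simps)
  have p: "seminorm p"
    unfolding seminorm_def
  proof (intro conjI allI)
    fix x y
    have "(\<Sum>j<d. real_of_int \<bar>l j (x + y)\<bar>) \<le> (\<Sum>j<d. real_of_int \<bar>l j x\<bar> + real_of_int \<bar>l j y\<bar>)"
      unfolding l_add by (intro sum_mono) (simp add: abs_triangle_ineq)
    then show "p (x + y) \<le> p x + p y"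
      using D by (simp add: p_def sum.distrib divide_right_mono flip: add_divide_distrib)
  next
    fix c x
    show "p (?sc c x) = real_of_int \<bar>c\<bar> * p x"
      unfolding p_def l_sc by (simp add: abs_mult sum_distrib_left)
  qed
  have l_le: "real_of_int \<bar>l j y\<bar> \<le> p y * D" if "j < d" for j y
    using member_le_sum[of j "{..<d}" "\<lambda>j. real_of_int \<bar>l j y\<bar>"] that D by (simp add: p_def)
  have disc: "discrete_norm p"
    unfolding discrete_norm_def
  proof (intro exI[of _ "1 / D"] conjI allI)
    fix y
    show "p y = 0 \<or> 1 / D \<le> p y"
    proof (cases "(\<Sum>j<d. \<bar>l j y\<bar>) = 0")
      case False
      moreover have "0 \<le> (\<Sum>j<d. \<bar>l j y\<bar>)" by (intro sum_nonneg) simp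
      ultimately have "1 \<le> (\<Sum>j<d. \<bar>l j y\<bar>)" by linarith
      then have "1 \<le> real_of_int (\<Sum>j<d. \<bar>l j y\<bar>)" by linarith
      then show ?thesis using D by (simp add: p_def divide_right_mono)
    next
      case True
      then have "real_of_int (\<Sum>j<d. \<bar>l j y\<bar>) = 0" by simp
      then show ?thesis by (simp add: p_def)
    qed
  qed (use D in simp)
  have rank: "rank_le p d"
    unfolding rank_le_def
  proof
    fix x :: "nat \<Rightarrow> nat \<Rightarrow> int"
    obtain c where c: "\<exists>i\<in>{..d}. c i \<noteq> 0" "\<forall>j<d. (\<Sum>i\<in>{..d}. c i * l j (x i)) = 0"
      using integer_dependence[of "{..d}" d "\<lambda>i j. l j (x i)"] by auto
    then show "\<exists>c :: nat \<Rightarrow> int. (\<exists>i\<le>d. c i \<noteq> 0) \<and> p (\<Sum>i\<le>d. ?sc (c i) (x i)) = 0"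
      by (intro exI[of _ c]) (auto simp: p_def l_sum)
  qed
  obtain v M where vM: "(\<Sum>i<d. real (M i) * p (v i)) \<le> box_const d"
    "\<And>x. p x \<le> 1 \<Longrightarrow> \<exists>n :: nat \<Rightarrow> int. (\<forall>i<d. \<bar>n i\<bar> \<le> int (M i)) \<and> p (x - (\<Sum>i<d. ?sc (n i) (v i))) = 0"
    using unit_ball_box[OF p rank disc] by blast
  define w where "w = (\<lambda>i. v i d)"
  show ?thesis
  proof (intro exI[of _ w] exI[of _ M] conjI ballI subsetI)
    fix x assume "x \<in> gap d w M"
    then obtain n where n: "x = (\<Sum>i<d. n i * w i)" "\<And>i. i < d \<Longrightarrow> \<bar>n i\<bar> \<le> int (M i)" by (rule gapE) blast
    define y where "y = (\<Sum>i<d. ?sc (n i) (v i))"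
    have yd: "y d = x" by (simp add: y_def n(1) w_def sum_fun_apply)
    have "p y \<le> (\<Sum>i<d. real_of_int \<bar>n i\<bar> * p (v i))" unfolding y_def by (rule seminorm_sum[OF p])
    also have "\<dots> \<le> (\<Sum>i<d. real (M i) * p (v i))"
    proof (intro sum_mono mult_right_mono)
      fix i assume "i \<in> {..<d}"
      then have "\<bar>n i\<bar> \<le> int (M i)" using n(2) by simp
      then show "real_of_int \<bar>n i\<bar> \<le> real (M i)" by linarith
    qed (simp add: seminormD(5)[OF p])
    finally have py: "p y \<le> box_const d" using vM(1) by simp
    show "x \<in> bohr d N \<xi> (real d * box_const d * r)"
      unfolding bohr_def
    proof (intro CollectI allI impI)
      fix j assume "j < d"
      have "real_of_int \<bar>l j y\<bar> \<le> box_const d * D"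
        using l_le[OF \<open>j < d\<close>, of y] mult_right_mono[OF py, of D] D by linarith
      then have "real_of_int \<bar>\<xi> j * x - N * y j\<bar> \<le> real d * box_const d * r * real_of_int N"
        by (simp add: l_def yd D_def algebra_simps)
      then show "\<exists>m. real_of_int \<bar>\<xi> j * x - N * m\<bar> \<le> real d * box_const d * r * real_of_int N" ..
    qed
  next
    fix x assume "x \<in> bohr d N \<xi> r"
    then have "\<forall>j. \<exists>m. j < d \<longrightarrow> real_of_int \<bar>\<xi> j * x - N * m\<bar> \<le> r * real_of_int N"
      by (auto simp: bohr_def)
    then obtain m where m: "\<And>j. j < d \<Longrightarrow> real_of_int \<bar>\<xi> j * x - N * m j\<bar> \<le> r * real_of_int N" by metis
    define y where "y = (\<lambda>j. if j < d then m j else x)"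
    have "(\<Sum>j<d. real_of_int \<bar>l j y\<bar>) \<le> (\<Sum>j<d. r * real_of_int N)"
      using m by (intro sum_mono) (simp add: l_def y_def)
    then have "p y \<le> 1" using D by (simp add: p_def D_def)
    then obtain n :: "nat \<Rightarrow> int" where n: "\<And>i. i < d \<Longrightarrow> \<bar>n i\<bar> \<le> int (M i)"
      "p (y - (\<Sum>i<d. ?sc (n i) (v i))) = 0" using vM(2) by blast
    define z where "z = y - (\<Sum>i<d. ?sc (n i) (v i))"
    have zd: "z d = x - (\<Sum>i<d. n i * w i)" by (simp add: z_def y_def w_def sum_fun_apply)
    show "\<exists>y\<in>gap d w M. \<forall>j<d. N dvd \<xi> j * (x - y)"
    proof (intro bexI allI impI)
      show "(\<Sum>i<d. n i * w i) \<in> gap d w M" by (rule gapI[OF n(1)])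
      fix j assume "j < d"
      then have "l j z = 0" using l_le[of j z] n(2) by (simp add: z_def[symmetric])
      then have "\<xi> j * (x - (\<Sum>i<d. n i * w i)) = N * z j" by (simp add: l_def zd)
      then show "N dvd \<xi> j * (x - (\<Sum>i<d. n i * w i))" by simp
    qed
  qed
qed

lemma pigeonhole_fiber:
  assumes "finite A" "f ` A \<subseteq> B" "finite B" "A \<noteq> {}"
  obtains y where "y \<in> B" "card A \<le> card B * card {x \<in> A. f x = y}"
proof -
  have "\<exists>y\<in>B. card A \<le> card B * card {x \<in> A. f x = y}"
  proof (rule ccontr)
    assume "\<not> ?thesis"
    then have *: "\<And>y. y \<in> B \<Longrightarrow> card B * card {x \<in> A. f x = y} < card A" by (auto simp: not_le)
    have B: "B \<noteq> {}" using assms by auto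
    have "card A = (\<Sum>y\<in>B. card {x \<in> A. f x = y})"
      using sum.group[OF assms(1,3,2), of "\<lambda>_. 1::nat"] by simp
    then have "card B * card A = (\<Sum>y\<in>B. card B * card {x \<in> A. f x = y})"
      by (simp add: sum_distrib_left)
    also have "\<dots> < (\<Sum>y\<in>B. card A)" using assms B * by (intro sum_strict_mono) auto
    finally show False by simp
  qed
  then show ?thesis using that by blast
qed

text \<open>Pigeonhole over the Q^d cells of side 1/Q of the torus: some cell receives at least N /
  Q^d residues, and two points of one cell differ by an element of the Bohr set of radius
  1/Q.\<close>

lemma bohr_large:
  assumes N: "N > 0" and Q: "Q > 0"
  obtains X x0 where "X \<subseteq> {0..<N}" "nat N \<le> Q ^ d * card X"
    "\<And>x. x \<in> X \<Longrightarrow> x - x0 \<in> bohr d N \<xi> (1 / real Q)"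
proof -
  define f where "f = (\<lambda>x. \<lambda>j\<in>{..<d}. (int Q * ((\<xi> j * x) mod N)) div N)"
  have cell: "(int Q * ((\<xi> j * x) mod N)) div N \<in> {0..<int Q}" for j x
  proof -
    have "int Q * ((\<xi> j * x) mod N) < int Q * N" using Q N by simp
    then have "(int Q * ((\<xi> j * x) mod N)) div N < int Q"
    proof (rule contrapos_pp)
      assume "\<not> (int Q * ((\<xi> j * x) mod N)) div N < int Q"
      then have "N * int Q \<le> N * ((int Q * ((\<xi> j * x) mod N)) div N)"
        using N by (intro mult_left_mono) auto
      also have "\<dots> \<le> int Q * ((\<xi> j * x) mod N)"
        using minus_mod_eq_mult_div[of "int Q * ((\<xi> j * x) mod N)" N]
          pos_mod_sign[OF N, of "int Q * ((\<xi> j * x) mod N)"] by linarith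
      finally show "\<not> int Q * ((\<xi> j * x) mod N) < int Q * N" by (simp add: mult.commute)
    qed
    then show ?thesis using N by (simp add: pos_imp_zdiv_nonneg_iff)
  qed
  have "f ` {0..<N} \<subseteq> PiE {..<d} (\<lambda>_. {0..<int Q})" using cell by (auto simp: f_def split: if_splits)
  moreover have "finite (PiE {..<d} (\<lambda>_. {0..<int Q}))" by (intro finite_PiE) auto
  moreover have "{0..<N} \<noteq> {}" using N by simp
  ultimately obtain y where y: "card {0..<N} \<le> card (PiE {..<d} (\<lambda>_. {0..<int Q})) * card {x \<in> {0..<N}. f x = y}"
    by (rule pigeonhole_fiber[OF finite_atLeastLessThan_int])
  define X where "X = {x \<in> {0..<N}. f x = y}"
  have X: "nat N \<le> Q ^ d * card X" using y by (simp add: card_PiE X_def)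
  then have "X \<noteq> {}" using N by auto
  then obtain x0 where x0: "x0 \<in> X" by auto
  show ?thesis
  proof (rule that[OF _ X])
    show "X \<subseteq> {0..<N}" by (auto simp: X_def)
    fix x assume x: "x \<in> X"
    show "x - x0 \<in> bohr d N \<xi> (1 / real Q)"
      unfolding bohr_def
    proof (intro CollectI allI impI exI)
      fix j assume j: "j < d"
      define s where "s = (\<xi> j * x) mod N"
      define s0 where "s0 = (\<xi> j * x0) mod N"
      have "f x j = f x0 j" using x x0 by (simp add: X_def)
      then have c: "(int Q * s) div N = (int Q * s0) div N" using j by (simp add: f_def s_def s0_def)
      have "int Q * s - int Q * s0 = (int Q * s) mod N - (int Q * s0) mod N"
        using minus_mod_eq_mult_div[of "int Q * s" N] minus_mod_eq_mult_div[of "int Q * s0" N]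
        unfolding c by linarith
      moreover have "0 \<le> (int Q * s) mod N" "(int Q * s) mod N < N" "0 \<le> (int Q * s0) mod N" "(int Q * s0) mod N < N"
        using N by simp_all
      ultimately have "\<bar>int Q * (s - s0)\<bar> \<le> N" unfolding right_diff_distrib by linarith
      then have "int Q * \<bar>s - s0\<bar> \<le> N" by (simp add: abs_mult)
      then have "real_of_int (int Q * \<bar>s - s0\<bar>) \<le> real_of_int N" by (simp only: of_int_le_iff)
      then have "real_of_int \<bar>s - s0\<bar> \<le> 1 / real Q * real_of_int N" using Q by (simp add: field_simps)
      moreover have "\<xi> j * (x - x0) - N * ((\<xi> j * x) div N - (\<xi> j * x0) div N) = s - s0"
        by (simp add: s_def s0_def minus_mult_div_eq_mod[symmetric] algebra_simps)
      ultimately show "real_of_int \<bar>\<xi> j * (x - x0) - N * ((\<xi> j * x) div N - (\<xi> j * x0) div N)\<bar>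
          \<le> 1 / real Q * real_of_int N" by simp
    qed
  qed
qed

text \<open>The bound on the spectrum in \<open>bogolyubov\<close>, rounded up, plus one place for
  the frequency 1.\<close>

definition freiman_rank :: "real \<Rightarrow> nat" where
  "freiman_rank \<delta> = nat \<lceil>2 / \<delta>\<^sup>2\<rceil> + 1"

text \<open>The base is the \<open>Q\<close> of \<open>dense_set_progression\<close>, so large that
  the box obtained from the Bohr set of radius 1/Q still lies in the one of radius 1/4, as
  \<open>bogolyubov\<close> requires.\<close>

definition freiman_loss :: "real \<Rightarrow> nat" where
  "freiman_loss \<delta> = (nat \<lceil>4 * real (freiman_rank \<delta>) * box_const (freiman_rank \<delta>)\<rceil> + 1) ^ freiman_rank \<delta>"

lemma enumerate_with_repetition:
  assumes "finite T" "T \<noteq> {}" "card T \<le> d"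
  obtains h :: "nat \<Rightarrow> 'a" where "h ` {..<d} = T"
proof -
  obtain g where g: "bij_betw g {0..<card T} T" using ex_bij_betw_nat_finite[OF assms(1)] by auto
  have T0: "card T > 0" using assms by (simp add: card_gt_0_iff)
  show ?thesis
  proof (rule that[of "\<lambda>i. if i < card T then g i else g 0"])
    show "(\<lambda>i. if i < card T then g i else g 0) ` {..<d} = T"
      using g T0 assms(3) by (force simp: bij_betw_def)
  qed
qed

lemma dense_set_progression:
  assumes N: "N > 0" and F: "F \<noteq> {}" "F \<subseteq> {0..<int N}" and \<delta>: "\<delta> > 0" "\<delta> * real N \<le> real (card F)"
  obtains v M where
    "\<And>x. x \<in> gap (freiman_rank \<delta>) v M \<Longrightarrow> \<exists>a\<in>F. \<exists>b\<in>F. \<exists>c\<in>F. \<exists>e\<in>F. int N dvd a + b - c - e - x"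
    "N \<le> freiman_loss \<delta> * card ((\<lambda>x. x mod int N) ` gap (freiman_rank \<delta>) v M)"
proof -
  define d where "d = freiman_rank \<delta>"
  define Q where "Q = nat \<lceil>4 * real d * box_const d\<rceil> + 1"
  have loss: "freiman_loss \<delta> = Q ^ d" by (simp add: freiman_loss_def Q_def d_def)
  obtain S where S: "S \<subseteq> {..<N}" "real (card S) \<le> 2 / \<delta>\<^sup>2"
    "\<And>x :: int. (\<And>k. k \<in> S \<Longrightarrow> \<exists>m :: int. 4 * \<bar>int k * x - int N * m\<bar> \<le> int N) \<Longrightarrow>
      \<exists>a\<in>F. \<exists>b\<in>F. \<exists>c\<in>F. \<exists>e\<in>F. int N dvd a + b - c - e - x"
    using bogolyubov[OF N F \<delta>] by metis
  have fS: "finite S" using S(1) by (rule finite_subset) simp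
  \<comment> \<open>Frequency 1 is added so that divisibility of all
    \<open>\<xi> j * (x - y)\<close> by \<open>N\<close> makes \<open>x\<close> and \<open>y\<close>
    congruent; without it distinct residues might share one point of the progression.\<close>
  have "card (insert 1 S) \<le> card S + 1" using fS by (simp add: card_insert_if)
  also have "\<dots> \<le> d" using S(2) unfolding d_def freiman_rank_def by linarith
  finally obtain \<xi>' where \<xi>': "\<xi>' ` {..<d} = insert 1 S"
    using enumerate_with_repetition[of "insert 1 S" d] fS by auto
  define \<xi> where "\<xi> = (\<lambda>j. int (\<xi>' j))"
  obtain v M where vM: "gap d v M \<subseteq> bohr d (int N) \<xi> (real d * box_const d * (1 / real Q))"
    "\<And>x. x \<in> bohr d (int N) \<xi> (1 / real Q) \<Longrightarrow> \<exists>y\<in>gap d v M. \<forall>j<d. int N dvd \<xi> j * (x - y)"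
    using bohr_box[of "int N" "1 / real Q" d \<xi>] N by (auto simp: Q_def)
  have small: "real d * box_const d * (1 / real Q) \<le> 1 / 4"
  proof -
    have "4 * real d * box_const d \<le> real Q" unfolding Q_def by linarith
    moreover have "real Q > 0" by (simp add: Q_def)
    ultimately show ?thesis by (simp add: field_simps)
  qed
  have 1: "\<exists>a\<in>F. \<exists>b\<in>F. \<exists>c\<in>F. \<exists>e\<in>F. int N dvd a + b - c - e - x" if x: "x \<in> gap d v M" for x
  proof (rule S(3))
    fix k assume "k \<in> S"
    then have "k \<in> \<xi>' ` {..<d}" using \<xi>' by simp
    then obtain j where j: "j < d" "\<xi> j = int k" by (auto simp: \<xi>_def)
    obtain m where "real_of_int \<bar>\<xi> j * x - int N * m\<bar> \<le> real d * box_const d * (1 / real Q) * real_of_int (int N)"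
      using subsetD[OF vM(1) x] j(1) unfolding bohr_def by blast
    also have "\<dots> \<le> 1 / 4 * real_of_int (int N)" by (rule mult_right_mono[OF small]) simp
    finally have "real_of_int (4 * \<bar>int k * x - int N * m\<bar>) \<le> real_of_int (int N)" unfolding j(2) by simp
    then have "4 * \<bar>int k * x - int N * m\<bar> \<le> int N" by (simp only: of_int_le_iff)
    then show "\<exists>m :: int. 4 * \<bar>int k * x - int N * m\<bar> \<le> int N" ..
  qed
  obtain X x0 where X: "X \<subseteq> {0..<int N}" "nat (int N) \<le> Q ^ d * card X"
    "\<And>x. x \<in> X \<Longrightarrow> x - x0 \<in> bohr d (int N) \<xi> (1 / real Q)"
    using bohr_large[of "int N" Q d \<xi>] N by (auto simp: Q_def)
  have "card X \<le> card ((\<lambda>x. x mod int N) ` gap d v M)"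
  \<comment> \<open>Subtracting \<open>x0\<close> moves the crowded cell into the Bohr set, whose
    residues are all attained on the progression.\<close>
  proof (rule card_inj_on_le[of "\<lambda>x. (x - x0) mod int N"])
    show "inj_on (\<lambda>x. (x - x0) mod int N) X"
    proof (rule inj_onI)
      fix x y assume xy: "x \<in> X" "y \<in> X" "(x - x0) mod int N = (y - x0) mod int N"
      then have "x mod int N = y mod int N" by (simp add: mod_eq_dvd_iff)
      then show "x = y" using xy X(1) by (auto simp: subset_iff)
    qed
    show "(\<lambda>x. (x - x0) mod int N) ` X \<subseteq> (\<lambda>x. x mod int N) ` gap d v M"
    proof clarify
      fix x assume "x \<in> X"
      then obtain y where y: "y \<in> gap d v M" "\<And>j. j < d \<Longrightarrow> int N dvd \<xi> j * (x - x0 - y)"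
        using X(3) vM(2) by blast
      have "1 \<in> \<xi>' ` {..<d}" using \<xi>' by simp
      then obtain j where "j < d" "\<xi> j = 1" by (auto simp: \<xi>_def)
      then have "int N dvd x - x0 - y" using y(2)[of j] by simp
      then have "(x - x0) mod int N = y mod int N" by (simp add: mod_eq_dvd_iff)
      then show "(x - x0) mod int N \<in> (\<lambda>x. x mod int N) ` gap d v M" using y(1) by blast
    qed
  qed (simp add: finite_gap)
  then have "N \<le> Q ^ d * card ((\<lambda>x. x mod int N) ` gap d v M)"
    using X(2) by (simp add: order_trans[OF _ mult_le_mono2])
  then show ?thesis using 1 by (intro that[of v M]) (simp_all add: loss d_def)
qed

section \<open>Freiman's theorem in the integers\<close>

lemma card_multiples_le: "card {t \<in> {1..m}. N dvd t} \<le> m div N" for m N :: nat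
proof (cases "N = 0")
  case False
  have "{t \<in> {1..m}. N dvd t} \<subseteq> (\<lambda>i. N * i) ` {1..m div N}"
  proof
    fix t assume "t \<in> {t \<in> {1..m}. N dvd t}"
    then obtain i where "t = N * i" "1 \<le> t" "t \<le> m" by auto
    then show "t \<in> (\<lambda>i. N * i) ` {1..m div N}"
      using False by (auto simp: less_eq_div_iff_mult_less_eq mult.commute intro!: image_eqI[of _ _ i])
  qed
  then have "card {t \<in> {1..m}. N dvd t} \<le> card ((\<lambda>i. N * i) ` {1..m div N})"
    by (intro card_mono) auto
  also have "\<dots> \<le> m div N" using card_image_le[of "{1..m div N}"] by simp
  finally show ?thesis .
qed auto

text \<open>Both representatives of \<open>q * c\<close> of absolute value below \<open>p\<close> are excluded, because sums of
  differences of residues have either sign.\<close>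

lemma good_multiplier:
  fixes p N :: nat and C :: "int set"
  assumes p: "prime p" and C: "finite C" "\<And>c. c \<in> C \<Longrightarrow> c \<noteq> 0 \<Longrightarrow> \<not> int p dvd c" and N: "N > 2 * card C"
  obtains q :: int where
    "\<And>c. c \<in> C \<Longrightarrow> c \<noteq> 0 \<Longrightarrow> \<not> int N dvd (q * c) mod int p \<and> \<not> int N dvd (q * c) mod int p - int p"
proof -
  have p2: "p \<ge> 2" using p by (rule prime_ge_2_nat)
  define T where "T = {t \<in> {1..<int p}. int N dvd t \<or> int N dvd t - int p}"
  define B where "B = (\<lambda>c. {q \<in> {1..<int p}. (q * c) mod int p \<in> T})"
  have cT: "card T \<le> 2 * ((p - 1) div N)"
  proof -
    let ?M = "{t \<in> {1..p - 1}. N dvd t}"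
    have "T \<subseteq> int ` ?M \<union> (\<lambda>t. int p - int t) ` ?M"
    proof
      fix t assume t: "t \<in> T"
      then have tt: "1 \<le> t" "t < int p" by (auto simp: T_def)
      from t consider "int N dvd t" | "int N dvd t - int p" by (auto simp: T_def)
      then show "t \<in> int ` ?M \<union> (\<lambda>t. int p - int t) ` ?M"
      proof cases
        case 1
        obtain n where n: "t = int n" using zero_le_imp_eq_int[of t] tt by auto
        then have "n \<in> ?M" using 1 tt by auto
        then show ?thesis using n by blast
      next
        case 2
        obtain n where n: "int p - t = int n" using zero_le_imp_eq_int[of "int p - t"] tt by auto
        have "int N dvd int p - t" using 2 by (simp add: dvd_diff_commute)
        then have "n \<in> ?M" using tt n by auto
        moreover have "t = int p - int n" using n by simp
        ultimately show ?thesis by blast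
      qed
    qed
    then have "card T \<le> card (int ` ?M \<union> (\<lambda>t. int p - int t) ` ?M)" by (intro card_mono) auto
    also have "\<dots> \<le> card (int ` ?M) + card ((\<lambda>t. int p - int t) ` ?M)" by (rule card_Un_le)
    also have "\<dots> \<le> card ?M + card ?M" by (intro add_mono card_image_le) auto
    also have "\<dots> \<le> 2 * ((p - 1) div N)" using card_multiples_le[of "p - 1" N] by linarith
    finally show ?thesis .
  qed
  have fT: "finite T" unfolding T_def by (rule finite_subset[of _ "{1..<int p}"]) auto
  have cB: "card (B c) \<le> card T" if "c \<in> C - {0}" for c
  proof (rule card_inj_on_le[of "\<lambda>q. (q * c) mod int p"])
    show "inj_on (\<lambda>q. (q * c) mod int p) (B c)"
    proof (rule inj_onI)
      fix q q' assume q: "q \<in> B c" "q' \<in> B c" "(q * c) mod int p = (q' * c) mod int p"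
      then have "int p dvd (q - q') * c" by (simp add: mod_eq_dvd_iff left_diff_distrib)
      then have "int p dvd q - q'" using p C(2)[of c] that by (auto simp: prime_dvd_mult_iff)
      then have "q mod int p = q' mod int p" by (simp add: mod_eq_dvd_iff)
      then show "q = q'" using q by (auto simp: B_def)
    qed
  qed (auto simp: B_def fT)
  \<comment> \<open>Each nonzero \<open>c\<close> forbids at most \<open>card T\<close> multipliers,
    as multiplication by \<open>c\<close> is injective modulo \<open>p\<close>; the hypothesis
    \<open>N > 2 * card C\<close> keeps the total below p - 1.\<close>
  have "card (\<Union>c\<in>C - {0}. B c) \<le> (\<Sum>c\<in>C - {0}. card (B c))"
    using C(1) by (intro card_UN_le) auto
  also have "\<dots> \<le> (\<Sum>c\<in>C - {0}. 2 * ((p - 1) div N))"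
    using cB cT by (intro sum_mono) (meson order_trans)
  also have "\<dots> \<le> 2 * card C * ((p - 1) div N)"
    using card_mono[OF C(1), of "C - {0}"] by simp
  also have "\<dots> < p - 1"
  proof (cases "(p - 1) div N = 0")
    case False
    then have "2 * card C * ((p - 1) div N) < N * ((p - 1) div N)" using N by simp
    also have "\<dots> \<le> p - 1" by simp
    finally show ?thesis .
  qed (use p2 in simp)
  also have "p - 1 = card {1..<int p}" by simp
  finally have less: "card (\<Union>c\<in>C - {0}. B c) < card {1..<int p}" .
  have "finite (B c)" for c unfolding B_def by (rule finite_subset[of _ "{1..<int p}"]) auto
  then have "finite (\<Union>c\<in>C - {0}. B c)" using C(1) by simp
  then have "\<not> {1..<int p} \<subseteq> (\<Union>c\<in>C - {0}. B c)"
    using less card_mono[of "\<Union>c\<in>C - {0}. B c" "{1..<int p}"] by linarith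
  then obtain q where q: "q \<in> {1..<int p}" "\<And>c. c \<in> C - {0} \<Longrightarrow> q \<notin> B c" by blast
  show ?thesis
  proof (rule that[of q])
    fix c assume c: "c \<in> C" "c \<noteq> 0"
    have "\<not> int p dvd q" using q(1) by (auto dest: zdvd_imp_le)
    then have "\<not> int p dvd q * c" using C(2)[OF c] p by (auto simp: prime_dvd_mult_iff)
    then have "(q * c) mod int p \<noteq> 0" by (simp add: dvd_eq_mod_eq_0)
    moreover have "0 \<le> (q * c) mod int p" "(q * c) mod int p < int p" using p2 by simp_all
    ultimately have "(q * c) mod int p \<in> {1..<int p}" by simp
    then show "\<not> int N dvd (q * c) mod int p \<and> \<not> int N dvd (q * c) mod int p - int p"
      using q c by (auto simp: B_def T_def)
  qed
qed

text \<open>Multiply by \<open>q\<close>, reduce modulo \<open>p\<close>, and keep a part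
  \<open>A'\<close> whose residues lie in one interval of length p / k. A sum \<open>D\<close> of
  \<open>k\<close> differences of such residues is below \<open>p\<close> in absolute value, so it
  is one of the two representatives of \<open>q * c\<close> that the choice of \<open>q\<close>
  controls.\<close>

lemma ruzsa_model:
  fixes A C :: "int set" and k N :: nat
  assumes A: "finite A" "A \<noteq> {}" and k: "k > 0" and C: "finite C"
    and AC: "\<And>a b. (\<And>i. i < k \<Longrightarrow> a i \<in> A \<and> b i \<in> A) \<Longrightarrow> (\<Sum>i<k. a i - b i) \<in> C"
    and N: "N > 2 * card C"
  obtains A' and f :: "int \<Rightarrow> int" where "A' \<subseteq> A" "card A \<le> k * card A'"
    "\<And>a b. (\<And>i. i < k \<Longrightarrow> a i \<in> A' \<and> b i \<in> A') \<Longrightarrow>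
      int N dvd (\<Sum>i<k. f (a i) - f (b i)) \<longleftrightarrow> (\<Sum>i<k. a i - b i) = 0"
proof -
  \<comment> \<open>\<open>p\<close> exceeds every |c|, so it divides no nonzero element of
    \<open>C\<close>.\<close>
  obtain p where p: "prime p" "p > nat (\<Sum>c\<in>C. \<bar>c\<bar>)" using bigger_prime by blast
  have p0: "int p > 0" using prime_gt_0_nat[OF p(1)] by simp
  have Cp: "\<not> int p dvd c" if "c \<in> C" "c \<noteq> 0" for c
  proof
    assume "int p dvd c"
    then have "int p \<le> \<bar>c\<bar>" using that(2) zdvd_imp_le[of "int p" "\<bar>c\<bar>"] by simp
    also have "\<bar>c\<bar> \<le> (\<Sum>c\<in>C. \<bar>c\<bar>)" using that C by (intro member_le_sum) auto
    finally show False using p(2) by linarith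
  qed
  obtain q where q: "\<And>c. c \<in> C \<Longrightarrow> c \<noteq> 0 \<Longrightarrow>
      \<not> int N dvd (q * c) mod int p \<and> \<not> int N dvd (q * c) mod int p - int p"
    using good_multiplier[OF p(1) C Cp N] by metis
  define f where "f = (\<lambda>a. (q * a) mod int p)"
  have f: "0 \<le> f a" "f a < int p" for a using p0 by (simp_all add: f_def)
  define h where "h = (\<lambda>a. (int k * f a) div int p)"
  have hk: "int p * h a \<le> int k * f a \<and> int k * f a < int p * h a + int p" for a
    using minus_mod_eq_mult_div[of "int k * f a" "int p"] pos_mod_sign[OF p0, of "int k * f a"]
      pos_mod_bound[OF p0, of "int k * f a"] unfolding h_def by linarith
  have hA: "h ` A \<subseteq> {0..<int k}"
  proof clarify
    fix a
    have "int p * h a < int p * int k"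
    proof -
      have "int k * f a < int p * int k" using f(2)[of a] k by (simp add: mult.commute)
      then show ?thesis using hk[of a] by linarith
    qed
    then show "h a \<in> {0..<int k}"
      using p0 f(1)[of a] by (simp add: h_def pos_imp_zdiv_nonneg_iff)
  qed
  obtain z where z: "card A \<le> card {0..<int k} * card {a \<in> A. h a = z}"
    using pigeonhole_fiber[OF A(1) hA _ A(2)] by blast
  define A' where "A' = {a \<in> A. h a = z}"
  show ?thesis
  proof (rule that[of A' f])
    show "A' \<subseteq> A" by (auto simp: A'_def)
    show "card A \<le> k * card A'" using z by (simp add: A'_def)
    fix a b :: "nat \<Rightarrow> int" assume ab: "\<And>i. i < k \<Longrightarrow> a i \<in> A' \<and> b i \<in> A'"
    define D where "D = (\<Sum>i<k. f (a i) - f (b i))"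
    define c where "c = (\<Sum>i<k. a i - b i)"
    have cC: "c \<in> C" unfolding c_def using ab by (intro AC) (auto simp: A'_def)
    have "int k * \<bar>D\<bar> = \<bar>\<Sum>i<k. int k * (f (a i) - f (b i))\<bar>"
      by (simp add: D_def abs_mult flip: sum_distrib_left)
    also have "\<dots> \<le> (\<Sum>i<k. \<bar>int k * (f (a i) - f (b i))\<bar>)" by (rule sum_abs)
    also have "\<dots> < (\<Sum>i<k. int p)"
    proof (rule sum_strict_mono)
      fix i assume "i \<in> {..<k}"
      then have "h (a i) = z" "h (b i) = z" using ab by (auto simp: A'_def)
      then show "\<bar>int k * (f (a i) - f (b i))\<bar> < int p"
        using hk[of "a i"] hk[of "b i"] by (simp add: right_diff_distrib abs_less_iff)
    qed (use k in auto)
    finally have Dp: "\<bar>D\<bar> < int p" using k by simp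
    have "int p dvd D - q * c"
    proof -
      have "D - q * c = (\<Sum>i<k. (f (a i) - q * a i) - (f (b i) - q * b i))"
        by (simp add: D_def c_def sum_distrib_left sum_subtractf right_diff_distrib)
      moreover have "int p dvd f y - q * y" for y
        by (simp add: f_def mod_eq_dvd_iff[symmetric])
      ultimately show ?thesis by (simp add: dvd_sum dvd_diff)
    qed
    then have Dq: "D mod int p = (q * c) mod int p" by (simp add: mod_eq_dvd_iff)
    have Dmod: "D = D mod int p \<or> D = D mod int p - int p"
    proof (cases "D \<ge> 0")
      case True then show ?thesis using Dp by simp
    next
      case False
      then have "(D + int p) mod int p = D + int p" using Dp by (intro mod_pos_pos_trivial) auto
      then show ?thesis by simp
    qed
    have "int N dvd D \<longleftrightarrow> c = 0"
    proof
      assume "int N dvd D"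
      then show "c = 0" using q[OF cC] Dmod unfolding Dq by metis
    next
      assume "c = 0"
      then have "int p dvd D" using Dq by (simp add: dvd_eq_mod_eq_0)
      then have "D = 0" using Dp zdvd_not_zless[of "\<bar>D\<bar>" "int p"] by auto
      then show "int N dvd D" by simp
    qed
    then show "int N dvd (\<Sum>i<k. f (a i) - f (b i)) \<longleftrightarrow> (\<Sum>i<k. a i - b i) = 0"
      by (simp only: D_def c_def)
  qed
qed

abbreviation sumset :: "int set \<Rightarrow> nat \<Rightarrow> int set" where
  "sumset A k \<equiv> set_pow integer_group A k"

lemma sum_in_sumset: "(\<And>i. i < k \<Longrightarrow> a i \<in> A) \<Longrightarrow> (\<Sum>i<k. a i) \<in> sumset A k"
proof (induction k)
  case (Suc k)
  have "a k + (\<Sum>i<k. a i) \<in> sumset A (Suc k)"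
    using Suc by (auto simp: set_mult_def)
  then show ?case by (simp add: add.commute)
qed simp

lemma sumset_addI: "x \<in> sumset A a \<Longrightarrow> y \<in> sumset A b \<Longrightarrow> x + y \<in> sumset A (a + b)"
  using group.set_pow_multI[OF group_integer_group, of A x a y b] by simp

lemma finite_sumset: "finite A \<Longrightarrow> finite (sumset A k)"
  by (rule group.finite_set_pow[OF group_integer_group])

lemma in_sumset_1: "x \<in> A \<Longrightarrow> x \<in> sumset A 1"
  using group.set_pow_1[OF group_integer_group, of A] by simp

text \<open>The induction removes one generator at a time, so that all partial sums stay in the box, where
  \<open>R\<close> is defined and additivity determines its value.\<close>

lemma transported_gap:
  assumes dom: "\<And>x. x \<in> gap d v M \<Longrightarrow> \<exists>y. R x y"
    and zero: "R 0 0"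
    and neg: "\<And>x y. R x y \<Longrightarrow> R (- x) (- y)"
    and add: "\<And>x y x' y' y''. R x y \<Longrightarrow> R x' y' \<Longrightarrow> R (x + x') y'' \<Longrightarrow> y'' = y + y'"
  shows "\<exists>w. \<forall>n. (\<forall>i<d. \<bar>n i\<bar> \<le> int (M i)) \<longrightarrow> R (\<Sum>i<d. n i * v i) (\<Sum>i<d. n i * w i)"
proof -
  have unit: "\<exists>y. R (v i) y" if "i < d" "M i \<ge> 1" for i
  proof -
    have "(\<Sum>j<d. (if j = i then 1 else 0) * v j) \<in> gap d v M"
      using that by (intro gapI) auto
    then have "v i \<in> gap d v M" using that by (simp add: if_distrib[of "\<lambda>x. x * _"] sum.delta cong: if_cong)
    then show ?thesis by (rule dom)
  qed
  \<comment> \<open>Where \<open>M i = 0\<close> the choice may be meaningless, but there only the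
    coefficient 0 occurs.\<close>
  define w where "w = (\<lambda>i. SOME y. R (v i) y)"
  have w: "R (v i) (w i)" if "i < d" "M i \<ge> 1" for i
    unfolding w_def using unit[OF that] by (rule someI_ex)
  have "R (\<Sum>i<d. n i * v i) (\<Sum>i<d. n i * w i)"
    if "\<And>i. i < d \<Longrightarrow> \<bar>n i\<bar> \<le> int (M i)" "nat (\<Sum>i<d. \<bar>n i\<bar>) = k" for n k
    using that
  proof (induction k arbitrary: n)
    case 0
    have "(\<Sum>i<d. \<bar>n i\<bar>) = 0" using 0(2) sum_nonneg[of "{..<d}" "\<lambda>i. \<bar>n i\<bar>"] by linarith
    then have "\<forall>i\<in>{..<d}. \<bar>n i\<bar> = 0" by (subst (asm) sum_nonneg_eq_0_iff) auto
    then show ?case using zero by simp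
  next
    case (Suc k)
    have "\<exists>i<d. n i \<noteq> 0"
    proof (rule ccontr)
      assume "\<not> ?thesis"
      then have "(\<Sum>i<d. \<bar>n i\<bar>) = 0" by simp
      then show False using Suc(3) by simp
    qed
    then obtain i where i: "i < d" "n i \<noteq> 0" by auto
    define n' where "n' = n(i := n i - sgn (n i))"
    have upd: "(\<Sum>j<d. g (n j) j) = (\<Sum>j<d. g (n' j) j) + (g (n i) i - g (n' i) i)" for g :: "int \<Rightarrow> nat \<Rightarrow> int"
    proof -
      have "(\<Sum>j<d. g (n j) j) = g (n i) i + (\<Sum>j\<in>{..<d} - {i}. g (n j) j)"
        using i by (intro sum.remove) auto
      also have "(\<Sum>j\<in>{..<d} - {i}. g (n j) j) = (\<Sum>j\<in>{..<d} - {i}. g (n' j) j)"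
        by (intro sum.cong) (auto simp: n'_def)
      also have "\<dots> = (\<Sum>j<d. g (n' j) j) - g (n' i) i"
        using i by (subst sum.remove[of "{..<d}" i]) auto
      finally show ?thesis by simp
    qed
    have abs': "\<bar>n' i\<bar> = \<bar>n i\<bar> - 1" using i(2) by (simp add: n'_def sgn_if)
    have box': "\<bar>n' j\<bar> \<le> int (M j)" if "j < d" for j
      using Suc(2)[OF that] abs' by (cases "j = i") (auto simp: n'_def)
    have "nat (\<Sum>j<d. \<bar>n' j\<bar>) = k"
      using upd[of "\<lambda>x _. \<bar>x\<bar>"] abs' Suc(3) by simp
    then have IH: "R (\<Sum>j<d. n' j * v j) (\<Sum>j<d. n' j * w j)" using Suc.IH box' by blast
    have Mi: "M i \<ge> 1" using Suc(2)[OF i(1)] i(2) by linarith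
    have step: "R (sgn (n i) * v i) (sgn (n i) * w i)"
      using w[OF i(1) Mi] neg[OF w[OF i(1) Mi]] i(2) by (simp add: sgn_if)
    have eq: "(\<Sum>j<d. n j * u j) = (\<Sum>j<d. n' j * u j) + sgn (n i) * u i" for u
      using upd[of "\<lambda>x j. x * u j"] by (simp add: n'_def algebra_simps)
    obtain y where y: "R (\<Sum>j<d. n j * v j) y"
      using dom[OF gapI[OF Suc(2)]] by auto
    then have "y = (\<Sum>j<d. n' j * w j) + sgn (n i) * w i"
      using add[OF IH step, of y] unfolding eq[of v] by simp
    then show ?case using y unfolding eq[of w] by simp
  qed
  then show ?thesis by blast
qed

text \<open>18 = 3 * 6: the modulus is at most 3 times the size of the 12-fold sumset, hence at most
  3 L |A|, and the model keeps at least a sixth of \<open>A\<close>.\<close>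

definition freiman_density :: "real \<Rightarrow> real" where
  "freiman_density L = 1 / (18 * L)"

text \<open>A progression found in the dense model modulo \<open>N\<close> is carried back by the
  relation \<open>R\<close>. Additivity of \<open>R\<close> involves three values of the form a + b
  - c - e, that is six terms on either side, so the model has to respect sums of six differences,
  which lie in the 12-fold sumset.\<close>

lemma freiman_int:
  fixes L :: real and A :: "int set"
  defines "d \<equiv> freiman_rank (freiman_density L)"
  assumes A: "finite A" "0 \<in> A" "\<And>a. a \<in> A \<Longrightarrow> - a \<in> A"
    and L: "L \<ge> 1" "real (card (sumset A 12)) \<le> L * real (card A)"
  obtains w M where "gap d w M \<subseteq> sumset A 4"
    "card A \<le> freiman_loss (freiman_density L) * card (gap d w M)"
proof -
  define \<delta> where "\<delta> = freiman_density L"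
  define C where "C = sumset A 12"
  have C: "finite C" unfolding C_def by (rule finite_sumset[OF A(1)])
  have A_C: "A \<subseteq> C"
    using group.set_pow_mono[OF group_integer_group, of A 1 12] A in_sumset_1 by (auto simp: C_def)
  have cA: "card A > 0" using A by (auto simp: card_gt_0_iff)
  define N where "N = 2 * card C + 1"
  have AC: "(\<Sum>i<6. a i - b i) \<in> C" if "\<And>i. i < 6 \<Longrightarrow> a i \<in> A \<and> b i \<in> A" for a b :: "nat \<Rightarrow> int"
  proof -
    have "(\<Sum>i<6. a i) \<in> sumset A 6" "(\<Sum>i<6. - b i) \<in> sumset A 6"
      using that A(3) by (auto intro!: sum_in_sumset)
    from sumset_addI[OF this] show ?thesis by (simp add: C_def sum_subtractf sum_negf)
  qed
  obtain A' f where A': "A' \<subseteq> A" "card A \<le> 6 * card A'"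
    and model: "\<And>a b :: nat \<Rightarrow> int. (\<And>i. i < 6 \<Longrightarrow> a i \<in> A' \<and> b i \<in> A') \<Longrightarrow>
      int N dvd (\<Sum>i<6. f (a i) - f (b i)) \<longleftrightarrow> (\<Sum>i<6. a i - b i) = 0"
    using ruzsa_model[of A 6 C N] A C AC by (auto simp: N_def)
  have ne: "A' \<noteq> {}" using A' cA by auto
  \<comment> \<open>\<open>o'\<close> pads shorter relations to six terms on each side.\<close>
  then obtain o' where o': "o' \<in> A'" by auto
  have model_list: "int N dvd (f a1 + f a2 + f a3 + f a4 + f a5 + f a6 - (f b1 + f b2 + f b3 + f b4 + f b5 + f b6))
      \<longleftrightarrow> a1 + a2 + a3 + a4 + a5 + a6 = b1 + b2 + b3 + b4 + b5 + b6"
    if "{a1, a2, a3, a4, a5, a6, b1, b2, b3, b4, b5, b6} \<subseteq> A'" for a1 a2 a3 a4 a5 a6 b1 b2 b3 b4 b5 b6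
  proof -
    have six: "(\<Sum>i<6. g i) = g 0 + g 1 + g 2 + g 3 + g 4 + g 5" for g :: "nat \<Rightarrow> int"
      by (simp add: eval_nat_numeral lessThan_Suc)
    have lt6: "i < 6 \<Longrightarrow> i = 0 \<or> i = 1 \<or> i = 2 \<or> i = 3 \<or> i = 4 \<or> i = 5" for i :: nat by linarith
    define a where "a = (\<lambda>i::nat. [a1, a2, a3, a4, a5, a6] ! i)"
    define b where "b = (\<lambda>i::nat. [b1, b2, b3, b4, b5, b6] ! i)"
    have "a i \<in> A' \<and> b i \<in> A'" if "i < 6" for i
      using lt6[OF that] \<open>_ \<subseteq> A'\<close> by (elim disjE) (simp_all add: a_def b_def)
    from model[of a b, OF this] show ?thesis
      unfolding six by (simp add: a_def b_def algebra_simps)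
  qed
  define F where "F = (\<lambda>a. f a mod int N) ` A'"
  have "inj_on (\<lambda>a. f a mod int N) A'"
  proof (rule inj_onI)
    fix x y assume xy: "x \<in> A'" "y \<in> A'" "f x mod int N = f y mod int N"
    then have "int N dvd f x - f y" by (simp add: mod_eq_dvd_iff)
    then show "x = y" using model_list[of x o' o' o' o' o' y o' o' o' o' o'] xy o' by simp
  qed
  then have cF: "card F = card A'" unfolding F_def by (rule card_image)
  have \<delta>: "\<delta> > 0" "\<delta> * real N \<le> real (card F)"
  proof -
    show "\<delta> > 0" using L by (simp add: \<delta>_def freiman_density_def)
    have "card C \<ge> 1" using A_C A C by (metis One_nat_def Suc_leI card_gt_0_iff empty_iff subsetD)
    then have "real N \<le> 3 * real (card C)" by (simp add: N_def)
    also have "\<dots> \<le> 3 * (L * real (card A))" using L by (simp add: C_def)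
    also have "\<dots> \<le> 3 * (L * (6 * real (card F)))"
      using A'(2) L unfolding cF by (intro mult_left_mono) linarith+
    finally show "\<delta> * real N \<le> real (card F)"
      using L by (simp add: \<delta>_def freiman_density_def field_simps)
  qed
  have F: "F \<noteq> {}" "F \<subseteq> {0..<int N}" "N > 0"
    using ne by (auto simp: F_def N_def)
  obtain v M where vM: "\<And>x. x \<in> gap d v M \<Longrightarrow> \<exists>a\<in>F. \<exists>b\<in>F. \<exists>c\<in>F. \<exists>e\<in>F. int N dvd a + b - c - e - x"
    "N \<le> freiman_loss \<delta> * card ((\<lambda>x. x mod int N) ` gap d v M)"
    using dense_set_progression[OF F(3,1,2) \<delta>] unfolding d_def \<delta>_def by metis
  \<comment> \<open>A relation rather than a function: \<open>x\<close> matters only modulo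
    \<open>N\<close>, and uniqueness of \<open>y\<close> is the special case of \<open>add\<close>
    with the pair 0, 0.\<close>
  define R where "R = (\<lambda>x y. \<exists>a\<in>A'. \<exists>b\<in>A'. \<exists>c\<in>A'. \<exists>e\<in>A'.
      int N dvd f a + f b - f c - f e - x \<and> y = a + b - c - e)"
  have dom: "\<exists>y. R x y" if "x \<in> gap d v M" for x
  proof -
    obtain a b c e where abce: "a \<in> A'" "b \<in> A'" "c \<in> A'" "e \<in> A'"
      and dv: "int N dvd f a mod int N + f b mod int N - f c mod int N - f e mod int N - x"
      using vM(1)[OF \<open>x \<in> gap d v M\<close>] by (auto simp: F_def)
    have md: "int N dvd f z - f z mod int N" for z by (rule dvd_minus_mod)
    have "int N dvd (f a mod int N + f b mod int N - f c mod int N - f e mod int N - x)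
        + (f a - f a mod int N) + (f b - f b mod int N) - (f c - f c mod int N) - (f e - f e mod int N)"
      by (rule dvd_diff[OF dvd_diff[OF dvd_add[OF dvd_add[OF dv md] md] md] md])
    then have "int N dvd f a + f b - f c - f e - x" by (simp add: algebra_simps)
    then show ?thesis using abce unfolding R_def by blast
  qed
  have zero: "R 0 0" unfolding R_def by (intro bexI[of _ o'] conjI) (use o' in simp_all)
  have neg: "R (- x) (- y)" if Rxy: "R x y" for x y
  proof -
    obtain a b c e where abce: "a \<in> A'" "b \<in> A'" "c \<in> A'" "e \<in> A'"
      "int N dvd f a + f b - f c - f e - x" "y = a + b - c - e"
      using Rxy unfolding R_def by blast
    have "int N dvd - (f a + f b - f c - f e - x)" using abce(5) by (simp only: dvd_minus_iff)
    also have "- (f a + f b - f c - f e - x) = f c + f e - f a - f b - (- x)" by simp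
    finally show ?thesis unfolding R_def using abce(1-4,6) by (intro bexI[of _ c] bexI[of _ e] bexI[of _ a] bexI[of _ b]) auto
  qed
  have add: "y'' = y + y'" if R: "R x y" "R x' y'" "R (x + x') y''" for x y x' y' y''
  proof -
    obtain a b c e where 1: "a \<in> A'" "b \<in> A'" "c \<in> A'" "e \<in> A'"
      "int N dvd f a + f b - f c - f e - x" "y = a + b - c - e"
      using R(1) unfolding R_def by blast
    obtain a' b' c' e' where 2: "a' \<in> A'" "b' \<in> A'" "c' \<in> A'" "e' \<in> A'"
      "int N dvd f a' + f b' - f c' - f e' - x'" "y' = a' + b' - c' - e'"
      using R(2) unfolding R_def by blast
    obtain a'' b'' c'' e'' where 3: "a'' \<in> A'" "b'' \<in> A'" "c'' \<in> A'" "e'' \<in> A'"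
      "int N dvd f a'' + f b'' - f c'' - f e'' - (x + x')" "y'' = a'' + b'' - c'' - e''"
      using R(3) unfolding R_def by blast
    have "int N dvd (f a + f b - f c - f e - x) + (f a' + f b' - f c' - f e' - x')
        - (f a'' + f b'' - f c'' - f e'' - (x + x'))"
      by (rule dvd_diff[OF dvd_add[OF 1(5) 2(5)] 3(5)])
    also have "\<dots> = f a + f b + f a' + f b' + f c'' + f e'' - (f c + f e + f c' + f e' + f a'' + f b'')"
      by simp
    finally have "a + b + a' + b' + c'' + e'' = c + e + c' + e' + a'' + b''"
      using model_list[of a b a' b' c'' e'' c e c' e' a'' b''] 1(1-4) 2(1-4) 3(1-4) by simp
    then show ?thesis using 1(6) 2(6) 3(6) by linarith
  qed
  have "\<exists>w. \<forall>n. (\<forall>i<d. \<bar>n i\<bar> \<le> int (M i)) \<longrightarrow> R (\<Sum>i<d. n i * v i) (\<Sum>i<d. n i * w i)"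
    by (rule transported_gap[OF dom zero neg add])
  then obtain w where w: "\<And>n. \<forall>i<d. \<bar>n i\<bar> \<le> int (M i) \<Longrightarrow> R (\<Sum>i<d. n i * v i) (\<Sum>i<d. n i * w i)"
    by blast
  have R4: "y \<in> sumset A 4" if Rxy: "R x y" for x y
  proof -
    obtain a b c e where "a \<in> A" "b \<in> A" "c \<in> A" "e \<in> A" "y = a + b - c - e"
      using Rxy A'(1) unfolding R_def by blast
    then have "a + (b + (- c + - e)) \<in> sumset A (1 + (1 + (1 + 1)))" using A(3)
      by (intro sumset_addI in_sumset_1)
    moreover have "(1 + (1 + (1 + 1)) :: nat) = 4" "a + (b + (- c + - e)) = y"
      using \<open>y = a + b - c - e\<close> by simp_all
    ultimately show ?thesis by (simp only:)
  qed
  have "card ((\<lambda>x. x mod int N) ` gap d v M) \<le> card (gap d w M)"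
  proof -
    \<comment> \<open>One coefficient vector is fixed per residue. The resulting map into
      \<open>gap d w M\<close> is injective because the model works in both directions: equal values
      \<open>y\<close> force congruent \<open>x\<close>.\<close>
    define h where "h = (\<lambda>z. SOME n. (\<forall>i<d. \<bar>n i\<bar> \<le> int (M i)) \<and> (\<Sum>i<d. n i * v i) mod int N = z)"
    have h: "(\<forall>i<d. \<bar>h z i\<bar> \<le> int (M i)) \<and> (\<Sum>i<d. h z i * v i) mod int N = z"
      if "z \<in> (\<lambda>x. x mod int N) ` gap d v M" for z
    proof -
      have "\<exists>n. (\<forall>i<d. \<bar>n i\<bar> \<le> int (M i)) \<and> (\<Sum>i<d. n i * v i) mod int N = z"
        using that by (auto simp: gap_def)
      from someI_ex[OF this] show ?thesis unfolding h_def .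
    qed
    show ?thesis
    proof (rule card_inj_on_le[of "\<lambda>z. \<Sum>i<d. h z i * w i"])
      show "(\<lambda>z. \<Sum>i<d. h z i * w i) ` (\<lambda>x. x mod int N) ` gap d v M \<subseteq> gap d w M"
      proof (rule image_subsetI)
        fix z assume z: "z \<in> (\<lambda>x. x mod int N) ` gap d v M"
        show "(\<Sum>i<d. h z i * w i) \<in> gap d w M" by (rule gapI) (use h[OF z] in blast)
      qed
      show "inj_on (\<lambda>z. \<Sum>i<d. h z i * w i) ((\<lambda>x. x mod int N) ` gap d v M)"
      proof (rule inj_onI)
        fix z z' assume z: "z \<in> (\<lambda>x. x mod int N) ` gap d v M" "z' \<in> (\<lambda>x. x mod int N) ` gap d v M"
          and eq: "(\<Sum>i<d. h z i * w i) = (\<Sum>i<d. h z' i * w i)"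
        define x where "x = (\<Sum>i<d. h z i * v i)"
        define x' where "x' = (\<Sum>i<d. h z' i * v i)"
        define y where "y = (\<Sum>i<d. h z i * w i)"
        have "R x y" unfolding x_def y_def by (rule w) (use h[OF z(1)] in blast)
        moreover have "R x' y" unfolding x'_def y_def eq by (rule w) (use h[OF z(2)] in blast)
        ultimately have Rx: "R x y" "R x' y" .
        obtain a b c e where 1: "a \<in> A'" "b \<in> A'" "c \<in> A'" "e \<in> A'"
          "int N dvd f a + f b - f c - f e - x" "y = a + b - c - e"
          using Rx(1) unfolding R_def by blast
        obtain a' b' c' e' where 2: "a' \<in> A'" "b' \<in> A'" "c' \<in> A'" "e' \<in> A'"
          "int N dvd f a' + f b' - f c' - f e' - x'" "y = a' + b' - c' - e'"
          using Rx(2) unfolding R_def by blast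
        have "a + b + c' + e' + o' + o' = c + e + a' + b' + o' + o'" using 1(6) 2(6) by linarith
        then have "int N dvd f a + f b + f c' + f e' + f o' + f o' - (f c + f e + f a' + f b' + f o' + f o')"
          using model_list[of a b c' e' o' o' c e a' b' o' o'] 1(1-4) 2(1-4) o' by simp
        then have "int N dvd f a + f b + f c' + f e' + f o' + f o' - (f c + f e + f a' + f b' + f o' + f o')
            - (f a + f b - f c - f e - x) + (f a' + f b' - f c' - f e' - x')"
          by (rule dvd_add[OF dvd_diff[OF _ 1(5)] 2(5)])
        also have "\<dots> = x - x'" by simp
        finally have "x mod int N = x' mod int N" by (simp add: mod_eq_dvd_iff)
        then show "z = z'" using h[OF z(1)] h[OF z(2)] by (simp add: x_def x'_def)
      qed
    qed (rule finite_gap)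
  qed
  then have "freiman_loss \<delta> * card ((\<lambda>x. x mod int N) ` gap d v M) \<le> freiman_loss \<delta> * card (gap d w M)"
    by simp
  moreover have "card A \<le> N" using card_mono[OF C A_C] by (simp add: N_def)
  ultimately have "card A \<le> freiman_loss \<delta> * card (gap d w M)" using vM(2) by linarith
  moreover have "gap d w M \<subseteq> sumset A 4"
  proof
    fix y assume "y \<in> gap d w M"
    then obtain n where "y = (\<Sum>i<d. n i * w i)" "\<And>i. i < d \<Longrightarrow> \<bar>n i\<bar> \<le> int (M i)" by (rule gapE) blast
    then show "y \<in> sumset A 4" using w R4 by blast
  qed
  ultimately show ?thesis using that by (simp add: \<delta>_def)
qed

text \<open>Ruzsa covering places \<open>A\<close> in Y + P - P. The differences lie in the box with
  doubled bounds, and halving coefficients, rounded down and up, writes each element of that box as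
  a sum of two elements of \<open>P\<close>; hence 8 = 4 + 4.\<close>

lemma freiman_int_covering:
  fixes L :: real and A :: "int set"
  defines "d \<equiv> freiman_rank (freiman_density L)"
  assumes A: "finite A" "0 \<in> A" "\<And>a. a \<in> A \<Longrightarrow> - a \<in> A"
    and L: "L \<ge> 1" "real (card (sumset A 12)) \<le> L * real (card A)"
  obtains w M Y where "gap d w M \<subseteq> sumset A 8" "Y \<subseteq> A"
    "real (card Y) \<le> L * real (freiman_loss (freiman_density L))"
    "\<And>a. a \<in> A \<Longrightarrow> \<exists>y\<in>Y. a - y \<in> gap d w M"
proof -
  interpret Z: group integer_group by (rule group_integer_group)
  obtain w M where wM: "gap d w M \<subseteq> sumset A 4"
    "card A \<le> freiman_loss (freiman_density L) * card (gap d w M)"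
    using freiman_int[OF A L] unfolding d_def by metis
  let ?P = "gap d w M"
  have P: "finite ?P" "?P \<noteq> {}" using finite_gap gapI[of d "\<lambda>_. 0" M w] by auto
  have "A <#>\<^bsub>integer_group\<^esub> ?P \<subseteq> sumset A 5"
  proof
    fix z assume "z \<in> A <#>\<^bsub>integer_group\<^esub> ?P"
    then obtain x y where "x \<in> A" "y \<in> ?P" "z = x + y" by (auto simp: set_mult_def)
    then show "z \<in> sumset A 5" using sumset_addI[OF in_sumset_1, of x A y 4] wM(1) by auto
  qed
  also have "\<dots> \<subseteq> sumset A 12" using A by (intro Z.set_pow_mono) auto
  finally have "card (A <#>\<^bsub>integer_group\<^esub> ?P) \<le> card (sumset A 12)"
    by (intro card_mono finite_sumset A)
  then have "real (card (A <#>\<^bsub>integer_group\<^esub> ?P)) \<le> L * real (card A)" using L(2) by linarith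
  also have "\<dots> \<le> L * real (freiman_loss (freiman_density L) * card ?P)"
    using wM(2) L(1) by (intro mult_left_mono of_nat_mono) auto
  finally have "real (card (A <#>\<^bsub>integer_group\<^esub> ?P)) \<le> L * real (freiman_loss (freiman_density L)) * real (card ?P)"
    by simp
  then obtain Y where Y: "Y \<subseteq> A" "real (card Y) \<le> L * real (freiman_loss (freiman_density L))"
    "A \<subseteq> Y <#>\<^bsub>integer_group\<^esub> (?P <#>\<^bsub>integer_group\<^esub> m_inv integer_group ` ?P)"
    using Z.ruzsa_covering[OF A(1) _ P] by auto
  have diff: "p - p' \<in> gap d w (\<lambda>i. 2 * M i)" if p: "p \<in> ?P" "p' \<in> ?P" for p p'
  proof -
    obtain n where n: "p = (\<Sum>i<d. n i * w i)" "\<And>i. i < d \<Longrightarrow> \<bar>n i\<bar> \<le> int (M i)" using p(1) by (rule gapE) blast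
    obtain n' where n': "p' = (\<Sum>i<d. n' i * w i)" "\<And>i. i < d \<Longrightarrow> \<bar>n' i\<bar> \<le> int (M i)" using p(2) by (rule gapE) blast
    have "p - p' = (\<Sum>i<d. (n i - n' i) * w i)" by (simp add: n n' sum_subtractf left_diff_distrib)
    moreover have "\<bar>n i - n' i\<bar> \<le> int (2 * M i)" if "i < d" for i using n(2)[OF that] n'(2)[OF that] by simp
    ultimately show ?thesis using gapI[of d "\<lambda>i. n i - n' i" "\<lambda>i. 2 * M i" w] by simp
  qed
  have halves: "gap d w (\<lambda>i. 2 * M i) \<subseteq> sumset A 8"
  proof
    fix x assume "x \<in> gap d w (\<lambda>i. 2 * M i)"
    then obtain n where n: "x = (\<Sum>i<d. n i * w i)" "\<And>i. i < d \<Longrightarrow> \<bar>n i\<bar> \<le> int (2 * M i)" by (rule gapE) blast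
    have "(\<Sum>i<d. (n i div 2) * w i) + (\<Sum>i<d. (n i - n i div 2) * w i) = x"
      by (simp add: n(1) left_diff_distrib sum_subtractf)
    moreover have "(\<Sum>i<d. (n i div 2) * w i) \<in> ?P"
      using n(2) by (intro gapI) fastforce
    moreover have "(\<Sum>i<d. (n i - n i div 2) * w i) \<in> ?P"
      using n(2) by (intro gapI) fastforce
    ultimately show "x \<in> sumset A 8"
      using sumset_addI[of "\<Sum>i<d. (n i div 2) * w i" A 4 "\<Sum>i<d. (n i - n i div 2) * w i" 4] wM(1) by auto
  qed
  show ?thesis
  proof (rule that[OF halves Y(1,2)])
    fix a assume "a \<in> A"
    then obtain y p p' where "y \<in> Y" "p \<in> ?P" "p' \<in> ?P" "a = y + (p - p')"
      using Y(3) by (fastforce simp: set_mult_def)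
    then show "\<exists>y\<in>Y. a - y \<in> gap d w (\<lambda>i. 2 * M i)" using diff[of p p'] by (intro bexI[of _ y]) auto
  qed
qed

section \<open>The lamplighter group\<close>

lemma shift_pow_simps:
  "shift_pow 0 x = x" "shift_pow n (x + y) = shift_pow n x + shift_pow n y" "shift_pow n 0 = 0"
  "shift_pow m (shift_pow n x) = shift_pow (m + n) x"
  by (auto simp: shift_pow_apply fun_eq_iff algebra_simps)

lemma seq_subspaceI:
  assumes "0 \<in> V" "\<And>x y. x \<in> V \<Longrightarrow> y \<in> V \<Longrightarrow> x + y \<in> V"
  shows "seq.subspace V"
proof (rule seq.subspaceI)
  fix c x assume "x \<in> V"
  then show "seq_scale c x \<in> V"
    using assms(1) by (cases c) simp_all
qed (use assms in auto)

lemma card_sums_le: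
  assumes "finite V" "finite W"
  shows "finite {v + w | v w. v \<in> V \<and> w \<in> W}" "card {v + w | v w. v \<in> V \<and> w \<in> W} \<le> card V * card W"
proof -
  have eq: "{v + w | v w. v \<in> V \<and> w \<in> W} = (\<lambda>(v, w). v + w) ` (V \<times> W)" by auto
  show "finite {v + w | v w. v \<in> V \<and> w \<in> W}" unfolding eq using assms by simp
  show "card {v + w | v w. v \<in> V \<and> w \<in> W} \<le> card V * card W"
    unfolding eq using card_image_le[of "V \<times> W"] assms by (simp add: card_cartesian_product)
qed

lemma card_span_le:
  assumes "finite Y"
  shows "finite (seq.span Y) \<and> card (seq.span Y) \<le> 2 ^ card Y"
  using assms
proof (induction Y rule: finite_induct)
  case (insert a Y)
  have "seq.span (insert a Y) \<subseteq> seq.span Y \<union> (\<lambda>x. a + x) ` seq.span Y"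
  proof
    fix x assume "x \<in> seq.span (insert a Y)"
    then obtain k where k: "x - seq_scale k a \<in> seq.span Y" by (auto simp: seq.span_breakdown_eq)
    show "x \<in> seq.span Y \<union> (\<lambda>x. a + x) ` seq.span Y"
    proof (cases k)
      case zero
      then show ?thesis using k by simp
    next
      case one
      then have "x - a \<in> seq.span Y" using k by simp
      then show ?thesis by (auto intro!: image_eqI[of _ _ "x - a"])
    qed
  qed
  note sub = this
  have fin: "finite (seq.span Y \<union> (\<lambda>x. a + x) ` seq.span Y)" using insert.IH by simp
  have "card (seq.span Y \<union> (\<lambda>x. a + x) ` seq.span Y) \<le> card (seq.span Y) + card (seq.span Y)"
    using card_Un_le card_image_le insert.IH by (meson add_left_mono order_trans)
  then have "card (seq.span (insert a Y)) \<le> 2 * card (seq.span Y)"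
    using card_mono[OF fin sub] by linarith
  also have "\<dots> \<le> 2 ^ card (insert a Y)" using insert by simp
  finally show ?case using finite_subset[OF sub fin] by blast
qed simp

text \<open>A proper extension contains a further coset of \<open>V\<close>, disjoint from
  \<open>V\<close>.\<close>

lemma card_strict_subspace:
  assumes "seq.subspace V" "seq.subspace W" "V \<subset> W" "finite W"
  shows "2 * card V \<le> card W"
proof -
  obtain a where a: "a \<in> W" "a \<notin> V" using assms(3) by auto
  have fV: "finite V" using assms by (auto intro: finite_subset)
  have "V \<inter> (\<lambda>x. a + x) ` V = {}"
  proof (rule ccontr)
    assume "\<not> ?thesis"
    then obtain x y where "x \<in> V" "y \<in> V" "x = a + y" by auto
    then have "a = x - y" by simp
    then show False using a(2) \<open>x \<in> V\<close> \<open>y \<in> V\<close> assms(1) seq.subspace_diff by blast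
  qed
  then have "card V + card V = card (V \<union> (\<lambda>x. a + x) ` V)"
    using fV by (subst card_Un_disjoint) (auto simp: card_image)
  also have "\<dots> \<le> card W"
    using assms a by (intro card_mono) (auto intro: seq.subspace_add)
  finally show ?thesis by simp
qed

lemma shift_pow_span: "shift_pow n ` seq.span X \<subseteq> seq.span (shift_pow n ` X)"
proof clarify
  fix x assume "x \<in> seq.span X"
  moreover have "seq.span X \<subseteq> {x. shift_pow n x \<in> seq.span (shift_pow n ` X)}"
    by (intro seq.span_minimal seq_subspaceI)
      (auto simp: shift_pow_simps intro: seq.span_base seq.span_zero seq.span_add)
  ultimately show "shift_pow n x \<in> seq.span (shift_pow n ` X)" by blast
qed

lemma inj_shift_pow: "inj (shift_pow n)"
  by (rule inj_on_inverseI[of _ "shift_pow (- n)"]) (simp add: shift_pow_simps)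

lemma subspace_fin_supp: "seq.subspace fin_supp_seqs"
proof (rule seq_subspaceI)
  fix x y assume "x \<in> fin_supp_seqs" "y \<in> fin_supp_seqs"
  moreover have "{i. (x + y) i \<noteq> 0} \<subseteq> {i. x i \<noteq> 0} \<union> {i. y i \<noteq> 0}" by auto
  ultimately show "x + y \<in> fin_supp_seqs"
    unfolding fin_supp_seqs_def mem_Collect_eq by (meson finite_UnI finite_subset)
qed (simp add: fin_supp_seqs_def)

text \<open>The shifts of \<open>x\<close> by multiples of \<open>d\<close> all lie in the finite
  set \<open>W\<close>, so two of them coincide and \<open>x\<close> is periodic, which is
  impossible for a nonzero sequence of finite support.\<close>

lemma finite_invariant_fin_supp:
  assumes "finite W" "shift_pow d ` W \<subseteq> W" "d \<ge> 1" "W \<subseteq> fin_supp_seqs"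
  shows "W \<subseteq> {0}"
proof (rule subsetI, rule ccontr)
  fix x assume x: "x \<in> W" "x \<notin> {0}"
  then obtain i where i: "x i \<noteq> 0" by (auto simp: fun_eq_iff)
  have mem: "shift_pow (int k * d) x \<in> W" for k
  proof (induction k)
    case (Suc k)
    have "shift_pow (int (Suc k) * d) x = shift_pow d (shift_pow (int k * d) x)"
      by (simp add: shift_pow_simps algebra_simps)
    then show ?case using Suc assms(2) by auto
  qed (use x in \<open>simp add: shift_pow_simps\<close>)
  have "\<not> inj_on (\<lambda>k. shift_pow (int k * d) x) UNIV"
    using mem assms(1) by (metis finite_imageD finite_subset image_subsetI infinite_UNIV_nat)
  then obtain k l where kl: "k \<noteq> l" "shift_pow (int k * d) x = shift_pow (int l * d) x"
    by (auto simp: inj_on_def)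
  define t where "t = (int l - int k) * d"
  have t: "t \<noteq> 0" using kl(1) assms(3) by (simp add: t_def)
  have per: "x (j + t) = x j" for j
    using fun_cong[OF kl(2), of "j + int l * d"] by (simp add: shift_pow_apply t_def algebra_simps)
  have "x (i + int n * t) = x i" for n
  proof (induction n)
    case (Suc n)
    then show ?case using per[of "i + int n * t"] by (simp add: algebra_simps)
  qed simp
  then have "range (\<lambda>n. i + int n * t) \<subseteq> {j. x j \<noteq> 0}" using i by auto
  moreover have "finite {j. x j \<noteq> 0}" using x assms(4) by (auto simp: fin_supp_seqs_def)
  moreover have "inj (\<lambda>n. i + int n * t)" using t by (auto simp: inj_on_def)
  ultimately show False by (meson finite_imageD finite_subset infinite_UNIV_nat)
qed

section \<open>The group law, the projection to the integers, and the elements over 0\<close>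

declare set_pow.simps(2) [simp del]

interpretation lamp: group ext_lamplighter by (rule group_ext_lamplighter)

lemma carrier_ext_lamplighter [simp]: "carrier ext_lamplighter = UNIV"
  by (simp add: ext_lamplighter_def)

lemma mult_ext_lamplighter [simp]:
  "(n, x) \<otimes>\<^bsub>ext_lamplighter\<^esub> (m, y) = (n + m, shift_pow m x + y)"
  by (simp add: ext_lamplighter_def)

lemma one_ext_lamplighter [simp]: "\<one>\<^bsub>ext_lamplighter\<^esub> = (0, 0)"
  by (simp add: ext_lamplighter_def)

lemma fst_mult: "fst (g \<otimes>\<^bsub>ext_lamplighter\<^esub> h) = fst g + fst h"
  by (cases g; cases h) simp

lemma fst_inv: "fst (inv\<^bsub>ext_lamplighter\<^esub> g) = - fst g"
  using fst_mult[of "inv\<^bsub>ext_lamplighter\<^esub> g" g] by (simp add: eq_neg_iff_add_eq_0)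

lemma mult_fiber: "(n, x) \<otimes>\<^bsub>ext_lamplighter\<^esub> (0, y) = (n, x + y)"
  by (simp add: shift_pow_simps)

lemma inv_mult_same_fst:
  "inv\<^bsub>ext_lamplighter\<^esub> (n, y) \<otimes>\<^bsub>ext_lamplighter\<^esub> (n, x) = (0, x - y)"
proof -
  have "(n, x) = (n, y) \<otimes>\<^bsub>ext_lamplighter\<^esub> (0, x - y)" by (simp add: shift_pow_simps)
  then show ?thesis by (metis UNIV_I carrier_ext_lamplighter lamp.inv_solve_left)
qed

text \<open>Sequences commute, so the conjugate depends only on the integer part of the conjugating
  element; this is how shifts arise from the group law.\<close>

lemma conj_fiber:
  "inv\<^bsub>ext_lamplighter\<^esub> (n, y) \<otimes>\<^bsub>ext_lamplighter\<^esub> ((0, x) \<otimes>\<^bsub>ext_lamplighter\<^esub> (n, y))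
    = (0, shift_pow n x)"
  by (simp add: inv_mult_same_fst)

definition fiber :: "(int \<times> seq) set \<Rightarrow> nat \<Rightarrow> seq set" where
  "fiber S m = {x. (0, x) \<in> set_pow ext_lamplighter S m}"

lemma fst_set_pow: "fst ` set_pow ext_lamplighter S k = sumset (fst ` S) k"
proof (induction k)
  case (Suc k)
  have "fst ` (S <#>\<^bsub>ext_lamplighter\<^esub> set_pow ext_lamplighter S k)
      = fst ` S <#>\<^bsub>integer_group\<^esub> fst ` set_pow ext_lamplighter S k"
    by (force simp: set_mult_def fst_mult image_iff)
  then show ?case using Suc by (simp add: set_pow.simps)
qed simp

text \<open>The properties provided by \<open>lamp.approximate_group_covering\<close>. All constants
  defined below depend on \<open>c\<close> alone, which makes them uniform in the set.\<close>

locale approx_group_lamp =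
  fixes S :: "(int \<times> seq) set" and c :: real
  assumes fin: "finite S" and one: "(0, 0) \<in> S"
    and inv: "\<And>s. s \<in> S \<Longrightarrow> inv\<^bsub>ext_lamplighter\<^esub> s \<in> S"
    and c: "c \<ge> 1" and pow: "\<And>m. real (card (set_pow ext_lamplighter S m)) \<le> c ^ m * real (card S)"
begin

abbreviation Spow :: "nat \<Rightarrow> (int \<times> seq) set" where
  "Spow \<equiv> set_pow ext_lamplighter S"

lemma Spow_mult: "g \<in> Spow a \<Longrightarrow> h \<in> Spow b \<Longrightarrow> g \<otimes>\<^bsub>ext_lamplighter\<^esub> h \<in> Spow (a + b)"
  by (rule lamp.set_pow_multI) simp_all

lemma Spow_inv: "g \<in> Spow a \<Longrightarrow> inv\<^bsub>ext_lamplighter\<^esub> g \<in> Spow a"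
  by (rule lamp.set_pow_inv) (simp_all add: inv)

lemma Spow_mono: "a \<le> b \<Longrightarrow> Spow a \<subseteq> Spow b"
  by (rule lamp.set_pow_mono) (simp_all add: one)

lemma finite_Spow: "finite (Spow k)"
  by (rule lamp.finite_set_pow[OF fin])

lemma Spow_1: "Spow (Suc 0) = S"
  by (rule lamp.set_pow_1) simp

lemma fiber_mono: "a \<le> b \<Longrightarrow> fiber S a \<subseteq> fiber S b"
  using Spow_mono by (auto simp: fiber_def)

lemma fiber_add: "x \<in> fiber S a \<Longrightarrow> y \<in> fiber S b \<Longrightarrow> x + y \<in> fiber S (a + b)"
  using Spow_mult[of "(0, x)" a "(0, y)" b] by (simp add: fiber_def shift_pow_simps)

lemma zero_in_fiber: "0 \<in> fiber S m"
  using lamp.one_in_set_pow[of S m] one by (simp add: fiber_def)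

lemma finite_fiber: "finite (fiber S m)"
proof -
  have "fiber S m \<subseteq> snd ` Spow m" by (force simp: fiber_def)
  then show ?thesis using finite_Spow by (meson finite_imageI finite_subset)
qed

lemma fiber_diff:
  assumes "(n, x) \<in> Spow a" "(n, y) \<in> Spow b"
  shows "x - y \<in> fiber S (b + a)"
  using Spow_mult[OF Spow_inv[OF assms(2)] assms(1)] by (simp add: inv_mult_same_fst fiber_def)

text \<open>Conjugation by a lift of \<open>n\<close> in the \<open>k\<close>-th power realises the
  shift and adds \<open>k\<close> factors on each side.\<close>

lemma shift_fiber:
  assumes "n \<in> fst ` Spow k"
  shows "shift_pow n ` fiber S m \<subseteq> fiber S (m + 2 * k)"
proof clarify
  fix x assume x: "x \<in> fiber S m"
  obtain y where y: "(n, y) \<in> Spow k" using assms by auto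
  have "inv\<^bsub>ext_lamplighter\<^esub> (n, y) \<otimes>\<^bsub>ext_lamplighter\<^esub> ((0, x) \<otimes>\<^bsub>ext_lamplighter\<^esub> (n, y)) \<in> Spow (k + (m + k))"
    using x y by (intro Spow_mult Spow_inv) (simp_all add: fiber_def)
  moreover have "k + (m + k) = m + 2 * k" by simp
  ultimately show "shift_pow n x \<in> fiber S (m + 2 * k)"
    unfolding conj_fiber by (simp only: fiber_def mem_Collect_eq)
qed

text \<open>Ruzsa covering by translates of \<open>S\<close> leaves a remainder in S S^-1. The
  covered element and the translating one both lie over 0, hence so does the remainder, which is
  therefore in \<open>fiber S 2\<close>.\<close>

lemma fiber_covering:
  obtains Y where "finite Y" "real (card Y) \<le> c ^ (m + 1)" "\<And>x. x \<in> fiber S m \<Longrightarrow> \<exists>y\<in>Y. \<exists>u\<in>fiber S 2. x = y + u"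
proof -
  define E where "E = Pair (0::int) ` fiber S m"
  have E: "finite E" using finite_fiber by (simp add: E_def)
  have ES: "E \<subseteq> Spow m" by (auto simp: E_def fiber_def)
  have "E <#>\<^bsub>ext_lamplighter\<^esub> S \<subseteq> Spow (m + 1)"
  proof
    fix z assume "z \<in> E <#>\<^bsub>ext_lamplighter\<^esub> S"
    then obtain x y where "x \<in> E" "y \<in> S" "z = x \<otimes>\<^bsub>ext_lamplighter\<^esub> y" by (rule lamp.set_multE)
    then show "z \<in> Spow (m + 1)" using Spow_mult[of x m y "Suc 0"] ES by (auto simp: Spow_1)
  qed
  then have "real (card (E <#>\<^bsub>ext_lamplighter\<^esub> S)) \<le> c ^ (m + 1) * real (card S)"
    using pow[of "m + 1"] card_mono[OF finite_Spow] by (meson of_nat_mono order_trans)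
  then obtain Y where Y: "Y \<subseteq> E" "real (card Y) \<le> c ^ (m + 1)"
    "E \<subseteq> Y <#>\<^bsub>ext_lamplighter\<^esub> (S <#>\<^bsub>ext_lamplighter\<^esub> m_inv ext_lamplighter ` S)"
    using lamp.ruzsa_covering[OF E _ fin] one by (metis carrier_ext_lamplighter empty_iff top_greatest)
  have fY: "finite Y" using Y E by (auto intro: finite_subset)
  show ?thesis
  proof (rule that[of "snd ` Y"])
    show "finite (snd ` Y)" using fY by simp
    show "real (card (snd ` Y)) \<le> c ^ (m + 1)" using card_image_le[OF fY, of snd] Y(2) by linarith
    fix x assume "x \<in> fiber S m"
    then have "(0, x) \<in> Y <#>\<^bsub>ext_lamplighter\<^esub> (S <#>\<^bsub>ext_lamplighter\<^esub> m_inv ext_lamplighter ` S)"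
      using Y(3) by (auto simp: E_def)
    then obtain g s t where g: "g \<in> Y" "s \<in> S" "t \<in> S"
      "(0, x) = g \<otimes>\<^bsub>ext_lamplighter\<^esub> (s \<otimes>\<^bsub>ext_lamplighter\<^esub> inv\<^bsub>ext_lamplighter\<^esub> t)"
      by (auto simp: set_mult_def)
    obtain y where y: "g = (0, y)" using g(1) Y(1) by (auto simp: E_def)
    obtain n u where nu: "s \<otimes>\<^bsub>ext_lamplighter\<^esub> inv\<^bsub>ext_lamplighter\<^esub> t = (n, u)" by fastforce
    have "s \<otimes>\<^bsub>ext_lamplighter\<^esub> inv\<^bsub>ext_lamplighter\<^esub> t \<in> Spow (1 + 1)"
      using g inv by (intro Spow_mult) (auto simp: Spow_1)
    moreover have "n = 0" "x = y + u" using g(4) unfolding y nu by (auto simp: shift_pow_simps)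
    ultimately have "u \<in> fiber S 2" unfolding nu by (simp add: fiber_def numeral_2_eq_2)
    then show "\<exists>y\<in>snd ` Y. \<exists>u\<in>fiber S 2. x = y + u" using \<open>x = y + u\<close> g(1) y by force
  qed
qed

text \<open>The first factor bounds the span of the translates that cover \<open>fiber S m\<close>,
  the second that of the translates that cover \<open>fiber S 4\<close>, with 5 = 4 + 1.\<close>

definition fiber_const :: "nat \<Rightarrow> nat" where
  "fiber_const m = 2 ^ nat \<lfloor>c ^ (m + 1)\<rfloor> * 2 ^ nat \<lfloor>c ^ 5\<rfloor>"

text \<open>Sums of two elements of \<open>fiber S 2\<close> lie in \<open>fiber S 4\<close>, which
  few translates \<open>Y\<close> of \<open>fiber S 2\<close> cover. So the span of \<open>Y\<close>
  plus \<open>fiber S 2\<close> is already closed under addition, and over two scalars the span of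
  \<open>Y\<close> has at most 2^|Y| elements.\<close>

lemma card_span_fiber_2: "finite (seq.span (fiber S 2))"
  "card (seq.span (fiber S 2)) \<le> 2 ^ nat \<lfloor>c ^ 5\<rfloor> * card (fiber S 2)"
proof -
  obtain Y where Y: "finite Y" "real (card Y) \<le> c ^ (4 + 1)" "\<And>x. x \<in> fiber S 4 \<Longrightarrow> \<exists>y\<in>Y. \<exists>u\<in>fiber S 2. x = y + u"
    using fiber_covering[of 4] by metis
  define Z where "Z = {y + u | y u. y \<in> seq.span Y \<and> u \<in> fiber S 2}"
  have "seq.subspace Z"
  proof (rule seq_subspaceI)
    have "0 + 0 \<in> Z" unfolding Z_def using zero_in_fiber seq.span_zero by blast
    then show "0 \<in> Z" by simp
    fix a b assume "a \<in> Z" "b \<in> Z"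
    then obtain y u y' u' where ab: "y \<in> seq.span Y" "u \<in> fiber S 2" "a = y + u"
      "y' \<in> seq.span Y" "u' \<in> fiber S 2" "b = y' + u'" by (auto simp: Z_def)
    have "u + u' \<in> fiber S 4" using fiber_add[OF ab(2,5)] by simp
    then obtain y'' u'' where "y'' \<in> Y" "u'' \<in> fiber S 2" "u + u' = y'' + u''" using Y(3) by blast
    then have "a + b = (y + y' + y'') + u''" by (simp add: ab algebra_simps)
    moreover have "y + y' + y'' \<in> seq.span Y"
      using ab(1,4) seq.span_base[OF \<open>y'' \<in> Y\<close>] by (intro seq.span_add)
    ultimately show "a + b \<in> Z" unfolding Z_def using \<open>u'' \<in> fiber S 2\<close> by blast
  qed
  moreover have "fiber S 2 \<subseteq> Z"
  proof
    fix u assume "u \<in> fiber S 2"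
    then have "0 + u \<in> Z" unfolding Z_def using seq.span_zero by blast
    then show "u \<in> Z" by simp
  qed
  ultimately have sub: "seq.span (fiber S 2) \<subseteq> Z" by (rule seq.span_minimal[rotated])
  note sp = card_span_le[OF Y(1)]
  have Z: "finite Z" "card Z \<le> card (seq.span Y) * card (fiber S 2)"
    unfolding Z_def using card_sums_le[of "seq.span Y" "fiber S 2"] sp finite_fiber by auto
  show "finite (seq.span (fiber S 2))" using sub Z by (auto intro: finite_subset)
  have "card Y \<le> nat \<lfloor>c ^ 5\<rfloor>" using Y(2) by (simp add: le_nat_floor)
  then have "card (seq.span Y) \<le> 2 ^ nat \<lfloor>c ^ 5\<rfloor>" using sp by (meson one_le_numeral order_trans power_increasing)
  then have "card Z \<le> 2 ^ nat \<lfloor>c ^ 5\<rfloor> * card (fiber S 2)" using Z(2) by (meson mult_le_mono1 order_trans)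
  then show "card (seq.span (fiber S 2)) \<le> 2 ^ nat \<lfloor>c ^ 5\<rfloor> * card (fiber S 2)"
    using card_mono[OF Z(1) sub] by linarith
qed

text \<open>As \<open>fiber S m\<close> is covered by few translates of \<open>fiber S 2\<close>,
  its span lies in the span of these translates plus that of \<open>fiber S 2\<close>.\<close>

lemma card_span_fiber: "finite (seq.span (fiber S m))"
  "card (seq.span (fiber S m)) \<le> fiber_const m * card (fiber S 2)"
proof -
  obtain Y where Y: "finite Y" "real (card Y) \<le> c ^ (m + 1)" "\<And>x. x \<in> fiber S m \<Longrightarrow> \<exists>y\<in>Y. \<exists>u\<in>fiber S 2. x = y + u"
    using fiber_covering[of m] by metis
  note sp = card_span_le[OF Y(1)]
  define Z where "Z = {y + u | y u. y \<in> seq.span Y \<and> u \<in> seq.span (fiber S 2)}"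
  have "seq.subspace Z" unfolding Z_def by (rule seq.subspace_sums) (rule seq.subspace_span)+
  moreover have "fiber S m \<subseteq> Z"
  proof
    fix x assume "x \<in> fiber S m"
    then obtain y u where "y \<in> Y" "u \<in> fiber S 2" "x = y + u" using Y(3) by blast
    then show "x \<in> Z" unfolding Z_def using seq.span_base by blast
  qed
  ultimately have sub: "seq.span (fiber S m) \<subseteq> Z" by (rule seq.span_minimal[rotated])
  have Z: "finite Z" "card Z \<le> card (seq.span Y) * card (seq.span (fiber S 2))"
    unfolding Z_def using card_sums_le[of "seq.span Y" "seq.span (fiber S 2)"] sp card_span_fiber_2(1) by auto
  show "finite (seq.span (fiber S m))" using sub Z by (auto intro: finite_subset)
  have "card Y \<le> nat \<lfloor>c ^ (m + 1)\<rfloor>" using Y(2) by (rule le_nat_floor)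
  then have "card (seq.span Y) \<le> 2 ^ nat \<lfloor>c ^ (m + 1)\<rfloor>" using sp by (meson one_le_numeral order_trans power_increasing)
  then have "card Z \<le> 2 ^ nat \<lfloor>c ^ (m + 1)\<rfloor> * (2 ^ nat \<lfloor>c ^ 5\<rfloor> * card (fiber S 2))"
    using Z(2) card_span_fiber_2(2) by (meson mult_le_mono order_trans)
  then show "card (seq.span (fiber S m)) \<le> fiber_const m * card (fiber S 2)"
    using card_mono[OF Z(1) sub] by (simp add: fiber_const_def)
qed

text \<open>The value 0 at \<open>n = 0\<close> makes the final set over the progression {0}
  literally \<open>{0} \<times> W\<close>, as Case 1 demands.\<close>

definition lift :: "nat \<Rightarrow> int \<Rightarrow> seq" where
  "lift k n = (if n = 0 then 0 else (SOME x. (n, x) \<in> Spow k))"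

lemma lift: "n \<in> sumset (fst ` S) k \<Longrightarrow> (n, lift k n) \<in> Spow k"
proof (cases "n = 0")
  case True
  then show ?thesis using zero_in_fiber[of k] by (simp add: lift_def fiber_def)
next
  case False
  assume "n \<in> sumset (fst ` S) k"
  then have "\<exists>x. (n, x) \<in> Spow k" by (auto simp: fst_set_pow[symmetric])
  from someI_ex[OF this] show ?thesis using False unfolding lift_def by simp
qed

text \<open>Above each \<open>n\<close> of the sumset, the lift of \<open>n\<close> plus
  \<open>fiber S 2\<close> is a full copy of that fiber inside the power k + 2.\<close>

lemma card_sumset_fiber: "real (card (sumset (fst ` S) k) * card (fiber S 2)) \<le> c ^ (k + 2) * real (card S)"
proof -
  have "card (sumset (fst ` S) k \<times> fiber S 2) \<le> card (Spow (k + 2))"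
  proof (rule card_inj_on_le[of "\<lambda>(n, u). (n, lift k n + u)"])
    show "(\<lambda>(n, u). (n, lift k n + u)) ` (sumset (fst ` S) k \<times> fiber S 2) \<subseteq> Spow (k + 2)"
    proof clarify
      fix n u assume "n \<in> sumset (fst ` S) k" "u \<in> fiber S 2"
      then show "(n, lift k n + u) \<in> Spow (k + 2)"
        using Spow_mult[OF lift, of n k "(0, u)" 2] by (simp add: mult_fiber fiber_def del: mult_ext_lamplighter)
    qed
  qed (auto simp: inj_on_def finite_Spow)
  then show ?thesis using pow[of "k + 2"] unfolding card_cartesian_product by (meson of_nat_mono order_trans)
qed

text \<open>The converse estimate: elements of \<open>S\<close> over the same integer differ from
  the chosen lift by \<open>fiber S 2\<close>.\<close>

lemma card_S_le: "card S \<le> card (fst ` S) * card (fiber S 2)"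
proof -
  have "S \<subseteq> (\<lambda>(n, u). (n, lift 1 n + u)) ` (fst ` S \<times> fiber S 2)"
  proof clarify
    fix n x assume s: "(n, x) \<in> S"
    then have n: "n \<in> fst ` S" by force
    then have "(n, lift 1 n) \<in> Spow 1" by (intro lift in_sumset_1)
    then have "x - lift 1 n \<in> fiber S (1 + 1)" using s by (intro fiber_diff) (simp_all add: Spow_1)
    then have "x - lift 1 n \<in> fiber S 2" by (simp only: one_add_one)
    then show "(n, x) \<in> (\<lambda>(n, u). (n, lift 1 n + u)) ` (fst ` S \<times> fiber S 2)"
      using n by (intro image_eqI[of _ _ "(n, x - lift 1 n)"]) auto
  qed
  then have "card S \<le> card ((\<lambda>(n, u). (n, lift 1 n + u)) ` (fst ` S \<times> fiber S 2))"
    using fin finite_fiber by (intro card_mono) auto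
  also have "\<dots> \<le> card (fst ` S \<times> fiber S 2)" using fin finite_fiber by (intro card_image_le) auto
  finally show ?thesis by (simp add: card_cartesian_product)
qed

text \<open>Both preceding estimates carry the factor \<open>card (fiber S 2)\<close>; it cancels,
  so controlled growth passes to the projection. 14 = 12 + 2.\<close>

lemma sumset_12: "real (card (sumset (fst ` S) 12)) \<le> c ^ 14 * real (card (fst ` S))"
proof -
  have U: "card (fiber S 2) > 0" using zero_in_fiber finite_fiber by (auto simp: card_gt_0_iff)
  have "real (card (sumset (fst ` S) 12)) * real (card (fiber S 2)) \<le> c ^ 14 * real (card S)"
    using card_sumset_fiber[of 12] by simp
  also have "\<dots> \<le> c ^ 14 * real (card (fst ` S) * card (fiber S 2))"
    using c card_S_le by (intro mult_left_mono of_nat_mono) auto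
  finally have "real (card (sumset (fst ` S) 12)) * real (card (fiber S 2))
      \<le> (c ^ 14 * real (card (fst ` S))) * real (card (fiber S 2))" by simp
  then show ?thesis using U by simp
qed

end

section \<open>Long directions of a progression, chains of subspaces, and shifts preserving a
  subspace\<close>

lemma card_gap_const_le: "card (gap d v (\<lambda>_. J)) \<le> (2 * J + 1) ^ d"
proof -
  let ?B = "PiE {..<d} (\<lambda>_. {- int J..int J})"
  have "gap d v (\<lambda>_. J) \<subseteq> (\<lambda>n. \<Sum>i<d. n i * v i) ` ?B"
  proof
    fix x assume "x \<in> gap d v (\<lambda>_. J)"
    then obtain n where n: "x = (\<Sum>i<d. n i * v i)" "\<And>i. i < d \<Longrightarrow> \<bar>n i\<bar> \<le> int J" by (rule gapE) blast
    have "restrict n {..<d} \<in> ?B" using n(2) by (auto simp: abs_le_iff minus_le_iff)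
    moreover have "x = (\<Sum>i<d. restrict n {..<d} i * v i)" by (simp add: n(1))
    ultimately show "x \<in> (\<lambda>n. \<Sum>i<d. n i * v i) ` ?B" by blast
  qed
  moreover have "finite ?B" by (intro finite_PiE) auto
  ultimately have "card (gap d v (\<lambda>_. J)) \<le> card ?B"
    by (meson card_image_le card_mono finite_imageI order_trans)
  also have "card ?B = (2 * J + 1) ^ d"
  proof -
    have "nat (int J - - int J + 1) = 2 * J + 1" by linarith
    then have "card {- int J..int J} = 2 * J + 1" by (simp only: card_atLeastAtMost_int)
    then show ?thesis by (simp only: card_PiE[OF finite_lessThan] prod_constant card_lessThan)
  qed
  finally show ?thesis .
qed

lemma gap_mono: "(\<And>i. i < d \<Longrightarrow> M i \<le> M' i) \<Longrightarrow> gap d v M \<subseteq> gap d v M'"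
  by (force simp: gap_def)

text \<open>Coefficients of directions shorter than \<open>J\<close> take boundedly many values,
  which produce \<open>Z\<close>; the long directions stay in \<open>v\<close>. Zero generators are
  left out of \<open>I\<close> so that a non-empty \<open>I\<close> later supplies a nonzero
  shift.\<close>

lemma gap_split:
  fixes d J :: nat and M :: "nat \<Rightarrow> nat" and w :: "nat \<Rightarrow> int"
  defines "I \<equiv> {i. i < d \<and> J \<le> M i \<and> w i \<noteq> 0}"
  defines "v \<equiv> \<lambda>i. if i \<in> I then w i else 0"
  obtains Z where "Z \<subseteq> gap d w M" "finite Z" "card Z \<le> (2 * J + 1) ^ d"
    "\<And>x. x \<in> gap d w M \<Longrightarrow> \<exists>z\<in>Z. x - z \<in> gap d v M"
proof -
  define w' where "w' = (\<lambda>i. if i \<in> I then 0 else w i)"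
  define Z where "Z = gap d w' (\<lambda>i. min J (M i))"
  show ?thesis
  proof (rule that[of Z])
    show "Z \<subseteq> gap d w M"
    proof
      fix x assume "x \<in> Z"
      then obtain n where n: "x = (\<Sum>i<d. n i * w' i)" "\<And>i. i < d \<Longrightarrow> \<bar>n i\<bar> \<le> int (min J (M i))"
        unfolding Z_def by (rule gapE) blast
      have "x = (\<Sum>i<d. (if i \<in> I then 0 else n i) * w i)"
        unfolding n(1) w'_def by (intro sum.cong) auto
      also have "\<dots> \<in> gap d w M" using n(2) by (intro gapI) fastforce
      finally show "x \<in> gap d w M" .
    qed
    have sub: "Z \<subseteq> gap d w' (\<lambda>_. J)" unfolding Z_def by (rule gap_mono) simp
    show "finite Z" unfolding Z_def by (rule finite_gap)
    show "card Z \<le> (2 * J + 1) ^ d"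
      using card_mono[OF finite_gap sub] card_gap_const_le[of d w' J] by linarith
    fix x assume "x \<in> gap d w M"
    then obtain n where n: "x = (\<Sum>i<d. n i * w i)" "\<And>i. i < d \<Longrightarrow> \<bar>n i\<bar> \<le> int (M i)" by (rule gapE) blast
    \<comment> \<open>For \<open>w i = 0\<close> the coefficient may exceed \<open>J\<close>; it is
      replaced by 0, which does not change the sum.\<close>
    define z where "z = (\<Sum>i<d. (if i \<in> I \<or> w i = 0 then 0 else n i) * w' i)"
    have "x = (\<Sum>i<d. n i * v i) + z"
      unfolding n(1) z_def sum.distrib[symmetric] by (intro sum.cong) (auto simp: v_def w'_def)
    moreover have "z \<in> Z"
      unfolding z_def Z_def
    proof (rule gapI)
      fix i assume "i < d"
      then show "\<bar>if i \<in> I \<or> w i = 0 then 0 else n i\<bar> \<le> int (min J (M i))"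
        using n(2)[of i] by (auto simp: I_def)
    qed
    moreover have "(\<Sum>i<d. n i * v i) \<in> gap d v M" by (rule gapI[OF n(2)])
    ultimately show "\<exists>z\<in>Z. x - z \<in> gap d v M" by (intro bexI[of _ z]) auto
  qed
qed

text \<open>Every proper inclusion at least doubles the size, so \<kappa> of them in a row would
  give 2^\<kappa> \<le> \<kappa>.\<close>

lemma subspace_chain_stabilises:
  fixes W :: "nat \<Rightarrow> seq set"
  assumes sub: "\<And>j. seq.subspace (W j)" and mono: "\<And>j. W j \<subseteq> W (Suc j)"
    and fin: "finite (W \<kappa>)" and card: "card (W \<kappa>) \<le> \<kappa> * card (W 0)"
  obtains j where "j < \<kappa>" "W (Suc j) = W j"
proof -
  have "\<exists>j<\<kappa>. W (Suc j) = W j"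
  proof (rule ccontr)
    assume no: "\<not> ?thesis"
    have "2 ^ j * card (W 0) \<le> card (W j)" if "j \<le> \<kappa>" for j
      using that
    proof (induction j)
      case (Suc j)
      have "W (Suc j) \<subseteq> W \<kappa>" using lift_Suc_mono_le[of W, OF mono] Suc.prems by blast
      then have f: "finite (W (Suc j))" using fin by (rule finite_subset)
      have "W j \<subset> W (Suc j)" using no Suc.prems mono[of j] by (metis Suc_le_lessD psubsetI)
      then have "2 * card (W j) \<le> card (W (Suc j))" using sub f by (intro card_strict_subspace)
      then show ?case using Suc by simp
    qed simp
    from this[of \<kappa>] have "2 ^ \<kappa> * card (W 0) \<le> \<kappa> * card (W 0)" using card by (meson order_refl order_trans)
    moreover have "W 0 \<subseteq> W \<kappa>" using lift_Suc_mono_le[of W, OF mono] by blast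
    then have "card (W 0) > 0" using fin seq.subspace_0[OF sub, of 0] by (auto simp: card_gt_0_iff intro: finite_subset)
    ultimately have "2 ^ \<kappa> \<le> \<kappa>" by simp
    then show False using less_exp[of \<kappa>] by simp
  qed
  then show ?thesis using that by blast
qed

text \<open>The shifts that preserve \<open>W\<close> form a subgroup of the integers, nontrivial
  because of \<open>n0\<close>; its least positive member divides all the others.\<close>

lemma stabiliser_generator:
  assumes "n0 \<noteq> 0" "shift_pow n0 ` W = W"
  obtains d where "d \<ge> 1" "shift_pow d ` W = W" "\<And>n. shift_pow n ` W = W \<Longrightarrow> d dvd n"
proof -
  define St where "St = {n. shift_pow n ` W = W}"
  have add: "m + n \<in> St" if "m \<in> St" "n \<in> St" for m n
  proof -
    have "shift_pow (m + n) ` W = shift_pow m ` shift_pow n ` W"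
      by (simp add: image_image shift_pow_simps)
    then show ?thesis using that by (simp add: St_def)
  qed
  have zero: "0 \<in> St" by (simp add: St_def shift_pow_simps image_def)
  have neg: "- n \<in> St" if "n \<in> St" for n
  proof -
    have "W = shift_pow (- n) ` shift_pow n ` W" by (simp add: image_image shift_pow_simps)
    then show ?thesis using that by (simp add: St_def)
  qed
  have mult: "k * n \<in> St" if n: "n \<in> St" for k n
  proof -
    have nat: "int j * n \<in> St" for j
      by (induction j) (use zero add n in \<open>simp_all add: algebra_simps\<close>)
    show ?thesis
    proof (cases "k \<ge> 0")
      case True then show ?thesis using nat[of "nat k"] by simp
    next
      case False then show ?thesis using neg[OF nat[of "nat (- k)"]] by simp
    qed
  qed
  have n0: "n0 \<in> St" using assms by (simp add: St_def)
  have "\<exists>k::nat. k > 0 \<and> int k \<in> St"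
    using neg[OF n0] n0 assms(1) by (intro exI[of _ "nat \<bar>n0\<bar>"]) (auto simp: abs_if)
  define k where "k = (LEAST k. k > 0 \<and> int k \<in> St)"
  have k: "k > 0" "int k \<in> St" using LeastI_ex[OF \<open>\<exists>k. _\<close>] by (auto simp: k_def)
  show ?thesis
  proof (rule that[of "int k"])
    fix n assume "shift_pow n ` W = W"
    then have "n \<in> St" by (simp add: St_def)
    then have "n + (- (n div int k)) * int k \<in> St" using mult[OF k(2)] by (intro add)
    then have r: "n mod int k \<in> St" by (simp add: minus_div_mult_eq_mod[symmetric])
    have "nat (n mod int k) < k" using k(1) by (simp add: nat_less_iff)
    then have "\<not> (nat (n mod int k) > 0 \<and> int (nat (n mod int k)) \<in> St)"
      unfolding k_def by (rule not_less_Least)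
    then have "n mod int k = 0" using r k(1) by (simp add: order.antisym)
    then show "int k dvd n" by (simp add: dvd_eq_mod_eq_0)
  qed (use k in \<open>simp_all add: St_def\<close>)
qed

section \<open>Assembly of the progression, the invariant space and the controlling set\<close>

context approx_group_lamp
begin

definition "gap_rank = freiman_rank (freiman_density (c ^ 14))"
text \<open>One number in two roles: it limits how often the chain of subspaces can grow, and it is
  the length from which a direction counts as long.\<close>

definition "kappa = fiber_const 48"
definition "cover_const = c ^ 14 * real (freiman_loss (freiman_density (c ^ 14))) * real ((2 * kappa + 1) ^ gap_rank)"
text \<open>Dominates the rank, the number of translates and the relative size of the controlling
  set; the exponent 10 is 8 + 2, from \<open>card_sumset_fiber\<close> for the 8-fold
  sumset.\<close>

definition "control_const = max (max (real gap_rank) 1) (max cover_const (real kappa * c ^ 10))"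

text \<open>Freiman covering followed by \<open>gap_split\<close>. A translate is an element of the
  projection plus a combination of discarded directions, so it has a lift in the power 9 = 1 +
  8.\<close>

lemma progression_cover:
  obtains w M Y where "gap gap_rank w M \<subseteq> sumset (fst ` S) 8"
    "Y \<subseteq> sumset (fst ` S) 9" "finite Y" "real (card Y) \<le> cover_const"
    "\<And>n. n \<in> fst ` S \<Longrightarrow> \<exists>y\<in>Y. n - y \<in>
      gap gap_rank (\<lambda>i. if i < gap_rank \<and> kappa \<le> M i \<and> w i \<noteq> 0 then w i else 0) M"
proof -
  let ?P = "fst ` S"
  have P: "finite ?P" "0 \<in> ?P" using fin one by (auto intro: image_eqI[of _ _ "(0, 0)"])
  have neg: "- n \<in> ?P" if n: "n \<in> ?P" for n
  proof -
    obtain s where "s \<in> S" "n = fst s" using n by auto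
    then show ?thesis using inv[of s] fst_inv[of s] by (intro image_eqI[of _ _ "inv\<^bsub>ext_lamplighter\<^esub> s"]) auto
  qed
  obtain w M Y1 where wM: "gap gap_rank w M \<subseteq> sumset ?P 8" and Y1: "Y1 \<subseteq> ?P"
    "real (card Y1) \<le> c ^ 14 * real (freiman_loss (freiman_density (c ^ 14)))"
    "\<And>a. a \<in> ?P \<Longrightarrow> \<exists>y\<in>Y1. a - y \<in> gap gap_rank w M"
    using freiman_int_covering[OF P neg one_le_power[OF c] sumset_12] unfolding gap_rank_def by metis
  let ?v = "\<lambda>i. if i \<in> {i. i < gap_rank \<and> kappa \<le> M i \<and> w i \<noteq> 0} then w i else 0"
  obtain Z where Z: "Z \<subseteq> gap gap_rank w M" "finite Z" "card Z \<le> (2 * kappa + 1) ^ gap_rank"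
    "\<And>x. x \<in> gap gap_rank w M \<Longrightarrow> \<exists>z\<in>Z. x - z \<in> gap gap_rank ?v M"
    by (rule gap_split[where d = gap_rank and J = kappa and M = M and w = w]) blast
  have fY1: "finite Y1" using Y1(1) P(1) by (rule finite_subset)
  define Y where "Y = (\<lambda>(y, z). y + z) ` (Y1 \<times> Z)"
  show ?thesis
  proof (rule that[OF wM])
    show "Y \<subseteq> sumset ?P 9"
    proof -
      have "y + z \<in> sumset ?P (1 + 8)" if "y \<in> Y1" "z \<in> Z" for y z
        using that Y1(1) Z(1) wM by (intro sumset_addI in_sumset_1) blast+
      then show ?thesis by (auto simp: Y_def)
    qed
    show "finite Y" using fY1 Z(2) by (simp add: Y_def)
    have "card Y \<le> card Y1 * card Z"
      unfolding Y_def using card_image_le[of "Y1 \<times> Z"] fY1 Z(2) by (simp add: card_cartesian_product)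
    then have "real (card Y) \<le> real (card Y1) * real (card Z)" by (simp flip: of_nat_mult)
    also have "\<dots> \<le> cover_const"
      unfolding cover_const_def using Y1(2) Z(3) c by (intro mult_mono of_nat_mono) auto
    finally show "real (card Y) \<le> cover_const" .
    fix n assume "n \<in> ?P"
    then obtain y where y: "y \<in> Y1" "n - y \<in> gap gap_rank w M" using Y1(3) by blast
    then obtain z where z: "z \<in> Z" "n - y - z \<in> gap gap_rank ?v M" using Z(4) by blast
    then show "\<exists>y\<in>Y. n - y \<in> gap gap_rank (\<lambda>i. if i < gap_rank \<and> kappa \<le> M i \<and> w i \<noteq> 0 then w i else 0) M"
      using y(1) by (intro bexI[of _ "y + z"]) (auto simp: Y_def algebra_simps)
  qed
qed

text \<open>Since every translate \<open>shift_pow n ` fiber S 32\<close> with \<open>n\<close> in the progression lies in the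
  bounded extension \<open>span (fiber S 48)\<close>, adding translates along the long directions must
  stabilise, and it does so at an invariant subspace.\<close>

lemma invariant_subspace:
  assumes wM: "gap r w M \<subseteq> sumset (fst ` S) 8" and I: "I \<subseteq> {i. i < r \<and> kappa \<le> M i}"
  obtains W where "seq.subspace W" "fiber S 32 \<subseteq> W" "W \<subseteq> seq.span (fiber S 48)"
    "\<And>i. i \<in> I \<Longrightarrow> shift_pow (w i) ` W = W"
proof -
  have fI: "finite I" using I by (rule finite_subset) auto
  \<comment> \<open>Sums of at most \<open>j\<close> long generators. Nonnegative coefficients
    suffice, since a shift mapping a finite space into itself is onto.\<close>
  define D where "D = (\<lambda>j. {\<Sum>i\<in>I. int (k i) * w i | k :: nat \<Rightarrow> nat. (\<Sum>i\<in>I. k i) \<le> j})"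
  have D0: "0 \<in> D 0" by (auto simp: D_def intro!: exI[of _ "\<lambda>_. 0"])
  have D_mono: "D j \<subseteq> D (Suc j)" for j by (auto simp: D_def)
  have D_step: "n + w i \<in> D (Suc j)" if n: "n \<in> D j" and i: "i \<in> I" for n i j
  proof -
    obtain k where k: "n = (\<Sum>i\<in>I. int (k i) * w i)" "(\<Sum>i\<in>I. k i) \<le> j" using n by (auto simp: D_def)
    have "(\<Sum>l\<in>I. int ((k(i := Suc (k i))) l) * w l) = (\<Sum>l\<in>I. int (k l) * w l) + w i"
    proof -
      have "(\<Sum>l\<in>I. int ((k(i := Suc (k i))) l) * w l)
          = (\<Sum>l\<in>I. int (k l) * w l + (if l = i then w i else 0))"
        by (intro sum.cong) (auto simp: algebra_simps)
      then show ?thesis using fI i by (simp add: sum.distrib)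
    qed
    moreover have "(\<Sum>l\<in>I. (k(i := Suc (k i))) l) = (\<Sum>l\<in>I. k l) + 1"
    proof -
      have "(\<Sum>l\<in>I. (k(i := Suc (k i))) l) = (\<Sum>l\<in>I. k l + (if l = i then 1 else 0))"
        by (intro sum.cong) auto
      then show ?thesis using fI i by (simp add: sum.distrib)
    qed
    ultimately show ?thesis
      unfolding D_def k(1) using k(2) by (intro CollectI exI[of _ "k(i := Suc (k i))"]) auto
  qed
  \<comment> \<open>Here the length of the directions enters: even if all \<open>kappa\<close> steps
    go in one direction, the coefficient stays within its bound.\<close>
  have D_gap: "D j \<subseteq> gap r w M" if "j \<le> kappa" for j
  proof
    fix n assume "n \<in> D j"
    then obtain k where k: "n = (\<Sum>i\<in>I. int (k i) * w i)" "(\<Sum>i\<in>I. k i) \<le> j" by (auto simp: D_def)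
    have "n = (\<Sum>i<r. (if i \<in> I then int (k i) else 0) * w i)"
      unfolding k(1) using I by (intro sum.mono_neutral_cong_left) auto
    also have "\<dots> \<in> gap r w M"
    proof (rule gapI)
      fix i assume "i < r"
      show "\<bar>if i \<in> I then int (k i) else 0\<bar> \<le> int (M i)"
      proof (cases "i \<in> I")
        case True
        then have "k i \<le> (\<Sum>i\<in>I. k i)" using fI by (intro member_le_sum) auto
        then show ?thesis using True I k(2) that by auto
      qed simp
    qed
    finally show "n \<in> gap r w M" .
  qed
  define E where "E = seq.span (fiber S 48)"
  define W where "W = (\<lambda>j. seq.span (\<Union>n\<in>D j. shift_pow n ` fiber S 32))"
  have sub: "seq.subspace (W j)" for j by (simp add: W_def seq.subspace_span)
  have mono: "W j \<subseteq> W (Suc j)" for j unfolding W_def using D_mono[of j] by (intro seq.span_mono) blast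
  have WE: "W j \<subseteq> E" if "j \<le> kappa" for j
    unfolding W_def E_def
  proof (rule seq.span_mono, rule UN_least)
    fix n assume "n \<in> D j"
    then have "n \<in> fst ` Spow 8" using D_gap[OF that] wM by (auto simp: fst_set_pow)
    \<comment> \<open>48 = 32 + 2 * 8, as elements of the progression have lifts in the eighth
      power.\<close>
    from shift_fiber[OF this, of 32] show "shift_pow n ` fiber S 32 \<subseteq> fiber S 48" by simp
  qed
  have fE: "finite E" "card E \<le> kappa * card (fiber S 2)"
    unfolding E_def kappa_def by (rule card_span_fiber)+
  have F0: "fiber S 32 \<subseteq> W 0"
  proof
    fix x assume "x \<in> fiber S 32"
    then have "shift_pow 0 x \<in> W 0" unfolding W_def using D0 by (intro seq.span_base) blast
    then show "x \<in> W 0" by (simp add: shift_pow_simps)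
  qed
  have "card (fiber S 2) \<le> card (W 0)"
    using fiber_mono[of 2 32] F0 WE[of 0] fE(1) by (intro card_mono) (auto intro: finite_subset)
  then have "card (W kappa) \<le> kappa * card (W 0)"
    using card_mono[OF fE(1) WE[OF order_refl]] fE(2) by (meson mult_le_mono2 order_trans)
  then obtain j where j: "j < kappa" "W (Suc j) = W j"
    using subspace_chain_stabilises[of W kappa, OF sub mono] finite_subset[OF WE[OF order_refl] fE(1)] by blast
  show ?thesis
  proof (rule that[of "W j"])
    show "fiber S 32 \<subseteq> W j" using F0 lift_Suc_mono_le[of W, OF mono, of 0 j] by blast
    show "W j \<subseteq> seq.span (fiber S 48)" using WE[of j] j(1) by (simp add: E_def)
    fix i assume i: "i \<in> I"
    have "shift_pow (w i) ` W j \<subseteq> seq.span (shift_pow (w i) ` (\<Union>n\<in>D j. shift_pow n ` fiber S 32))"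
      unfolding W_def by (rule shift_pow_span)
    also have "\<dots> \<subseteq> W (Suc j)"
      unfolding W_def
    proof (rule seq.span_mono)
      show "shift_pow (w i) ` (\<Union>n\<in>D j. shift_pow n ` fiber S 32) \<subseteq> (\<Union>n\<in>D (Suc j). shift_pow n ` fiber S 32)"
      proof clarify
        fix n x assume nx: "n \<in> D j" "x \<in> fiber S 32"
        then have "shift_pow (w i) (shift_pow n x) = shift_pow (n + w i) x"
          by (simp add: shift_pow_simps add.commute)
        then show "shift_pow (w i) (shift_pow n x) \<in> (\<Union>n\<in>D (Suc j). shift_pow n ` fiber S 32)"
          using D_step[OF nx(1) i] nx(2) by blast
      qed
    qed
    finally have le: "shift_pow (w i) ` W j \<subseteq> W j" using j(2) by simp
    have "finite (W j)" using WE[of j] j(1) fE(1) by (auto intro: finite_subset)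
    then show "shift_pow (w i) ` W j = W j"
      using le inj_on_subset[OF inj_shift_pow] by (intro card_subset_eq) (auto simp: card_image)
  qed (rule sub)
qed

lemma control_const_bounds:
  "1 \<le> control_const" "real gap_rank \<le> control_const" "cover_const \<le> control_const"
  "real kappa * c ^ 10 \<le> control_const"
  by (auto simp: control_const_def)

text \<open>The second alternative is asserted for every larger \<open>R\<close> so that it survives
  the enlargement of the constant needed to pass from \<open>S\<close> to \<open>A\<close>.\<close>

theorem controlled_structure:
  obtains V B X where "finite X" "real (card X) \<le> control_const" "finite B" "B \<noteq> {}"
    "real (card B) \<le> control_const * real (card S)"
    "S \<subseteq> X <#>\<^bsub>ext_lamplighter\<^esub> B" "S \<subseteq> B <#>\<^bsub>ext_lamplighter\<^esub> X"
    "V \<subseteq> seq.span (fiber S 48)"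
    "case1_form V B \<or> (\<forall>R\<ge>control_const. case2_form R V B)"
proof -
  obtain w M Y where wM: "gap gap_rank w M \<subseteq> sumset (fst ` S) 8"
    and Y: "Y \<subseteq> sumset (fst ` S) 9" "finite Y" "real (card Y) \<le> cover_const"
    and cover: "\<And>n. n \<in> fst ` S \<Longrightarrow> \<exists>y\<in>Y. n - y \<in>
      gap gap_rank (\<lambda>i. if i < gap_rank \<and> kappa \<le> M i \<and> w i \<noteq> 0 then w i else 0) M"
    by (rule progression_cover) blast
  define I where "I = {i. i < gap_rank \<and> kappa \<le> M i \<and> w i \<noteq> 0}"
  have "I \<subseteq> {i. i < gap_rank \<and> kappa \<le> M i}" by (auto simp: I_def)
  then obtain W where W: "seq.subspace W" "fiber S 32 \<subseteq> W" "W \<subseteq> seq.span (fiber S 48)"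
    "\<And>i. i \<in> I \<Longrightarrow> shift_pow (w i) ` W = W"
    by (rule invariant_subspace[OF wM]) blast
  have fW: "finite W" using W(3) card_span_fiber(1) by (rule finite_subset)
  have cW: "card W \<le> kappa * card (fiber S 2)"
    using card_mono[OF card_span_fiber(1) W(3)] card_span_fiber(2)[of 48] by (simp add: kappa_def)
  define v where "v = (\<lambda>i. if i \<in> I then w i else 0)"
  \<comment> \<open>Outside \<open>I\<close> the generator is 0, so resetting its bound to 1 does
    not change the progression and satisfies the requirement of \<open>int_gap\<close> that bounds
    be at least 1.\<close>
  define N where "N = (\<lambda>i. if i \<in> I then M i else 1)"
  define P where "P = gap gap_rank v N"
  have PM: "P = gap gap_rank v M"
  proof
    have *: "gap gap_rank v N1 \<subseteq> gap gap_rank v N2" if "\<And>i. i \<in> I \<Longrightarrow> N1 i = N2 i" for N1 N2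
    proof
      fix x assume "x \<in> gap gap_rank v N1"
      then obtain n where n: "x = (\<Sum>i<gap_rank. n i * v i)" "\<And>i. i < gap_rank \<Longrightarrow> \<bar>n i\<bar> \<le> int (N1 i)"
        by (rule gapE) blast
      have "x = (\<Sum>i<gap_rank. (if i \<in> I then n i else 0) * v i)"
        unfolding n(1) by (intro sum.cong) (auto simp: v_def)
      also have "\<dots> \<in> gap gap_rank v N2"
        using n(2) that by (intro gapI) fastforce
      finally show "x \<in> gap gap_rank v N2" .
    qed
    show "P \<subseteq> gap gap_rank v M" unfolding P_def by (rule *) (simp add: N_def)
    show "gap gap_rank v M \<subseteq> P" unfolding P_def by (rule *) (simp add: N_def)
  qed
  have P8: "P \<subseteq> sumset (fst ` S) 8"
  proof
    fix x assume "x \<in> P"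
    then obtain n where n: "x = (\<Sum>i<gap_rank. n i * v i)" "\<And>i. i < gap_rank \<Longrightarrow> \<bar>n i\<bar> \<le> int (M i)"
      unfolding PM by (rule gapE) blast
    have "x = (\<Sum>i<gap_rank. (if i \<in> I then n i else 0) * w i)"
      unfolding n(1) by (intro sum.cong) (auto simp: v_def)
    also have "\<dots> \<in> gap gap_rank w M" using n(2) by (intro gapI) auto
    finally show "x \<in> sumset (fst ` S) 8" using wM by blast
  qed
  have fP: "finite P" by (simp add: P_def finite_gap)
  have P0: "0 \<in> P" unfolding P_def using gapI[of gap_rank "\<lambda>_. 0" N v] by simp
  define \<phi> where "\<phi> = lift 8"
  have \<phi>: "(n, \<phi> n) \<in> Spow 8" if "n \<in> P" for n
    unfolding \<phi>_def using that P8 by (intro lift) blast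
  \<comment> \<open>The limit 32 is needed for two products of two lifts, 16 + 16; both covering
    arguments get by with 18.\<close>
  have inW: "x - y \<in> W" if "(n, x) \<in> Spow a" "(n, y) \<in> Spow b" "a + b \<le> 32" for n x y a b
    using fiber_diff[OF that(1,2)] fiber_mono[of "b + a" 32] that(3) W(2) by auto
  define B where "B = {(n, \<phi> n + u) | n u. n \<in> P \<and> u \<in> W}"
  have B_img: "B = (\<lambda>(n, u). (n, \<phi> n + u)) ` (P \<times> W)" by (auto simp: B_def)
  define X where "X = (\<lambda>y. (y, lift 9 y)) ` Y"
  have X9: "(y, lift 9 y) \<in> Spow 9" if "y \<in> Y" for y using that Y(1) by (intro lift) blast
  have coverP: "\<exists>y\<in>Y. n - y \<in> P" if "n \<in> fst ` S" for n
    using cover[OF that] unfolding PM v_def I_def by simp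
  have int_gap_P: "int_gap gap_rank P"
    unfolding int_gap_def
  proof (intro exI[of _ v] exI[of _ "\<lambda>i. real (N i)"] conjI allI impI)
    fix i assume "i < gap_rank"
    have "kappa \<ge> 1" by (simp add: kappa_def fiber_const_def)
    then show "1 \<le> real (N i)" by (auto simp: N_def I_def)
  next
    have "real_of_int \<bar>x\<bar> \<le> real m \<longleftrightarrow> \<bar>x\<bar> \<le> int m" for x :: int and m :: nat by linarith
    then show "P = {\<Sum>i<gap_rank. n i * v i |n. \<forall>i<gap_rank. real_of_int \<bar>n i\<bar> \<le> real (N i)}"
      by (simp add: P_def gap_def)
  qed
  have fin_dim: "fin_dim_subspace W"
    unfolding fin_dim_subspace_def using W(1) fW seq.span_eq_iff[of W] by blast
  show ?thesis
  proof (rule that[of X B W])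
    show "finite X" using Y(2) by (simp add: X_def)
    have "card X \<le> card Y" unfolding X_def by (rule card_image_le[OF Y(2)])
    then show "real (card X) \<le> control_const" using Y(3) control_const_bounds by linarith
    show "finite B" unfolding B_img using fP fW by simp
    show "B \<noteq> {}" using P0 seq.subspace_0[OF W(1)] by (auto simp: B_def)
    have "card B \<le> card P * card W"
      unfolding B_img using card_image_le[of "P \<times> W"] fP fW by (simp add: card_cartesian_product)
    also have "\<dots> \<le> card (sumset (fst ` S) 8) * (kappa * card (fiber S 2))"
      using card_mono[OF finite_sumset P8] fin cW by (intro mult_le_mono) auto
    finally have "card B \<le> kappa * (card (sumset (fst ` S) 8) * card (fiber S 2))"
      by (simp add: algebra_simps)
    then have "real (card B) \<le> real kappa * real (card (sumset (fst ` S) 8) * card (fiber S 2))"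
      by (simp flip: of_nat_mult)
    also have "\<dots> \<le> real kappa * (c ^ (8 + 2) * real (card S))"
      by (intro mult_left_mono card_sumset_fiber) simp
    also have "\<dots> = (real kappa * c ^ 10) * real (card S)" by simp
    also have "\<dots> \<le> control_const * real (card S)"
      by (intro mult_right_mono control_const_bounds) simp
    finally show "real (card B) \<le> control_const * real (card S)" .
    show "S \<subseteq> X <#>\<^bsub>ext_lamplighter\<^esub> B"
    proof
      fix s assume s: "s \<in> S"
      obtain n x where nx: "s = (n, x)" by fastforce
      obtain y where y: "y \<in> Y" "n - y \<in> P" using coverP[of n] s nx by force
      define h where "h = (y, lift 9 y) \<otimes>\<^bsub>ext_lamplighter\<^esub> (n - y, \<phi> (n - y))"
      have h: "h \<in> Spow (9 + 8)" unfolding h_def by (rule Spow_mult[OF X9[OF y(1)] \<phi>[OF y(2)]])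
      obtain x' where x': "h = (n, x')" unfolding h_def by simp
      have "x - x' \<in> W" using inW[of n x "Suc 0" x' 17] h s nx x' by (simp add: Spow_1)
      then have "(n - y, \<phi> (n - y) + (x - x')) \<in> B" using y(2) by (auto simp: B_def)
      moreover have "s = (y, lift 9 y) \<otimes>\<^bsub>ext_lamplighter\<^esub> (n - y, \<phi> (n - y) + (x - x'))"
        using x' by (simp add: nx h_def algebra_simps)
      ultimately show "s \<in> X <#>\<^bsub>ext_lamplighter\<^esub> B"
        using y(1) by (auto simp: X_def intro: lamp.set_multI simp del: mult_ext_lamplighter)
    qed
    show "S \<subseteq> B <#>\<^bsub>ext_lamplighter\<^esub> X"
    proof
      fix s assume s: "s \<in> S"
      obtain n x where nx: "s = (n, x)" by fastforce
      obtain y where y: "y \<in> Y" "n - y \<in> P" using coverP[of n] s nx by force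
      define g where "g = s \<otimes>\<^bsub>ext_lamplighter\<^esub> inv\<^bsub>ext_lamplighter\<^esub> (y, lift 9 y)"
      have g: "g \<in> Spow (Suc 0 + 9)"
        unfolding g_def using s by (intro Spow_mult Spow_inv X9 y(1)) (simp add: Spow_1)
      have "fst g = n - y" unfolding g_def fst_mult fst_inv by (simp add: nx)
      then obtain x' where x': "g = (n - y, x')" by (metis prod.collapse)
      have "x' - \<phi> (n - y) \<in> W" using inW[of "n - y" x' 10 "\<phi> (n - y)" 8] g x' \<phi>[OF y(2)] by simp
      then have "(n - y, \<phi> (n - y) + (x' - \<phi> (n - y))) \<in> B" using y(2) unfolding B_def by blast
      then have "g \<in> B" by (simp add: x')
      moreover have "s = g \<otimes>\<^bsub>ext_lamplighter\<^esub> (y, lift 9 y)"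
        unfolding g_def by (simp add: lamp.m_assoc del: mult_ext_lamplighter)
      ultimately show "s \<in> B <#>\<^bsub>ext_lamplighter\<^esub> X"
        using y(1) by (auto simp: X_def intro: lamp.set_multI simp del: mult_ext_lamplighter)
    qed
    show "W \<subseteq> seq.span (fiber S 48)" by (rule W(3))
    show "case1_form W B \<or> (\<forall>R\<ge>control_const. case2_form R W B)"
    proof (cases "I = {}")
      case True
      then have "P = {0}" using P0 by (auto simp: P_def v_def elim: gapE)
      then have "B = {0} \<times> W" by (auto simp: B_def \<phi>_def lift_def)
      then show ?thesis using fin_dim by (simp add: case1_form_def)
    next
      case False
      then obtain i where i: "i \<in> I" by auto
      then have "w i \<noteq> 0" by (simp add: I_def)
      then obtain d where d: "d \<ge> 1" "shift_pow d ` W = W" "\<And>n. shift_pow n ` W = W \<Longrightarrow> d dvd n"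
        using stabiliser_generator[of "w i" W] W(4)[OF i] by metis
      have "P \<subseteq> {n. d dvd n}"
      proof
        fix x assume "x \<in> P"
        then obtain n where "x = (\<Sum>i<gap_rank. n i * v i)" unfolding P_def by (rule gapE) blast
        \<comment> \<open>Generators in \<open>I\<close> preserve \<open>W\<close>, and the others
          have been set to 0.\<close>
        moreover have "d dvd v i" for i using d(3)[OF W(4)] by (simp add: v_def)
        ultimately show "x \<in> {n. d dvd n}" by (auto intro!: dvd_sum dvd_mult)
      qed
      moreover have "eq_mod W ((n1, \<phi> n1) \<otimes>\<^bsub>ext_lamplighter\<^esub> (n2, \<phi> n2)) ((n3, \<phi> n3) \<otimes>\<^bsub>ext_lamplighter\<^esub> (n4, \<phi> n4))"
        if n: "n1 \<in> P" "n2 \<in> P" "n3 \<in> P" "n4 \<in> P" "n1 + n2 = n3 + n4" for n1 n2 n3 n4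
      proof -
        have "(n1, \<phi> n1) \<otimes>\<^bsub>ext_lamplighter\<^esub> (n2, \<phi> n2) \<in> Spow (8 + 8)"
          "(n3, \<phi> n3) \<otimes>\<^bsub>ext_lamplighter\<^esub> (n4, \<phi> n4) \<in> Spow (8 + 8)"
          by (rule Spow_mult[OF \<phi>[OF n(1)] \<phi>[OF n(2)]], rule Spow_mult[OF \<phi>[OF n(3)] \<phi>[OF n(4)]])
        then show ?thesis
          using inW[of "n1 + n2" "shift_pow n2 (\<phi> n1) + \<phi> n2" 16 "shift_pow n4 (\<phi> n3) + \<phi> n4" 16] n(5)
          by (simp add: eq_mod_def)
      qed
      moreover have "real gap_rank \<le> R" if "R \<ge> control_const" for R
        using that control_const_bounds(2) by simp
      ultimately have "case2_form R W B" if "R \<ge> control_const" for R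
        unfolding case2_form_def using that fin_dim d(1,2) int_gap_P B_def by blast
      then show ?thesis by blast
    qed
  qed
qed

end

theorem theorem1p7:
  fixes K :: real
  assumes "K \<ge> 1"
  shows "\<exists>C :: real. C \<ge> 1 \<and>
    (\<forall>A :: (int \<times> seq) set.
       A \<subseteq> carrier ext_lamplighter \<and> finite A \<and> A \<noteq> {} \<and>
       real (card (A <#>\<^bsub>ext_lamplighter\<^esub> A)) \<le> K * real (card A) \<longrightarrow>
         (\<exists>V B. controlled ext_lamplighter C A B \<and>
            (case1_form V B \<or> case2_form C V B)) \<and>
         (A \<subseteq> lamplighter \<longrightarrow>
           (\<exists>V B. controlled ext_lamplighter C A B \<and>
              (case1_form V B \<and> V \<subseteq> fin_supp_seqs \<or> case2_form C V B \<and> V = {0}))))"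
proof -
  \<comment> \<open>\<open>control_const\<close> has \<open>c\<close> as its only parameter, so this
    number is fixed before \<open>A\<close> is chosen.\<close>
  define \<kappa> where "\<kappa> = approx_group_lamp.control_const (K ^ 72)"
  \<comment> \<open>4 K^81 absorbs both losses: 2 * (2 K^8) for the translates taken in two orders,
    and K^81 for comparing \<open>S\<close> with \<open>A\<close>.\<close>
  define C where "C = \<kappa> * (4 * K ^ 81)"
  have "1 \<le> \<kappa>"
  proof -
    \<comment> \<open>The trivial subgroup is an instance of the locale, used to obtain the bound on
      \<kappa> before any \<open>S\<close> is at hand.\<close>
    have "approx_group_lamp {(0, 0)} (K ^ 72)"
    proof
      show "real (card (set_pow ext_lamplighter {(0, 0)} m)) \<le> (K ^ 72) ^ m * real (card {(0::int, 0::seq)})" for m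
      proof -
        have "set_pow ext_lamplighter {(0, 0)} m \<subseteq> {(0, 0)}"
          using lamp.set_pow_subset_subgroup[OF lamp.triv_subgroup, of "{(0, 0)}" m] by simp
        then have "card (set_pow ext_lamplighter {(0, 0)} m) \<le> 1"
          using card_mono[of "{(0::int, 0::seq)}"] by fastforce
        moreover have "1 \<le> (K ^ 72) ^ m * real (card {(0::int, 0::seq)})"
          using assms by simp
        ultimately show ?thesis by linarith
      qed
      show "inv\<^bsub>ext_lamplighter\<^esub> s \<in> {(0, 0)}" if "s \<in> {(0, 0)}" for s
        using that lamp.inv_one by simp
    qed (use assms in auto)
    then show ?thesis unfolding \<kappa>_def by (rule approx_group_lamp.control_const_bounds(1))
  qed
  have K81: "1 \<le> K ^ 81" "K ^ 8 \<le> K ^ 81" using assms by (auto intro: power_increasing)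
  have C\<kappa>: "\<kappa> \<le> C" "\<kappa> * K ^ 81 \<le> C" "\<kappa> * (4 * K ^ 8) \<le> C"
  proof -
    show "\<kappa> * K ^ 81 \<le> C" "\<kappa> * (4 * K ^ 8) \<le> C"
      unfolding C_def using assms \<open>1 \<le> \<kappa>\<close> K81 by (auto intro!: mult_left_mono)
    have "\<kappa> * 1 \<le> \<kappa> * K ^ 81" using \<open>1 \<le> \<kappa>\<close> K81 by (intro mult_left_mono) auto
    then show "\<kappa> \<le> C" using \<open>\<kappa> * K ^ 81 \<le> C\<close> by simp
  qed
  have C1: "1 \<le> C" using C\<kappa>(1) \<open>1 \<le> \<kappa>\<close> by simp
  have main: "\<exists>V B. controlled ext_lamplighter C A B \<and> (case1_form V B \<or> case2_form C V B) \<and>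
      (A \<subseteq> lamplighter \<longrightarrow> V \<subseteq> fin_supp_seqs \<and> (case2_form C V B \<longrightarrow> V = {0}))"
    if A: "finite A" "A \<noteq> {}" "real (card (A <#>\<^bsub>ext_lamplighter\<^esub> A)) \<le> K * real (card A)" for A
  proof -
    obtain S Y where S: "finite S" "\<one>\<^bsub>ext_lamplighter\<^esub> \<in> S" "\<And>s. s \<in> S \<Longrightarrow> inv\<^bsub>ext_lamplighter\<^esub> s \<in> S"
      "\<And>H. subgroup H ext_lamplighter \<Longrightarrow> A \<subseteq> H \<Longrightarrow> S \<subseteq> H"
      "\<And>m. real (card (set_pow ext_lamplighter S m)) \<le> (K ^ 72) ^ m * real (card S)"
      "real (card S) \<le> K ^ 81 * real (card A)"
      and Y: "finite Y" "real (card Y) \<le> 2 * K ^ 8"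
        "A \<subseteq> Y <#>\<^bsub>ext_lamplighter\<^esub> S" "A \<subseteq> S <#>\<^bsub>ext_lamplighter\<^esub> Y"
      by (rule lamp.approximate_group_covering[OF A(1,2) _ A(3) assms]) simp_all
    interpret approx_group_lamp S "K ^ 72"
      by unfold_locales (use S assms in simp_all)
    obtain V B X where X: "finite X" "real (card X) \<le> \<kappa>" and B: "finite B" "B \<noteq> {}"
      "real (card B) \<le> \<kappa> * real (card S)"
      and SXB: "S \<subseteq> X <#>\<^bsub>ext_lamplighter\<^esub> B" "S \<subseteq> B <#>\<^bsub>ext_lamplighter\<^esub> X"
      and V: "V \<subseteq> seq.span (fiber S 48)" "case1_form V B \<or> (\<forall>R\<ge>\<kappa>. case2_form R V B)"
      unfolding \<kappa>_def by (rule controlled_structure)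
    \<comment> \<open>One set of translates has to work on both sides, so both orders of
      multiplication are united.\<close>
    define X' where "X' = (Y <#>\<^bsub>ext_lamplighter\<^esub> X) \<union> (X <#>\<^bsub>ext_lamplighter\<^esub> Y)"
    have AB: "A \<subseteq> X' <#>\<^bsub>ext_lamplighter\<^esub> B" "A \<subseteq> B <#>\<^bsub>ext_lamplighter\<^esub> X'"
    proof -
      have "A \<subseteq> Y <#>\<^bsub>ext_lamplighter\<^esub> (X <#>\<^bsub>ext_lamplighter\<^esub> B)"
        using Y(3) lamp.set_mult_subset[OF order_refl SXB(1)] by (rule order_trans)
      also have "\<dots> = (Y <#>\<^bsub>ext_lamplighter\<^esub> X) <#>\<^bsub>ext_lamplighter\<^esub> B"
        by (simp add: lamp.set_mult_assoc)
      also have "\<dots> \<subseteq> X' <#>\<^bsub>ext_lamplighter\<^esub> B" by (rule lamp.set_mult_subset) (auto simp: X'_def)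
      finally show "A \<subseteq> X' <#>\<^bsub>ext_lamplighter\<^esub> B" .
      have "A \<subseteq> (B <#>\<^bsub>ext_lamplighter\<^esub> X) <#>\<^bsub>ext_lamplighter\<^esub> Y"
        using Y(4) lamp.set_mult_subset[OF SXB(2) order_refl] by (rule order_trans)
      also have "\<dots> = B <#>\<^bsub>ext_lamplighter\<^esub> (X <#>\<^bsub>ext_lamplighter\<^esub> Y)"
        by (simp add: lamp.set_mult_assoc)
      also have "\<dots> \<subseteq> B <#>\<^bsub>ext_lamplighter\<^esub> X'" by (rule lamp.set_mult_subset) (auto simp: X'_def)
      finally show "A \<subseteq> B <#>\<^bsub>ext_lamplighter\<^esub> X'" .
    qed
    have "controlled ext_lamplighter C A B"
      unfolding controlled_def
    proof (intro conjI exI[of _ X'])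
      show "finite X'" unfolding X'_def using X(1) Y(1) by (simp add: lamp.finite_set_mult)
      show "X' \<noteq> {}" using AB(1) A(2) by (auto simp: set_mult_def)
      have "card X' \<le> card (Y <#>\<^bsub>ext_lamplighter\<^esub> X) + card (X <#>\<^bsub>ext_lamplighter\<^esub> Y)"
        unfolding X'_def by (rule card_Un_le)
      also have "\<dots> \<le> card Y * card X + card X * card Y"
        by (intro add_mono lamp.card_set_mult_le X(1) Y(1))
      also have "\<dots> = 2 * (card X * card Y)" by simp
      finally have "real (card X') \<le> real (2 * (card X * card Y))" by (rule of_nat_mono)
      then have "real (card X') \<le> 2 * (real (card X) * real (card Y))"
        by simp
      also have "\<dots> \<le> 2 * (\<kappa> * (2 * K ^ 8))"
        using X(2) Y(2) \<open>1 \<le> \<kappa>\<close> by (intro mult_left_mono mult_mono) auto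
      also have "\<dots> \<le> C" using C\<kappa>(3) by simp
      finally show "real (card X') \<le> C" .
      have "\<kappa> * real (card S) \<le> \<kappa> * (K ^ 81 * real (card A))"
        using S(6) \<open>1 \<le> \<kappa>\<close> by (intro mult_left_mono) auto
      also have "\<dots> \<le> C * real (card A)"
        using mult_right_mono[OF C\<kappa>(2), of "real (card A)"] by simp
      finally show "real (card B) \<le> C * real (card A)" using B(3) by linarith
    qed (use A B C1 AB in auto)
    moreover have "case1_form V B \<or> case2_form C V B"
      using V(2) C\<kappa>(1) by blast
    \<comment> \<open>\<open>S\<close> and its powers stay in the subgroup, so the span of
      \<open>fiber S 48\<close> is finitely supported and \<open>V\<close> with it; in Case 2
      invariance under a positive shift then leaves only 0.\<close>
    moreover have "V \<subseteq> fin_supp_seqs \<and> (case2_form C V B \<longrightarrow> V = {0})" if "A \<subseteq> lamplighter"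
    proof
      have "set_pow ext_lamplighter S 48 \<subseteq> lamplighter"
        using S(4)[OF subgroup_lamplighter that] by (rule lamp.set_pow_subset_subgroup[OF subgroup_lamplighter])
      then have "fiber S 48 \<subseteq> fin_supp_seqs" by (auto simp: fiber_def lamplighter_def)
      then show sup: "V \<subseteq> fin_supp_seqs"
        using V(1) seq.span_minimal[OF _ subspace_fin_supp] by blast
      show "case2_form C V B \<longrightarrow> V = {0}"
      proof
        assume c2: "case2_form C V B"
        then obtain d where "d \<ge> 1" "shift_pow d ` V = V" unfolding case2_form_def by blast
        moreover have "finite V" using V(1) card_span_fiber(1) by (rule finite_subset)
        ultimately have "V \<subseteq> {0}" using sup by (intro finite_invariant_fin_supp) auto
        moreover have "0 \<in> V"
          using c2 seq.subspace_0 by (auto simp: case2_form_def fin_dim_subspace_def)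
        ultimately show "V = {0}" by blast
      qed
    qed
    ultimately show ?thesis by blast
  qed
  show ?thesis
  proof (intro exI[of _ C] conjI allI impI)
    fix A :: "(int \<times> seq) set"
    assume A: "A \<subseteq> carrier ext_lamplighter \<and> finite A \<and> A \<noteq> {} \<and>
       real (card (A <#>\<^bsub>ext_lamplighter\<^esub> A)) \<le> K * real (card A)"
    then obtain V B where VB: "controlled ext_lamplighter C A B" "case1_form V B \<or> case2_form C V B"
      "A \<subseteq> lamplighter \<longrightarrow> V \<subseteq> fin_supp_seqs \<and> (case2_form C V B \<longrightarrow> V = {0})"
      using main[of A] by blast
    show "\<exists>V B. controlled ext_lamplighter C A B \<and> (case1_form V B \<or> case2_form C V B)"
      using VB by blast
    assume "A \<subseteq> lamplighter"
    then show "\<exists>V B. controlled ext_lamplighter C A B \<and>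
        (case1_form V B \<and> V \<subseteq> fin_supp_seqs \<or> case2_form C V B \<and> V = {0})"
      using VB by blast
  qed (rule C1)
qed

end
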